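(* Let $N\ge 1$ be an integer, let $0<\lambda<N$ if $N=1,2$ and $N-2\le\lambda<N$ if $N\ge 3$, and let $p=2N/(2N-\lambda)$. Then for all (complex-valued) $f,g\in L^p(\mathbb{R}^N)$, $$ \left|\iint_{\mathbb{R}^N\times\mathbb{R}^N}\frac{\overline{f(x)}\,g(y)}{|x-y|^{\lambda}}\,dx\,dy\right|\le \mathcal H_{N,\lambda}\,\|f\|_p\,\|g\|_p , $$ where $$ \mathcal H_{N,\lambda}=\pi^{\lambda/2}\,\frac{\Gamma((N-\lambda)/2)}{\Gamma(N-\lambda/2)}\left(\frac{\Gamma(N)}{\Gamma(N/2)}\right)^{1-\lambda/N}. $$ Equality holds if and only if $f\equiv 0$ or $g\equiv 0$ or $$ f(x)=c\left(b^2+|x-a|^2\right)^{-(2N-\lambda)/2}\quad\text{and}\quad g(x)=c'\left(b^2+|x-a|^2\right)^{-(2N-\lambda)/2} $$ for some $a\in\mathbb{R}^N$, $b>0$ and $c,c'\in\mathbb{C}$.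
   Context: $\|\cdot\|_p$ is the norm of $L^p(\mathbb{R}^N)$ with respect to Lebesgue measure, and $\Gamma$ is the Gamma function. Identities between functions are understood almost everywhere. *)

theory Defs
  imports "HOL-Analysis.Analysis"
begin

definition Lp_norm :: "real \<Rightarrow> ('a::euclidean_space \<Rightarrow> complex) \<Rightarrow> real" where
  "Lp_norm p f = (\<integral>x. norm (f x) powr p \<partial>lebesgue) powr (1 / p)"

text \<open>
  The elements are functions, not equivalence classes; identities between them are
  therefore stated almost everywhere.
\<close>

definition Lp_space :: "real \<Rightarrow> ('a::euclidean_space \<Rightarrow> complex) set" where
  "Lp_space p =
    {f \<in> borel_measurable lebesgue. integrable lebesgue (\<lambda>x. norm (f x) powr p)}"

text \<open>
  On the null set \<open>x = y\<close> the division convention makes the integrand \<open>0\<close>.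
\<close>

definition HLS_integrand ::
    "real \<Rightarrow> ('a::euclidean_space \<Rightarrow> complex) \<Rightarrow> ('a \<Rightarrow> complex) \<Rightarrow> 'a \<times> 'a \<Rightarrow> complex" where
  "HLS_integrand l f g = (\<lambda>(x, y). cnj (f x) * g y / of_real (norm (x - y) powr l))"

definition HLS_const :: "nat \<Rightarrow> real \<Rightarrow> real" where
  "HLS_const N l =
     pi powr (l / 2) * (Gamma ((real N - l) / 2) / Gamma (real N - l / 2))
       * (Gamma (real N) / Gamma (real N / 2)) powr (1 - l / real N)"

definition HLS_optimizer :: "real \<Rightarrow> 'a::euclidean_space \<Rightarrow> real \<Rightarrow> 'a \<Rightarrow> real" where
  "HLS_optimizer l a b x =
     (b\<^sup>2 + (norm (x - a))\<^sup>2) powr (- ((2 * real DIM('a) - l) / 2))"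

end

(* The form I(f,g) is invariant under inversions in spheres and reflections in hyperplanes, acting as
   isometries of L^p. Replacing f on one side of such a sphere by the maximum of f and its reflection, and on
   the other side by the minimum, increases I(f,f) strictly unless f and its reflection are ordered on each side.
   Hence a maximizer is ordered with respect to every sphere; as the reflection preserves the norm, f is even
   invariant under the reflection in every sphere that bisects the mass of f^p. Bisecting hyperplanes give a
   center of symmetry c, a bisecting sphere about c gives a radius r, and the resulting antipodal map
   exchanges the two sides of all spheres with center a and radius (r^2 + |a-c|^2)^(1/2), which therefore
   bisect as well. Only multiples of (r^2 + |x-c|^2)^(-(2N-l)/2) have all these symmetries.

   Polarizing in the right direction preserves the class of functions with f <= C (1+|x|^2)^(-(2N-l)/2)
   and norm at most 1, on which a maximizer exists by compactness. This gives the constant on the class,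
   and letting C tend to infinity gives the inequality in general. Positive definiteness of I and strict
   convexity of the norm reduce a pair f, g to a single function. *)

theory Submission
  imports Defs "HOL-Probability.Distributions" "HOL-Probability.Distribution_Functions"
    "HOL-Complex_Analysis.Great_Picard"
begin

text \<open>The norm and the form share a noncompact group of conformal symmetries, so maximizing
  sequences may concentrate or spread out. Domination by a multiple of the one optimizer
  \<open>HLS_optimizer l 0 1\<close> removes this freedom, but it also breaks the symmetry: a
  polarization keeps the bound if it moves the larger values to the side on which that optimizer
  exceeds its own pullback. Each of the spheres and hyperplanes in question has such a side, and
  comparability on one side is equivalent to comparability on the other, so this one-sided
  information suffices. Stereographic projection is the hidden picture. Spheres with squared radius
  \<open>b^2 + |a - c|^2\<close> are images of great spheres, their inversions come from orthogonal
  reflections, and the optimizer with center \<open>c\<close> and scale \<open>b\<close> stands for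
  a constant function. Rigidity needs no regularity of \<open>f\<close>: the quotient of
  \<open>f\<close> by the optimizer is invariant under each of these inversions up to a null set,
  and Fubini's theorem in point and center, together with the differentiable dependence of the image
  on the center, makes it constant almost everywhere.\<close>

section \<open>Inversions and the change of variables\<close>

text \<open>
  Division by zero makes the inversion fix its center; accordingly \<open>inversion_weight\<close> is \<open>1\<close> there.
\<close>

definition inversion :: "'a::real_inner \<Rightarrow> real \<Rightarrow> 'a \<Rightarrow> 'a" where
  "inversion a r x = a + (r / norm (x - a))\<^sup>2 *\<^sub>R (x - a)"

lemma norm_inversion_diff: "norm (inversion a r x - a) = r\<^sup>2 / norm (x - a)"
  by (cases "x = a") (auto simp: inversion_def power2_eq_square)

lemma inversion_eq_center_iff: "r \<noteq> 0 \<Longrightarrow> inversion a r x = a \<longleftrightarrow> x = a"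
  by (auto simp: inversion_def)

lemma inversion_inversion: assumes "r \<noteq> 0" shows "inversion a r (inversion a r x) = x"
proof (cases "x = a")
  case False
  define n where "n = norm (x - a)"
  have n: "n \<noteq> 0" using False by (simp add: n_def)
  have "inversion a r (inversion a r x) = a + (r / norm (inversion a r x - a))\<^sup>2 *\<^sub>R (inversion a r x - a)"
    by (simp add: inversion_def)
  also have "\<dots> = a + (n / r)\<^sup>2 *\<^sub>R (inversion a r x - a)"
    unfolding norm_inversion_diff n_def[symmetric] using n assms
    by (simp add: power2_eq_square field_simps)
  also have "\<dots> = a + ((n / r)\<^sup>2 * (r / n)\<^sup>2) *\<^sub>R (x - a)"
    by (simp add: inversion_def n_def)
  also have "(n / r)\<^sup>2 * (r / n)\<^sup>2 = 1"
    using n assms by (simp add: power_divide)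
  finally show ?thesis by simp
qed (simp add: inversion_def)

text \<open>Each point contributes its own factor. This is why a power of the distance transforms by
  a product of weights, and it is the source of the conformal invariance of the form. The squares of
  both sides agree after expansion.\<close>

lemma dist_inversion:
  assumes "x \<noteq> a" "y \<noteq> a" "r > 0"
  shows "norm (inversion a r x - inversion a r y) =
    (r / norm (x - a)) * (r / norm (y - a)) * norm (x - y)"
proof -
  define u v where "u = x - a" and "v = y - a"
  have n: "norm u \<noteq> 0" "norm v \<noteq> 0" using assms by (auto simp: u_def v_def)
  have eq: "u \<bullet> u = (norm u)\<^sup>2" "v \<bullet> v = (norm v)\<^sup>2" by (simp_all add: dot_square_norm)
  have gen: "(norm (s *\<^sub>R u - t *\<^sub>R v))\<^sup>2 = s\<^sup>2 * (u \<bullet> u) - 2 * s * t * (u \<bullet> v) + t\<^sup>2 * (v \<bullet> v)" for s t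
    unfolding power2_norm_eq_inner
    by (simp add: inner_commute[of v u] power2_eq_square algebra_simps)
  have "(norm (inversion a r x - inversion a r y))\<^sup>2 =
      (norm ((r / norm u)\<^sup>2 *\<^sub>R u - (r / norm v)\<^sup>2 *\<^sub>R v))\<^sup>2"
    by (simp add: inversion_def u_def v_def)
  also have "\<dots> = ((r / norm u)\<^sup>2)\<^sup>2 * (u \<bullet> u) - 2 * (r / norm u)\<^sup>2 * (r / norm v)\<^sup>2 * (u \<bullet> v) + ((r / norm v)\<^sup>2)\<^sup>2 * (v \<bullet> v)"
    by (rule gen)
  also have "\<dots> = ((r / norm u) * (r / norm v))\<^sup>2 * (u \<bullet> u - 2 * (u \<bullet> v) + v \<bullet> v)"
    unfolding eq using n by (simp add: field_simps power2_eq_square)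
  also have "u \<bullet> u - 2 * (u \<bullet> v) + v \<bullet> v = (norm (x - y))\<^sup>2"
    by (simp add: u_def v_def power2_norm_eq_inner inner_diff_left inner_diff_right inner_commute algebra_simps)
  finally have "(norm (inversion a r x - inversion a r y))\<^sup>2 = ((r / norm u) * (r / norm v) * norm (x - y))\<^sup>2"
    by (simp only: power_mult_distrib)
  then show ?thesis
    using assms by (subst (asm) power2_eq_iff_nonneg) (auto simp: u_def v_def)
qed

lemma borel_measurable_inversion [measurable (raw)]:
  fixes a x :: "'b \<Rightarrow> 'a::euclidean_space"
  assumes [measurable]: "a \<in> borel_measurable M" "r \<in> borel_measurable M" "x \<in> borel_measurable M"
  shows "(\<lambda>t. inversion (a t) (r t) (x t)) \<in> borel_measurable M"
  unfolding inversion_def by measurable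

text \<open>Differentiating the scalar factor \<open>r\<^sup>2 / ((x - a) \<bullet> (x - a))\<close>
  adds a radial term that turns the identity into the reflection in the hyperplane orthogonal to
  \<open>x - a\<close>. The derivative is thus a similarity of ratio
  \<open>(r / norm (x - a))\<^sup>2\<close>.\<close>

lemma has_derivative_inversion:
  fixes a x :: "'a::euclidean_space"
  assumes "x \<noteq> a"
  shows "(inversion a r has_derivative
    (\<lambda>h. (r / norm (x - a))\<^sup>2 *\<^sub>R (h - (2 * ((x - a) \<bullet> h) / (norm (x - a))\<^sup>2) *\<^sub>R (x - a)))) (at x within S)"
proof -
  define u where "u = x - a"
  have n: "u \<bullet> u \<noteq> 0" using assms by (simp add: u_def)
  have 0: "((\<lambda>v. r\<^sup>2 / (v \<bullet> v)) has_derivative (\<lambda>h. - (r\<^sup>2 / (u \<bullet> u) * (2 * (u \<bullet> h) / (u \<bullet> u))))) (at u)"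
  proof -
    have A: "r\<^sup>2 * (- (inverse m * (2 * k) * inverse m)) = - (r\<^sup>2 / m * (2 * k / m))" for m k :: real
      by (simp add: divide_inverse)
    have B: "u \<bullet> h + h \<bullet> u = 2 * (u \<bullet> h)" for h by (simp add: inner_commute[of h u])
    have "(\<lambda>h. r\<^sup>2 * (- (inverse (u \<bullet> u) * (u \<bullet> h + h \<bullet> u) * inverse (u \<bullet> u)))) =
        (\<lambda>h. - (r\<^sup>2 / (u \<bullet> u) * (2 * (u \<bullet> h) / (u \<bullet> u))))" unfolding B A ..
    moreover have "((\<lambda>v. r\<^sup>2 * inverse (v \<bullet> v)) has_derivative
        (\<lambda>h. r\<^sup>2 * (- (inverse (u \<bullet> u) * (u \<bullet> h + h \<bullet> u) * inverse (u \<bullet> u))))) (at u)"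
      by (intro has_derivative_mult_right Deriv.has_derivative_inverse n has_derivative_inner has_derivative_ident)
    ultimately show ?thesis by (simp add: divide_inverse)
  qed
  have 1: "((\<lambda>v. (r\<^sup>2 / (v \<bullet> v)) *\<^sub>R v) has_derivative
      (\<lambda>h. (r\<^sup>2 / (u \<bullet> u)) *\<^sub>R (h - (2 * (u \<bullet> h) / (u \<bullet> u)) *\<^sub>R u))) (at (x - a))"
    unfolding u_def[symmetric]
    by (rule has_derivative_eq_rhs[OF has_derivative_scaleR[OF 0 has_derivative_ident]])
       (simp add: fun_eq_iff scaleR_diff_right)
  have "((\<lambda>x. a + (r\<^sup>2 / ((x - a) \<bullet> (x - a))) *\<^sub>R (x - a)) has_derivative
      (\<lambda>h. (r\<^sup>2 / (u \<bullet> u)) *\<^sub>R (h - (2 * (u \<bullet> h) / (u \<bullet> u)) *\<^sub>R u))) (at x within S)"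
  proof -
    have 2: "((\<lambda>x. x - a) has_derivative (\<lambda>h. h)) (at x within S)"
      by (auto intro!: derivative_eq_intros)
    from has_derivative_add[OF has_derivative_const[of a] has_derivative_compose[OF 2 1]]
    show ?thesis by simp
  qed
  moreover have "inversion a r = (\<lambda>x. a + (r\<^sup>2 / ((x - a) \<bullet> (x - a))) *\<^sub>R (x - a))"
    by (simp add: fun_eq_iff inversion_def power_divide power2_norm_eq_inner)
  ultimately show ?thesis by (simp add: u_def power_divide power2_norm_eq_inner)
qed

lemma orthogonal_transformation_reflection:
  fixes u :: "'a::euclidean_space"
  assumes "u \<noteq> 0"
  shows "orthogonal_transformation (\<lambda>h. h - (2 * (u \<bullet> h) / (norm u)\<^sup>2) *\<^sub>R u)"
proof -
  have n: "u \<bullet> u \<noteq> 0" using assms by simp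
  show ?thesis
    unfolding orthogonal_transformation_def power2_norm_eq_inner
  proof (intro conjI allI)
    show "linear (\<lambda>h. h - (2 * (u \<bullet> h) / (u \<bullet> u)) *\<^sub>R u)"
      by (rule linearI) (simp_all add: inner_add_right algebra_simps add_divide_distrib)
    fix v w
    show "(v - (2 * (u \<bullet> v) / (u \<bullet> u)) *\<^sub>R u) \<bullet> (w - (2 * (u \<bullet> w) / (u \<bullet> u)) *\<^sub>R u) = v \<bullet> w"
    proof -
      have "(v - \<alpha> *\<^sub>R u) \<bullet> (w - \<beta> *\<^sub>R u) = v \<bullet> w - \<beta> * (u \<bullet> v) - \<alpha> * (u \<bullet> w) + \<alpha> * \<beta> * (u \<bullet> u)" for \<alpha> \<beta>
        by (simp add: inner_diff_left inner_diff_right inner_commute[of v u] algebra_simps)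
      then show ?thesis using n by (simp add: divide_simps)
    qed
  qed
qed

lemma det_derivative_inversion:
  fixes u :: "real^'n"
  assumes "u \<noteq> 0"
  shows "\<bar>det (matrix (\<lambda>h. c *\<^sub>R (h - (2 * (u \<bullet> h) / (norm u)\<^sup>2) *\<^sub>R u)))\<bar> = \<bar>c\<bar> ^ CARD('n)"
proof -
  let ?R = "\<lambda>h. h - (2 * (u \<bullet> h) / (norm u)\<^sup>2) *\<^sub>R u"
  have R: "orthogonal_transformation ?R" by (rule orthogonal_transformation_reflection[OF assms])
  have "matrix ((\<lambda>h. c *\<^sub>R h) \<circ> ?R) = matrix ((*\<^sub>R) c) ** matrix ?R"
    by (rule matrix_compose) (use R in \<open>auto simp: orthogonal_transformation_def linear_scale_self\<close>)
  then show ?thesis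
    using orthogonal_transformation_det[OF R] by (simp add: o_def det_mul abs_mult power_abs)
qed

text \<open>The derivative is a similarity, so the Jacobian is the \<open>CARD('m)\<close>-th power
  of its ratio \<open>(r / norm (x - a))\<^sup>2\<close>. The change of variables runs over the
  preimage of the box; the center, where the map is not differentiable, is taken out as a null
  set.\<close>

lemma emeasure_inversion_box_wellorder:
  fixes a :: "real^'m::{finite,wellorder}"
  assumes "r > 0"
  shows "(\<integral>\<^sup>+x. ennreal ((r / norm (x - a)) ^ (2 * CARD('m))) * indicator (box l u) (inversion a r x) \<partial>lborel)
     = emeasure lborel (box l u)"
proof -
  define S where "S = (inversion a r -` box l u) - {a}"
  have [measurable]: "S \<in> sets borel"
  proof -
    have "inversion a r \<in> borel_measurable borel" by measurable
    from measurable_sets[OF this, of "box l u"] show ?thesis unfolding S_def by simp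
  qed
  have img: "inversion a r ` S = box l u - {a}"
  proof (intro equalityI subsetI)
    fix y assume "y \<in> box l u - {a}"
    then have "inversion a r y \<in> S" "y = inversion a r (inversion a r y)"
      using assms by (auto simp: S_def inversion_inversion inversion_eq_center_iff)
    then show "y \<in> inversion a r ` S" by blast
  qed (use assms in \<open>auto simp: S_def inversion_eq_center_iff\<close>)
  have inj: "inj_on (inversion a r) S"
    using assms by (metis inj_onI inversion_inversion order_less_irrefl)
  have eq: "measure lebesgue (box l u - {a}) = measure lborel (box l u)"
    by (simp add: measure_Diff_null_set measure_completion)
  let ?D = "\<lambda>x h. (r / norm (x - a))\<^sup>2 *\<^sub>R (h - (2 * ((x - a) \<bullet> h) / (norm (x - a))\<^sup>2) *\<^sub>R (x - a))"
  have "((\<lambda>x. \<bar>det (matrix (?D x))\<bar>) has_integral measure lborel (box l u)) S"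
  proof (subst has_measure_differentiable_image[of S "inversion a r" ?D, symmetric])
    show "S \<in> sets lebesgue" by (rule sets_completionI_sets) simp
    show "(inversion a r has_derivative ?D x) (at x within S)" if "x \<in> S" for x
      using that by (intro has_derivative_inversion) (auto simp: S_def)
    have "box l u - {a} \<in> lmeasurable" by (intro fmeasurable.Diff lmeasurable_box lmeasurable_compact compact_sing fmeasurableD)
    then show "inversion a r ` S \<in> lmeasurable \<and> measure lebesgue (inversion a r ` S) = measure lborel (box l u)"
      using eq by (simp add: img)
  qed (rule inj)
  then have "((\<lambda>x. (r / norm (x - a)) ^ (2 * CARD('m))) has_integral measure lborel (box l u)) S"
    by (rule has_integral_eq[rotated]) (use assms in \<open>auto simp: S_def det_derivative_inversion power_mult\<close>)
  then have "(\<integral>\<^sup>+x. ennreal ((r / norm (x - a)) ^ (2 * CARD('m))) * indicator S x \<partial>lborel) = ennreal (measure lborel (box l u))"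
    by (rule nn_integral_has_integral_lebesgue'[rotated]) (use assms in auto)
  also have "\<dots> = emeasure lborel (box l u)"
    by (simp add: emeasure_lborel_box_eq measure_lborel_box_eq)
  also have "(\<integral>\<^sup>+x. ennreal ((r / norm (x - a)) ^ (2 * CARD('m))) * indicator S x \<partial>lborel) =
     (\<integral>\<^sup>+x. ennreal ((r / norm (x - a)) ^ (2 * CARD('m))) * indicator (box l u) (inversion a r x) \<partial>lborel)"
    by (intro nn_integral_cong_AE eventually_mono[OF AE_lborel_singleton[of a]])
       (auto simp: S_def split: split_indicator)
  finally show ?thesis .
qed

text \<open>
  The change of variables theorem of the library needs a well-ordered index type, so it is applied to
  a copy of the given finite index type.
\<close>

typedef 'a ordered_copy = "UNIV :: 'a set" by simp

instance ordered_copy :: (finite) finite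
proof
  have "(UNIV :: 'a ordered_copy set) = Abs_ordered_copy ` UNIV"
    by (metis Abs_ordered_copy_cases UNIV_eq_I rangeI)
  then show "finite (UNIV :: 'a ordered_copy set)" by (metis finite finite_imageI)
qed

instantiation ordered_copy :: (finite) wellorder
begin

definition ordered_copy_rank :: "'a ordered_copy \<Rightarrow> nat" where
  "ordered_copy_rank = (SOME f. inj f)"

definition less_eq_ordered_copy :: "'a ordered_copy \<Rightarrow> 'a ordered_copy \<Rightarrow> bool" where
  "less_eq_ordered_copy x y \<longleftrightarrow> ordered_copy_rank x \<le> ordered_copy_rank y"

definition less_ordered_copy :: "'a ordered_copy \<Rightarrow> 'a ordered_copy \<Rightarrow> bool" where
  "less_ordered_copy x y \<longleftrightarrow> ordered_copy_rank x < ordered_copy_rank y"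

instance
proof
  have "\<exists>f :: 'a ordered_copy \<Rightarrow> nat. inj f"
    using finite_imp_inj_to_nat_seg[OF finite, of "UNIV :: 'a ordered_copy set"] by auto
  then have inj: "inj (ordered_copy_rank :: 'a ordered_copy \<Rightarrow> nat)"
    unfolding ordered_copy_rank_def by (rule someI_ex)
  fix x y z :: "'a ordered_copy"
  show "x \<le> y \<Longrightarrow> y \<le> x \<Longrightarrow> x = y"
    using inj by (auto simp: less_eq_ordered_copy_def inj_def)
  fix P :: "'a ordered_copy \<Rightarrow> bool" and b
  assume step: "\<And>x. (\<And>y. y < x \<Longrightarrow> P y) \<Longrightarrow> P x"
  show "P b"
    by (rule measure_induct_rule[of ordered_copy_rank]) (rule step, simp add: less_ordered_copy_def)
qed (auto simp: less_eq_ordered_copy_def less_ordered_copy_def)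

end

lemma bij_Rep_ordered_copy: "bij (Rep_ordered_copy :: 'a ordered_copy \<Rightarrow> 'a)"
  by (rule bij_betwI[where g = Abs_ordered_copy]) (simp_all add: Rep_ordered_copy_inverse Abs_ordered_copy_inverse)

definition reindex :: "real^'n \<Rightarrow> real^('n ordered_copy)" where
  "reindex x = (\<chi> i. x $ Rep_ordered_copy i)"

lemma inner_reindex: "reindex x \<bullet> reindex y = x \<bullet> y"
  unfolding reindex_def inner_vec_def
  using sum.reindex_bij_betw[OF bij_Rep_ordered_copy, of "\<lambda>i. x $ i \<bullet> y $ i"] by simp

lemma linear_reindex: "linear reindex"
  by (rule linearI) (auto simp: reindex_def vec_eq_iff)

lemma norm_reindex: "norm (reindex x) = norm x"
  by (simp add: norm_eq_sqrt_inner inner_reindex)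

lemma reindex_inversion: "reindex (inversion a r x) = inversion (reindex a) r (reindex x)"
proof -
  have "norm (reindex x - reindex a) = norm (x - a)"
    by (metis linear_diff linear_reindex norm_reindex)
  then show ?thesis
    by (simp add: inversion_def linear_add[OF linear_reindex] linear_diff[OF linear_reindex]
        linear_scale[OF linear_reindex])
qed

lemma reindex_measurable [measurable]: "reindex \<in> borel_measurable borel"
  by (intro borel_measurable_continuous_onI linear_continuous_on linear_conv_bounded_linear[THEN iffD1] linear_reindex)

lemma reindex_box: "reindex -` box (reindex l) (reindex u) = box l u"
  unfolding set_eq_iff vimage_eq mem_box_cart reindex_def
  by simp (metis Abs_ordered_copy_inverse UNIV_I)

lemma surj_reindex: "\<exists>x. reindex x = y"
proof
  show "reindex (\<chi> i. y $ Abs_ordered_copy i) = y"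
    by (simp add: reindex_def vec_eq_iff Rep_ordered_copy_inverse)
qed

text \<open>Renaming coordinates permutes the side lengths of a box, and Lebesgue measure is
  determined by the volumes of boxes.\<close>

lemma lborel_reindex: "distr lborel borel reindex = (lborel :: (real^('n::finite ordered_copy)) measure)"
proof (rule lborel_eqI[symmetric])
  fix l u :: "real^('n ordered_copy)"
  assume le: "\<And>b. b \<in> Basis \<Longrightarrow> l \<bullet> b \<le> u \<bullet> b"
  obtain l' u' :: "real^'n" where lu: "l = reindex l'" "u = reindex u'" using surj_reindex by metis
  have le': "l' $ i \<le> u' $ i" for i
  proof -
    have "l $ Abs_ordered_copy i \<le> u $ Abs_ordered_copy i"
      using le[of "axis (Abs_ordered_copy i) 1"] by (auto simp: Basis_vec_def inner_axis)
    then show ?thesis by (simp add: lu reindex_def Abs_ordered_copy_inverse)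
  qed
  have "emeasure (distr lborel borel reindex) (box l u) = emeasure lborel (box l' u')"
    by (subst emeasure_distr) (auto simp: lu reindex_box)
  also have "\<dots> = (\<Prod>b\<in>Basis. (u' - l') \<bullet> b)"
    using le' by (subst emeasure_lborel_box) (auto simp: Basis_vec_def inner_axis)
  also have "(\<Prod>b\<in>Basis. (u' - l') \<bullet> b) = (\<Prod>i\<in>UNIV. (u' - l') $ i)"
    by (simp add: Basis_vec_def UNION_singleton_eq_range prod.reindex inj_on_def axis_eq_axis inner_axis)
  also have "\<dots> = (\<Prod>i\<in>UNIV. (u - l) $ i)"
    using prod.reindex_bij_betw[OF bij_Rep_ordered_copy, of "\<lambda>i. (u' - l') $ i"] by (simp add: lu reindex_def)
  also have "\<dots> = (\<Prod>b\<in>Basis. (u - l) \<bullet> b)"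
    by (simp add: Basis_vec_def UNION_singleton_eq_range prod.reindex inj_on_def axis_eq_axis inner_axis)
  finally show "emeasure (distr lborel borel reindex) (box l u) = (\<Prod>b\<in>Basis. (u - l) \<bullet> b)" .
qed simp

lemma card_ordered_copy: "CARD('n::finite ordered_copy) = CARD('n)"
  by (rule bij_betw_same_card[OF bij_Rep_ordered_copy])

lemma emeasure_inversion_box:
  fixes a :: "real^'n"
  assumes "r > 0"
  shows "(\<integral>\<^sup>+x. ennreal ((r / norm (x - a)) ^ (2 * CARD('n))) * indicator (box l u) (inversion a r x) \<partial>lborel)
     = emeasure lborel (box l u)"
proof -
  have b: "indicator (box (reindex l) (reindex u)) (reindex x) = (indicator (box l u) x :: ennreal)" for x
    using reindex_box[of l u] by (auto split: split_indicator)
  have n: "norm (reindex x - reindex a) = norm (x - a)" for x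
    by (metis linear_diff linear_reindex norm_reindex)
  have box: "emeasure (distr lborel borel reindex) (box (reindex l) (reindex u)) = emeasure lborel (box l u)"
    by (subst emeasure_distr) (simp_all add: reindex_box)
  have "(\<integral>\<^sup>+x. ennreal ((r / norm (x - reindex a)) ^ (2 * CARD('n ordered_copy))) *
       indicator (box (reindex l) (reindex u)) (inversion (reindex a) r x) \<partial>distr lborel borel reindex)
     = emeasure (distr lborel borel reindex) (box (reindex l) (reindex u))"
    unfolding lborel_reindex by (rule emeasure_inversion_box_wellorder[OF assms])
  then show ?thesis
    unfolding box
    by (subst (asm) nn_integral_distr, measurable) (simp only: reindex_inversion[symmetric] n b card_ordered_copy)
qed

text \<open>Lebesgue measure is determined by its values on boxes. The box formula therefore
  identifies it with the image, under the inversion, of the measure that has the Jacobian as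
  density.\<close>

lemma nn_integral_inversion:
  fixes a :: "real^'n" and g :: "real^'n \<Rightarrow> ennreal"
  assumes r: "r > 0" and [measurable]: "g \<in> borel_measurable borel"
  shows "(\<integral>\<^sup>+x. g (inversion a r x) * ennreal ((r / norm (x - a)) ^ (2 * CARD('n))) \<partial>lborel) = (\<integral>\<^sup>+x. g x \<partial>lborel)"
proof -
  let ?j = "\<lambda>x. ennreal ((r / norm (x - a)) ^ (2 * CARD('n)))"
  have "lborel = distr (density lborel ?j) borel (inversion a r)"
  proof (rule lborel_eqI)
    fix l u :: "real^'n" assume le: "\<And>b. b \<in> Basis \<Longrightarrow> l \<bullet> b \<le> u \<bullet> b"
    have "emeasure (distr (density lborel ?j) borel (inversion a r)) (box l u)
      = (\<integral>\<^sup>+x. indicator (box l u) x \<partial>(distr (density lborel ?j) borel (inversion a r)))"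
      by simp
    also have "\<dots> = (\<integral>\<^sup>+x. ?j x * indicator (box l u) (inversion a r x) \<partial>lborel)"
      by (subst nn_integral_distr, simp, simp, subst nn_integral_density) auto
    also have "\<dots> = emeasure lborel (box l u)" by (rule emeasure_inversion_box[OF r])
    finally show "emeasure (distr (density lborel ?j) borel (inversion a r)) (box l u) = (\<Prod>b\<in>Basis. (u - l) \<bullet> b)"
      using le by simp
  qed simp
  then have "(\<integral>\<^sup>+x. g x \<partial>lborel) = (\<integral>\<^sup>+x. g x \<partial>(distr (density lborel ?j) borel (inversion a r)))" by simp
  also have "\<dots> = (\<integral>\<^sup>+x. g (inversion a r x) * ?j x \<partial>lborel)"
    by (subst nn_integral_distr, simp, simp, subst nn_integral_density) (auto simp: mult.commute)
  finally show ?thesis by simp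
qed

section \<open>Reflections in coordinate hyperplanes\<close>

definition coord_reflection :: "'n \<Rightarrow> real \<Rightarrow> real^'n \<Rightarrow> real^'n" where
  "coord_reflection i c x = (\<chi> k. if k = i then 2 * c - x $ k else x $ k)"

lemma borel_measurable_coord_reflection [measurable]:
  fixes i :: "'n::finite"
  shows "coord_reflection i c \<in> borel_measurable borel"
proof (rule borel_measurable_continuous_onI)
  have "continuous_on UNIV (\<lambda>x :: real^'n. if k = i then 2 * c - x $ k else x $ k)" for k
    by (cases "k = i") (auto intro!: continuous_intros)
  then show "continuous_on UNIV (coord_reflection i c)"
    unfolding coord_reflection_def by (intro continuous_on_vec_lambda)
qed


lemma coord_reflection_involution: "coord_reflection i c (coord_reflection i c x) = x"
  by (simp add: coord_reflection_def vec_eq_iff)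

lemma norm_coord_reflection_diff: "norm (coord_reflection i c x - coord_reflection i c y) = norm (x - y)"
proof -
  have "(coord_reflection i c x - coord_reflection i c y) $ k * (coord_reflection i c x - coord_reflection i c y) $ k
      = (x - y) $ k * (x - y) $ k" for k
    by (simp add: coord_reflection_def algebra_simps)
  then show ?thesis by (simp add: norm_eq_sqrt_inner inner_vec_def)
qed

lemma nn_integral_coord_reflection:
  fixes g :: "real^'n \<Rightarrow> ennreal"
  assumes [measurable]: "g \<in> borel_measurable borel"
  shows "(\<integral>\<^sup>+x. g (coord_reflection i c x) \<partial>lborel) = (\<integral>\<^sup>+x. g x \<partial>lborel)"
proof -
  define s where "s = (\<lambda>j :: real^'n. if j = axis i 1 then - 1 else 1 :: real)"
  have eq: "(2 * c) *\<^sub>R axis i 1 + (\<Sum>j\<in>Basis. (s j * (x \<bullet> j)) *\<^sub>R j) = coord_reflection i c x" for x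
  proof (rule euclidean_eqI)
    fix b :: "real^'n" assume b: "b \<in> Basis"
    then obtain k where k: "b = axis k 1" by (auto simp: Basis_vec_def)
    have axis: "(axis i 1 :: real^'n) $ k = (if k = i then 1 else 0)" by (simp add: axis_def)
    have "(\<Sum>j\<in>Basis. (s j * (x \<bullet> j)) *\<^sub>R j) \<bullet> b = s b * (x \<bullet> b)"
      using b by (simp add: inner_sum_left inner_Basis if_distrib cong: if_cong)
    then show "((2 * c) *\<^sub>R axis i 1 + (\<Sum>j\<in>Basis. (s j * (x \<bullet> j)) *\<^sub>R j)) \<bullet> b = coord_reflection i c x \<bullet> b"
      unfolding inner_add_left using axis
      by (simp add: k s_def inner_axis_axis inner_axis coord_reflection_def axis_eq_axis)
  qed
  have "lborel = density (distr lborel borel (\<lambda>x. (2 * c) *\<^sub>R axis i 1 + (\<Sum>j\<in>Basis. (s j * (x \<bullet> j)) *\<^sub>R j)))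
      (\<lambda>_. (\<Prod>j\<in>Basis. \<bar>s j\<bar>))"
    by (rule lborel_affine_euclidean) (simp add: s_def)
  also have "(\<lambda>_ :: real^'n. ennreal (\<Prod>j\<in>Basis. \<bar>s j\<bar>)) = (\<lambda>_. 1)"
  proof -
    have "(\<Prod>j\<in>Basis. \<bar>s j\<bar>) = 1" by (rule prod.neutral) (simp add: s_def)
    then show ?thesis by simp
  qed
  finally have "lborel = distr lborel borel (coord_reflection i c)" by (simp add: eq density_1)
  then have "(\<integral>\<^sup>+x. g x \<partial>lborel) = (\<integral>\<^sup>+x. g x \<partial>distr lborel borel (coord_reflection i c))" by simp
  also have "\<dots> = (\<integral>\<^sup>+x. g (coord_reflection i c x) \<partial>lborel)"
    by (rule nn_integral_distr) auto
  finally show ?thesis by simp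
qed

section \<open>Polarization\<close>

text \<open>Values in \<open>ennreal\<close> allow Tonelli's theorem and comparisons before any
  integrability is known. The arguments are meant to be nonnegative, since \<open>ennreal\<close>
  cuts negative numbers off at \<open>0\<close>. On the diagonal \<open>0 powr (- l)\<close> is
  \<open>0\<close>, which does not affect the integral.\<close>

definition riesz_form :: "real \<Rightarrow> ('a::euclidean_space \<Rightarrow> real) \<Rightarrow> ('a \<Rightarrow> real) \<Rightarrow> ennreal" where
  "riesz_form l f g = (\<integral>\<^sup>+x. \<integral>\<^sup>+y. ennreal (f x * g y * norm (x - y) powr (- l)) \<partial>lborel \<partial>lborel)"

text \<open>For \<open>q = 2 * N - l\<close> and \<open>p * q = 2 * N\<close> this is the isometric
  action of a reflection: the \<open>p\<close>-th power of \<open>w x powr q\<close> is the Jacobian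
  \<open>w x ^ (2 * N)\<close>.\<close>

definition pullback :: "real \<Rightarrow> ('a \<Rightarrow> 'a) \<Rightarrow> ('a \<Rightarrow> real) \<Rightarrow> ('a \<Rightarrow> real) \<Rightarrow> 'a \<Rightarrow> real" where
  "pullback q s w f x = w x powr q * f (s x)"

definition polarization :: "real \<Rightarrow> ('a \<Rightarrow> 'a) \<Rightarrow> ('a \<Rightarrow> real) \<Rightarrow> 'a set \<Rightarrow> ('a \<Rightarrow> real) \<Rightarrow> 'a \<Rightarrow> real" where
  "polarization q s w B f x =
    (if x \<in> B then max (f x) (pullback q s w f x) else min (f x) (pullback q s w f x))"

text \<open>A common interface for inversions and hyperplane reflections. The weight
  \<open>w\<close> is the square root of the linear scale factor, so a distance acquires the product
  of the weights of both points and the Jacobian is \<open>w x ^ (2 * N)\<close>. The set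
  \<open>B\<close> is the side that receives the maximum. The covering is required almost
  everywhere, and the distance identity only on mirror pairs that meet \<open>B\<close>, because
  mirrors and centers are exceptional. The condition \<open>closer\<close> is the geometric content
  of polarization: points of the same side are nearer, in the conformal sense, than mirror
  images.\<close>

locale conformal_reflection =
  fixes s :: "real^'n \<Rightarrow> real^'n" and w :: "real^'n \<Rightarrow> real" and B :: "(real^'n) set"
  assumes s_measurable [measurable]: "s \<in> borel_measurable borel"
    and w_measurable [measurable]: "w \<in> borel_measurable borel"
    and B_measurable [measurable]: "B \<in> sets borel"
    and w_pos: "0 < w x"
    and s_s [simp]: "s (s x) = x"
    and w_s: "w (s x) * w x = 1"
    and s_notin: "x \<in> B \<Longrightarrow> s x \<notin> B"
    and cover: "AE x in lborel. x \<in> B \<or> s x \<in> B"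
    and nn_integral_s: "\<And>g :: real^'n \<Rightarrow> ennreal. g \<in> borel_measurable borel \<Longrightarrow>
      (\<integral>\<^sup>+x. g (s x) * ennreal (w x ^ (2 * CARD('n))) \<partial>lborel) = (\<integral>\<^sup>+x. g x \<partial>lborel)"
    and dist_s: "x \<in> B \<or> s x \<in> B \<Longrightarrow> y \<in> B \<or> s y \<in> B \<Longrightarrow> norm (s x - s y) = w x * w y * norm (x - y)"
    and closer: "x \<in> B \<Longrightarrow> y \<in> B \<Longrightarrow> w y * norm (x - y) < norm (x - s y)"
begin

lemma pullback_measurable [measurable]:
  assumes [measurable]: "f \<in> borel_measurable borel"
  shows "pullback q s w f \<in> borel_measurable borel"
  unfolding pullback_def[abs_def] by measurable

lemma polarization_measurable [measurable]:
  assumes [measurable]: "f \<in> borel_measurable borel"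
  shows "polarization q s w B f \<in> borel_measurable borel"
  unfolding polarization_def[abs_def] by measurable

lemma pullback_nonneg: "(\<And>x. 0 \<le> f x) \<Longrightarrow> 0 \<le> pullback q s w f x"
  by (simp add: pullback_def)

lemma polarization_nonneg: "(\<And>x. 0 \<le> f x) \<Longrightarrow> 0 \<le> polarization q s w B f x"
  using pullback_nonneg[of f q x] by (simp add: polarization_def max_def min_def)

lemma w_s_powr: "w (s x) powr q * w x powr q = 1"
  using w_s[of x] w_pos[of x] w_pos[of "s x"] by (simp flip: powr_mult)

lemma pullback_s: "w x powr q * pullback q s w f (s x) = f x"
  using w_s_powr[of x q] by (simp add: pullback_def mult.commute mult.left_commute)

text \<open>A mirror pair carries two data, \<open>f x\<close> and the pullback at \<open>x\<close>.
  On \<open>B\<close> polarization sorts them: the maximum stays at \<open>x\<close>, and the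
  minimum, stored at \<open>s x\<close>, returns through the pullback. The positive weight commutes
  with the minimum.\<close>

lemma pullback_polarization:
  assumes "x \<in> B"
  shows "pullback q s w (polarization q s w B f) x = min (f x) (pullback q s w f x)"
proof -
  have "0 < w x powr q" using w_pos[of x] by simp
  then have "pullback q s w (polarization q s w B f) x =
      min (w x powr q * f (s x)) (w x powr q * pullback q s w f (s x))"
    unfolding pullback_def[of q s w "polarization q s w B f"] polarization_def
    using s_notin[OF assms] by (simp add: min_def)
  then show ?thesis unfolding pullback_s by (simp add: pullback_def min.commute)
qed

text \<open>The change of variables formula for the indicator of a null set, whose integrand on the
  reflected side has a strictly positive weight.\<close>

lemma AE_s: assumes "AE x in lborel. P x" shows "AE x in lborel. P (s x)"
proof -
  obtain N where N: "N \<in> null_sets lborel" "{x. \<not> P x} \<subseteq> N"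
    using assms by (auto simp: eventually_ae_filter)
  then have [measurable]: "N \<in> sets borel" by auto
  have "(\<integral>\<^sup>+x. indicator N (s x) * ennreal (w x ^ (2 * CARD('n))) \<partial>lborel) = (\<integral>\<^sup>+x. indicator N x \<partial>lborel)"
    by (rule nn_integral_s) simp
  also have "\<dots> = 0" using N by (simp add: null_setsD1)
  finally have "AE x in lborel. indicator N (s x) * ennreal (w x ^ (2 * CARD('n))) = 0"
    by (subst (asm) nn_integral_0_iff_AE) auto
  then show ?thesis
  proof eventually_elim
    case (elim x)
    moreover have "\<not> w x ^ (2 * CARD('n)) \<le> 0" using w_pos[of x] by (simp add: not_le)
    ultimately show ?case using N by (auto simp: indicator_def ennreal_eq_0_iff split: if_splits)
  qed
qed

text \<open>Almost every mirror pair has exactly one member in \<open>B\<close>, so the integral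
  over the complement can be transported to \<open>B\<close> by the reflection.\<close>

lemma nn_integral_fold:
  assumes [measurable]: "\<phi> \<in> borel_measurable borel"
  shows "(\<integral>\<^sup>+x. \<phi> x \<partial>lborel) = (\<integral>\<^sup>+x. (\<phi> x + \<phi> (s x) * ennreal (w x ^ (2 * CARD('n)))) * indicator B x \<partial>lborel)"
proof -
  have "(\<integral>\<^sup>+x. \<phi> x \<partial>lborel) = (\<integral>\<^sup>+x. \<phi> x * indicator B x + \<phi> x * indicator B (s x) \<partial>lborel)"
    by (intro nn_integral_cong_AE eventually_mono[OF cover]) (use s_notin in \<open>auto split: split_indicator\<close>)
  also have "\<dots> = (\<integral>\<^sup>+x. \<phi> x * indicator B x \<partial>lborel) + (\<integral>\<^sup>+x. \<phi> x * indicator B (s x) \<partial>lborel)"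
    by (rule nn_integral_add) measurable
  also have "(\<integral>\<^sup>+x. \<phi> x * indicator B (s x) \<partial>lborel) =
      (\<integral>\<^sup>+x. \<phi> (s x) * indicator B (s (s x)) * ennreal (w x ^ (2 * CARD('n))) \<partial>lborel)"
    by (rule nn_integral_s[symmetric]) measurable
  also have "(\<integral>\<^sup>+x. \<phi> x * indicator B x \<partial>lborel) + \<dots> =
      (\<integral>\<^sup>+x. \<phi> x * indicator B x + \<phi> (s x) * indicator B (s (s x)) * ennreal (w x ^ (2 * CARD('n))) \<partial>lborel)"
    by (rule nn_integral_add[symmetric]) measurable
  finally show ?thesis by (simp add: algebra_simps)
qed

lemma w_powr_split:
  fixes l :: real
  shows "w x ^ (2 * CARD('n)) = w x powr (2 * real CARD('n) - l) * w x powr l"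
proof -
  have "w x ^ (2 * CARD('n)) = w x powr real (2 * CARD('n))" by (rule powr_realpow[OF w_pos, symmetric])
  then show ?thesis by (simp flip: powr_add)
qed

text \<open>Folding both variables onto \<open>B\<close> produces four terms. By covariance of the
  kernel only two kernels remain: \<open>norm (x - y) powr (- l)\<close> couples values on equal
  sides, and \<open>norm (x - s y) powr (- l) * w y powr l\<close> couples values on opposite
  sides.\<close>

lemma riesz_form_fold:
  fixes l :: real
  assumes [measurable]: "f \<in> borel_measurable borel" "g \<in> borel_measurable borel"
    and nn: "\<And>x. 0 \<le> f x" "\<And>x. 0 \<le> g x"
  defines "q \<equiv> 2 * real CARD('n) - l"
  shows "riesz_form l f g = (\<integral>\<^sup>+x. (\<integral>\<^sup>+y. ennreal
    ((f x * g y + pullback q s w f x * pullback q s w g y) * norm (x - y) powr (- l) +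
     (f x * pullback q s w g y + pullback q s w f x * g y) * (norm (x - s y) powr (- l) * w y powr l))
    * indicator B y \<partial>lborel) * indicator B x \<partial>lborel)"
proof -
  let ?K = "\<lambda>x y. norm (x - y) powr (- l)"
  let ?W = "\<lambda>x. ennreal (w x ^ (2 * CARD('n)))"
  let ?F = "\<lambda>x y. ennreal (f x * g y * ?K x y)"
  have K1: "?K (s x) (s y) * (w x powr l * w y powr l) = ?K x y" if "x \<in> B" "y \<in> B" for x y
  proof -
    have "?K (s x) (s y) = w x powr (- l) * w y powr (- l) * ?K x y"
      using w_pos[of x] w_pos[of y] that by (simp add: dist_s powr_mult)
    moreover have "w x powr (- l) * w x powr l = 1" "w y powr (- l) * w y powr l = 1"
      using w_pos[of x] w_pos[of y] by (simp_all flip: powr_add)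
    ultimately show ?thesis by algebra
  qed
  \<comment> \<open>The distance identity for \<open>x\<close> and \<open>s y\<close>, whose mirror
    image is \<open>y\<close>, moves the reflection from one argument to the other.\<close>
  have K2: "?K (s x) y * w x powr l = ?K x (s y) * w y powr l" if "x \<in> B" "y \<in> B" for x y
  proof -
    have "norm (s x - s (s y)) = w x * w (s y) * norm (x - s y)"
      using that by (intro dist_s) auto
    then have "?K (s x) y = w x powr (- l) * w (s y) powr (- l) * ?K x (s y)"
      using w_pos[of x] w_pos[of "s y"] by (simp add: powr_mult)
    moreover have "w x powr (- l) * w x powr l = 1" using w_pos[of x] by (simp flip: powr_add)
    moreover have "w (s y) powr (- l) = w y powr l"
    proof -
      have "w (s y) = inverse (w y)" using w_s[of y] w_pos[of y] by (simp add: field_simps)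
      then show ?thesis using w_pos[of y] by (simp add: powr_minus inverse_powr)
    qed
    ultimately show ?thesis by algebra
  qed
  have "riesz_form l f g = (\<integral>\<^sup>+x. ((\<integral>\<^sup>+y. ?F x y \<partial>lborel) + (\<integral>\<^sup>+y. ?F (s x) y \<partial>lborel) * ?W x) * indicator B x \<partial>lborel)"
    unfolding riesz_form_def by (rule nn_integral_fold) measurable
  also have "\<dots> = (\<integral>\<^sup>+x. ((\<integral>\<^sup>+y. (?F x y + ?F x (s y) * ?W y) * indicator B y \<partial>lborel)
      + (\<integral>\<^sup>+y. (?F (s x) y + ?F (s x) (s y) * ?W y) * indicator B y \<partial>lborel) * ?W x) * indicator B x \<partial>lborel)"
    by (subst (1 2) nn_integral_fold) simp_all
  also have "\<dots> = (\<integral>\<^sup>+x. (\<integral>\<^sup>+y. ((?F x y + ?F x (s y) * ?W y) + (?F (s x) y + ?F (s x) (s y) * ?W y) * ?W x)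
      * indicator B y \<partial>lborel) * indicator B x \<partial>lborel)"
  proof (intro nn_integral_cong)
    fix x
    have eq: "(\<integral>\<^sup>+y. (a y + b y * c) * indicator B y \<partial>lborel) =
      (\<integral>\<^sup>+y. a y * indicator B y \<partial>lborel) + (\<integral>\<^sup>+y. b y * indicator B y \<partial>lborel) * c"
      if [measurable]: "a \<in> borel_measurable borel" "b \<in> borel_measurable borel" for a b :: "real^'n \<Rightarrow> ennreal" and c
    proof -
      have "(\<integral>\<^sup>+y. (a y + b y * c) * indicator B y \<partial>lborel) = (\<integral>\<^sup>+y. a y * indicator B y + b y * indicator B y * c \<partial>lborel)"
        by (intro nn_integral_cong) (auto split: split_indicator)
      also have "\<dots> = (\<integral>\<^sup>+y. a y * indicator B y \<partial>lborel) + (\<integral>\<^sup>+y. b y * indicator B y * c \<partial>lborel)"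
        by (rule nn_integral_add) measurable
      also have "(\<integral>\<^sup>+y. b y * indicator B y * c \<partial>lborel) = (\<integral>\<^sup>+y. b y * indicator B y \<partial>lborel) * c"
        by (rule nn_integral_multc) measurable
      finally show ?thesis .
    qed
    show "((\<integral>\<^sup>+y. (?F x y + ?F x (s y) * ?W y) * indicator B y \<partial>lborel)
      + (\<integral>\<^sup>+y. (?F (s x) y + ?F (s x) (s y) * ?W y) * indicator B y \<partial>lborel) * ?W x) * indicator B x =
      (\<integral>\<^sup>+y. ((?F x y + ?F x (s y) * ?W y) + (?F (s x) y + ?F (s x) (s y) * ?W y) * ?W x)
      * indicator B y \<partial>lborel) * indicator B x"
      by (subst eq) simp_all
  qed
  also have "\<dots> = (\<integral>\<^sup>+x. (\<integral>\<^sup>+y. ennreal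
    ((f x * g y + pullback q s w f x * pullback q s w g y) * norm (x - y) powr (- l) +
     (f x * pullback q s w g y + pullback q s w f x * g y) * (norm (x - s y) powr (- l) * w y powr l))
    * indicator B y \<partial>lborel) * indicator B x \<partial>lborel)"
  proof (intro nn_integral_cong)
    fix x
    have "(?F x y + ?F x (s y) * ?W y) + (?F (s x) y + ?F (s x) (s y) * ?W y) * ?W x =
      ennreal ((f x * g y + pullback q s w f x * pullback q s w g y) * norm (x - y) powr (- l) +
        (f x * pullback q s w g y + pullback q s w f x * g y) * (norm (x - s y) powr (- l) * w y powr l))"
      if B: "x \<in> B" "y \<in> B" for y
    proof -
      define X Y X' Y' where "X = w x powr q" and "Y = w y powr q" and "X' = w x powr l" and "Y' = w y powr l"
      \<comment> \<open>The Jacobian splits into two factors: the power \<open>q\<close> is absorbed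
        by the pullback, the power \<open>l\<close> by the kernel.\<close>
      have W: "w x ^ (2 * CARD('n)) = X * X'" "w y ^ (2 * CARD('n)) = Y * Y'"
        unfolding q_def X_def Y_def X'_def Y'_def by (rule w_powr_split)+
      have nnX: "0 \<le> X" "0 \<le> Y" "0 \<le> X'" "0 \<le> Y'" by (simp_all add: X_def Y_def X'_def Y'_def)
      have "(?F x y + ?F x (s y) * ?W y) + (?F (s x) y + ?F (s x) (s y) * ?W y) * ?W x =
        ennreal ((f x * g y * ?K x y + f x * g (s y) * ?K x (s y) * (Y * Y')) +
          (f (s x) * g y * ?K (s x) y + f (s x) * g (s y) * ?K (s x) (s y) * (Y * Y')) * (X * X'))"
        unfolding W using nn nnX by (simp add: ennreal_plus ennreal_mult' del: ennreal_plus[symmetric])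
      also have "(f x * g y * ?K x y + f x * g (s y) * ?K x (s y) * (Y * Y')) +
          (f (s x) * g y * ?K (s x) y + f (s x) * g (s y) * ?K (s x) (s y) * (Y * Y')) * (X * X') =
         (f x * g y + (X * f (s x)) * (Y * g (s y))) * ?K x y +
         (f x * (Y * g (s y)) + (X * f (s x)) * g y) * (?K x (s y) * Y')"
      proof -
        have "(f x * g y * ?K x y + f x * g (s y) * ?K x (s y) * (Y * Y')) +
            (f (s x) * g y * ?K (s x) y + f (s x) * g (s y) * ?K (s x) (s y) * (Y * Y')) * (X * X') =
          f x * g y * ?K x y + f x * (Y * g (s y)) * (?K x (s y) * Y') +
            (X * f (s x)) * g y * (?K (s x) y * X') + (X * f (s x)) * (Y * g (s y)) * (?K (s x) (s y) * (X' * Y'))"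
          by (simp add: algebra_simps)
        also have "\<dots> = (f x * g y + (X * f (s x)) * (Y * g (s y))) * ?K x y +
         (f x * (Y * g (s y)) + (X * f (s x)) * g y) * (?K x (s y) * Y')"
          unfolding K1[OF B, folded X'_def Y'_def] K2[OF B, folded X'_def Y'_def] by (simp add: algebra_simps)
        finally show ?thesis .
      qed
      finally show ?thesis by (simp add: pullback_def X_def Y_def Y'_def)
    qed
    then show "(\<integral>\<^sup>+y. ((?F x y + ?F x (s y) * ?W y) + (?F (s x) y + ?F (s x) (s y) * ?W y) * ?W x)
        * indicator B y \<partial>lborel) * indicator B x = (\<integral>\<^sup>+y. ennreal
      ((f x * g y + pullback q s w f x * pullback q s w g y) * norm (x - y) powr (- l) +
       (f x * pullback q s w g y + pullback q s w f x * g y) * (norm (x - s y) powr (- l) * w y powr l))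
      * indicator B y \<partial>lborel) * indicator B x"
      by (cases "x \<in> B") (auto intro!: nn_integral_cong split: split_indicator)
  qed
  finally show ?thesis .
qed

text \<open>Since \<open>p * q = 2 * N\<close>, the \<open>p\<close>-mass folds to the sum of the
  \<open>p\<close>-th powers of \<open>f\<close> and of its pullback over \<open>B\<close>, and a
  sum of two numbers is insensitive to sorting them.\<close>

lemma nn_integral_polarization:
  assumes [measurable]: "f \<in> borel_measurable borel" and nn: "\<And>x. 0 \<le> f x"
    and pq: "p * q = 2 * real CARD('n)" and p: "0 < p"
  shows "(\<integral>\<^sup>+x. ennreal (polarization q s w B f x powr p) \<partial>lborel) = (\<integral>\<^sup>+x. ennreal (f x powr p) \<partial>lborel)"
proof -
  have fold: "(\<integral>\<^sup>+x. ennreal (g x powr p) \<partial>lborel) =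
      (\<integral>\<^sup>+x. ennreal (g x powr p + pullback q s w g x powr p) * indicator B x \<partial>lborel)"
    if [measurable]: "g \<in> borel_measurable borel" and "\<And>x. 0 \<le> g x" for g
  proof -
    have "g (s x) powr p * w x ^ (2 * CARD('n)) = pullback q s w g x powr p" for x
    proof -
      have "w x ^ (2 * CARD('n)) = w x powr (p * q)"
        unfolding pq using powr_realpow[OF w_pos, of x "2 * CARD('n)"] by simp
      then show ?thesis using that(2)[of "s x"] w_pos[of x]
        by (simp add: pullback_def powr_mult powr_powr mult.commute)
    qed
    then show ?thesis
      by (subst nn_integral_fold) (auto simp: ennreal_plus simp flip: ennreal_mult')
  qed
  have "ennreal (max a b powr p) + ennreal (min a b powr p) = ennreal (a powr p) + ennreal (b powr p)" for a b :: real
    by (auto simp: max_def min_def add.commute)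
  then show ?thesis
    unfolding fold[OF assms(1) nn] fold[OF polarization_measurable[OF assms(1)] polarization_nonneg[OF nn]]
    by (intro nn_integral_cong) (auto simp: pullback_polarization polarization_def split: split_indicator)
qed

lemma kernel_closer:
  assumes "x \<in> B" "y \<in> B" "x \<noteq> y" "0 < l"
  shows "norm (x - s y) powr (- l) * w y powr l < norm (x - y) powr (- l)"
proof -
  have "norm (x - s y) powr (- l) < (w y * norm (x - y)) powr (- l)"
    using assms closer[OF assms(1,2)] w_pos[of y] by (intro powr_less_mono2_neg) auto
  then have "norm (x - s y) powr (- l) * w y powr l < (w y powr (- l) * norm (x - y) powr (- l)) * w y powr l"
    using w_pos[of y] by (simp add: powr_mult)
  moreover have "w y powr (- l) * w y powr l = 1" using w_pos[of y] by (simp flip: powr_add)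
  moreover have "(X * k) * Y = k" if "X * Y = 1" for X Y k :: real using that by algebra
  ultimately show ?thesis by metis
qed

text \<open>Two-point rearrangement: sorting the pairs at \<open>x\<close> and \<open>y\<close>
  raises the folded integrand by \<open>?K x y - ?K' x y\<close>, which is strictly positive, times
  the negative part of \<open>(f x - ?J x) * (f y - ?J y)\<close>. Finiteness allows the form of
  \<open>f\<close> to be cancelled, so this gain vanishes almost everywhere and
  \<open>f - ?J\<close> cannot take both signs on subsets of \<open>B\<close> of positive
  measure.\<close>

lemma polarization_eq_imp_comparable:
  fixes l :: real
  assumes [measurable]: "f \<in> borel_measurable borel" and nn: "\<And>x. 0 \<le> f x" and l: "0 < l"
  defines "q \<equiv> 2 * real CARD('n) - l"
  assumes fin: "riesz_form l f f < \<infinity>"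
    and le: "riesz_form l (polarization q s w B f) (polarization q s w B f) \<le> riesz_form l f f"
  shows "(AE x in lborel. x \<in> B \<longrightarrow> pullback q s w f x \<le> f x) \<or> (AE x in lborel. x \<in> B \<longrightarrow> f x \<le> pullback q s w f x)"
proof -
  let ?J = "pullback q s w f" and ?P = "polarization q s w B f"
  let ?K = "\<lambda>x y. norm (x - y) powr (- l)" and ?K' = "\<lambda>x y. norm (x - s y) powr (- l) * w y powr l"
  let ?e = "\<lambda>x y. max 0 (- ((f x - ?J x) * (f y - ?J y)))"
  let ?A = "\<lambda>x y. (f x * f y + ?J x * ?J y) * ?K x y + (f x * ?J y + ?J x * f y) * ?K' x y"
  let ?D = "\<integral>\<^sup>+x. (\<integral>\<^sup>+y. ennreal ((?K x y - ?K' x y) * ?e x y) * indicator B y \<partial>lborel) * indicator B x \<partial>lborel"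
  have Jnn: "0 \<le> ?J x" for x by (rule pullback_nonneg[OF nn])
  \<comment> \<open>Sorting changes something only if the two pairs are ordered oppositely; then the
    products that carry \<open>k\<close> and those that carry \<open>k'\<close> trade
    places.\<close>
  have key: "(max a a' * max b b' + min a a' * min b b') * k + (max a a' * min b b' + min a a' * max b b') * k' =
     ((a * b + a' * b') * k + (a * b' + a' * b) * k') + (k - k') * max 0 (- ((a - a') * (b - b')))"
    for a a' b b' k k' :: real
  proof -
    consider "a \<le> a'" "b \<le> b'" | "a \<le> a'" "b' \<le> b" | "a' \<le> a" "b \<le> b'" | "a' \<le> a" "b' \<le> b" by linarith
    then show ?thesis
    proof cases
      case 1 then have "0 \<le> (a - a') * (b - b')" by (intro mult_nonpos_nonpos) auto
      with 1 show ?thesis by (simp add: max_def min_def algebra_simps)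
    next
      case 2 then have "(a - a') * (b - b') \<le> 0" by (intro mult_nonpos_nonneg) auto
      with 2 show ?thesis by (simp add: max_def min_def) (auto simp: algebra_simps)
    next
      case 3 then have "(a - a') * (b - b') \<le> 0" by (intro mult_nonneg_nonpos) auto
      with 3 show ?thesis by (simp add: max_def min_def) (auto simp: algebra_simps)
    next
      case 4 then have "0 \<le> (a - a') * (b - b')" by (intro mult_nonneg_nonneg) auto
      with 4 show ?thesis by (simp add: max_def min_def algebra_simps)
    qed
  qed
  have "riesz_form l ?P ?P = (\<integral>\<^sup>+x. (\<integral>\<^sup>+y. ennreal
    ((?P x * ?P y + pullback q s w ?P x * pullback q s w ?P y) * ?K x y +
     (?P x * pullback q s w ?P y + pullback q s w ?P x * ?P y) * ?K' x y)
    * indicator B y \<partial>lborel) * indicator B x \<partial>lborel)"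
    unfolding q_def by (rule riesz_form_fold) (auto intro: polarization_nonneg nn)
  also have "\<dots> = (\<integral>\<^sup>+x. (\<integral>\<^sup>+y. (ennreal (?A x y) + ennreal ((?K x y - ?K' x y) * ?e x y))
      * indicator B y \<partial>lborel) * indicator B x \<partial>lborel)"
  proof (intro nn_integral_cong)
    fix x
    have "(\<integral>\<^sup>+y. ennreal ((?P x * ?P y + pullback q s w ?P x * pullback q s w ?P y) * ?K x y +
         (?P x * pullback q s w ?P y + pullback q s w ?P x * ?P y) * ?K' x y) * indicator B y \<partial>lborel) =
       (\<integral>\<^sup>+y. (ennreal (?A x y) + ennreal ((?K x y - ?K' x y) * ?e x y)) * indicator B y \<partial>lborel)" if x: "x \<in> B"
    proof (intro nn_integral_cong_AE eventually_mono[OF AE_lborel_singleton[of x]])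
      fix y assume "y \<noteq> x"
      show "ennreal ((?P x * ?P y + pullback q s w ?P x * pullback q s w ?P y) * ?K x y +
         (?P x * pullback q s w ?P y + pullback q s w ?P x * ?P y) * ?K' x y) * indicator B y =
        (ennreal (?A x y) + ennreal ((?K x y - ?K' x y) * ?e x y)) * indicator B y"
      proof (cases "y \<in> B")
        case True
        have "0 \<le> (?K x y - ?K' x y) * ?e x y"
          using kernel_closer[OF x True _ l] \<open>y \<noteq> x\<close> by (intro mult_nonneg_nonneg) auto
        moreover have "0 \<le> ?A x y" using nn Jnn by (intro add_nonneg_nonneg mult_nonneg_nonneg) auto
        moreover have P: "?P x = max (f x) (?J x)" "?P y = max (f y) (?J y)" using x True by (auto simp: polarization_def)
        ultimately show ?thesis
          unfolding pullback_polarization[OF x] pullback_polarization[OF True] P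
          by (subst key) (simp add: ennreal_plus)
      qed simp
    qed
    then show "(\<integral>\<^sup>+y. ennreal ((?P x * ?P y + pullback q s w ?P x * pullback q s w ?P y) * ?K x y +
         (?P x * pullback q s w ?P y + pullback q s w ?P x * ?P y) * ?K' x y) * indicator B y \<partial>lborel) * indicator B x =
       (\<integral>\<^sup>+y. (ennreal (?A x y) + ennreal ((?K x y - ?K' x y) * ?e x y)) * indicator B y \<partial>lborel) * indicator B x"
      by (cases "x \<in> B") auto
  qed
  also have "\<dots> = (\<integral>\<^sup>+x. (\<integral>\<^sup>+y. ennreal (?A x y) * indicator B y \<partial>lborel) * indicator B x \<partial>lborel) + ?D"
    by (simp add: distrib_right nn_integral_add)
  also have "(\<integral>\<^sup>+x. (\<integral>\<^sup>+y. ennreal (?A x y) * indicator B y \<partial>lborel) * indicator B x \<partial>lborel) = riesz_form l f f"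
    unfolding q_def by (rule riesz_form_fold[symmetric]) (auto intro: nn)
  finally have "riesz_form l f f + ?D \<le> riesz_form l f f + 0" using le by simp
  then have "?D \<le> 0" using fin by (subst (asm) ennreal_add_left_cancel_le) auto
  then have "?D = 0" by simp
  then have "AE x in lborel. (\<integral>\<^sup>+y. ennreal ((?K x y - ?K' x y) * ?e x y) * indicator B y \<partial>lborel) * indicator B x = 0"
    by (subst (asm) nn_integral_0_iff_AE) auto
  then have AE: "AE x in lborel. x \<in> B \<longrightarrow> (AE y in lborel. y \<in> B \<longrightarrow> 0 \<le> (f x - ?J x) * (f y - ?J y))"
  proof eventually_elim
    case (elim x)
    show ?case
    proof
      assume x: "x \<in> B"
      with elim have "(\<integral>\<^sup>+y. ennreal ((?K x y - ?K' x y) * ?e x y) * indicator B y \<partial>lborel) = 0" by simp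
      then have "AE y in lborel. ennreal ((?K x y - ?K' x y) * ?e x y) * indicator B y = 0"
        by (subst (asm) nn_integral_0_iff_AE) auto
      with AE_lborel_singleton[of x] show "AE y in lborel. y \<in> B \<longrightarrow> 0 \<le> (f x - ?J x) * (f y - ?J y)"
      proof eventually_elim
        case (elim y)
        show ?case
        proof
          assume y: "y \<in> B"
          with elim have "(?K x y - ?K' x y) * ?e x y \<le> 0" by (simp add: ennreal_eq_0_iff)
          moreover have "0 < ?K x y - ?K' x y" using kernel_closer[OF x y _ l] elim by auto
          ultimately have "?e x y \<le> 0" by (simp add: mult_le_0_iff)
          then show "0 \<le> (f x - ?J x) * (f y - ?J y)" by linarith
        qed
      qed
    qed
  qed
  show ?thesis
  proof (cases "AE x in lborel. x \<in> B \<longrightarrow> ?J x \<le> f x")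
    case False
    \<comment> \<open>One point at which the pullback is strictly larger, and at which the sign
      relation holds for almost every \<open>y\<close>, decides the sign almost everywhere on
      \<open>B\<close>.\<close>
    have "\<exists>x. x \<in> B \<and> f x < ?J x \<and> (AE y in lborel. y \<in> B \<longrightarrow> 0 \<le> (f x - ?J x) * (f y - ?J y))"
    proof (rule ccontr)
      assume neg: "\<not> ?thesis"
      from AE have "AE x in lborel. x \<in> B \<longrightarrow> ?J x \<le> f x"
        by eventually_elim (use neg in \<open>auto simp: not_less[symmetric]\<close>)
      with False show False by simp
    qed
    then obtain x where x: "f x < ?J x" and ae: "AE y in lborel. y \<in> B \<longrightarrow> 0 \<le> (f x - ?J x) * (f y - ?J y)" by blast
    from ae have "AE y in lborel. y \<in> B \<longrightarrow> f y \<le> ?J y"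
      by eventually_elim (use x in \<open>auto simp: zero_le_mult_iff\<close>)
    then show ?thesis by simp
  qed simp
qed

end

section \<open>Reflections in spheres and hyperplanes\<close>

definition inversion_weight :: "'a::real_inner \<Rightarrow> real \<Rightarrow> 'a \<Rightarrow> real" where
  "inversion_weight a r x = (if x = a then 1 else r / norm (x - a))"

lemma borel_measurable_inversion_weight [measurable]: 
  fixes a :: "'a::euclidean_space"
  shows "inversion_weight a r \<in> borel_measurable borel"
  unfolding inversion_weight_def[abs_def] by measurable

lemma AE_lborel_not_sphere: "AE x in lborel. norm (x - a) \<noteq> (r::real)"
  for a :: "'a::euclidean_space"
proof -
  have "sphere a r \<in> null_sets lborel"
    using negligible_sphere[of a r] by (simp add: negligible_iff_null_sets null_sets_completion_iff)
  from AE_not_in[OF this] show ?thesis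
    by eventually_elim (simp add: dist_norm norm_minus_commute)
qed

lemma AE_lborel_not_hyperplane: "AE x in lborel. (x :: real^'n) $ i \<noteq> c"
proof -
  have "closed {x :: real^'n. x $ i = c}" by (intro closed_Collect_eq continuous_intros)
  then have "{x :: real^'n. x $ i = c} \<in> null_sets lborel"
    using negligible_hyperplane[of "axis i (1::real) :: real^'n" c] by (simp add: inner_axis' axis_eq_0_iff inner_real_def negligible_iff_null_sets null_sets_completion_iff)
  from AE_not_in[OF this] show ?thesis by simp
qed

text \<open>The difference of the squares is \<open>((norm (x - a))\<^sup>2 - r\<^sup>2) * ((norm (y
  - a))\<^sup>2 - r\<^sup>2) / (norm (y - a))\<^sup>2\<close>, which is positive when both points
  lie on the same side of the sphere.\<close>

lemma inversion_closer:
  assumes "y \<noteq> a" "0 < r" "0 < ((norm (x - a))\<^sup>2 - r\<^sup>2) * ((norm (y - a))\<^sup>2 - r\<^sup>2)"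
  shows "r / norm (y - a) * norm (x - y) < norm (x - inversion a r y)"
proof -
  define u v where "u = x - a" and "v = y - a"
  define n where "n = norm v"
  have n: "0 < n" using assms by (simp add: n_def v_def)
  have xy: "(norm (x - y))\<^sup>2 = (norm u)\<^sup>2 - 2 * (u \<bullet> v) + n\<^sup>2"
  proof -
    have "x - y = u - v" by (simp add: u_def v_def)
    then have "(norm (x - y))\<^sup>2 = (norm (u - v))\<^sup>2" by simp
    also have "\<dots> = (norm u)\<^sup>2 - 2 * (u \<bullet> v) + n\<^sup>2"
      unfolding n_def power2_norm_eq_inner by (simp add: inner_commute[of v u] algebra_simps)
    finally show ?thesis .
  qed
  have xs: "(norm (x - inversion a r y))\<^sup>2 = (norm u)\<^sup>2 - 2 * (r / n)\<^sup>2 * (u \<bullet> v) + ((r / n)\<^sup>2)\<^sup>2 * n\<^sup>2"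
  proof -
    have "x - inversion a r y = u - (r / n)\<^sup>2 *\<^sub>R v" by (simp add: u_def v_def n_def inversion_def)
    moreover have "(norm (u - t *\<^sub>R v))\<^sup>2 = (norm u)\<^sup>2 - 2 * t * (u \<bullet> v) + t\<^sup>2 * (norm v)\<^sup>2" for t
      unfolding power2_norm_eq_inner by (simp add: inner_commute[of v u] power2_eq_square algebra_simps)
    ultimately show ?thesis by (simp add: n_def)
  qed
  have "(norm (x - inversion a r y))\<^sup>2 - (r / n * norm (x - y))\<^sup>2 = ((norm u)\<^sup>2 - r\<^sup>2) * (n\<^sup>2 - r\<^sup>2) / n\<^sup>2"
    unfolding power_mult_distrib xy xs using n by (simp add: power_divide power2_eq_square field_simps)
  also have "\<dots> > 0" using assms n by (simp add: u_def v_def n_def)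
  finally have "(r / n * norm (x - y))\<^sup>2 < (norm (x - inversion a r y))\<^sup>2" by simp
  then show ?thesis unfolding n_def v_def by (rule power2_less_imp_less) simp
qed

text \<open>The condition \<open>side\<close> says that \<open>B\<close> lies entirely inside or
  entirely outside the sphere, so the same criterion serves for the ball and for its
  complement.\<close>

lemma conformal_reflection_inversionI:
  fixes a :: "real^'n"
  assumes r: "0 < r" and B: "B \<in> sets borel" "a \<notin> B" "\<And>x. x \<in> B \<Longrightarrow> inversion a r x \<notin> B"
    and cover: "\<And>x. x \<noteq> a \<Longrightarrow> norm (x - a) \<noteq> r \<Longrightarrow> x \<in> B \<or> inversion a r x \<in> B"
    and side: "\<And>x y. x \<in> B \<Longrightarrow> y \<in> B \<Longrightarrow> 0 < ((norm (x - a))\<^sup>2 - r\<^sup>2) * ((norm (y - a))\<^sup>2 - r\<^sup>2)"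
  shows "conformal_reflection (inversion a r) (inversion_weight a r) B"
proof
  show "inversion a r \<in> borel_measurable borel" by measurable
  show "AE x in lborel. x \<in> B \<or> inversion a r x \<in> B"
    using AE_lborel_not_sphere[of a r] AE_lborel_singleton[of a] by eventually_elim (use cover in blast)
  show "0 < inversion_weight a r x" for x using r by (simp add: inversion_weight_def)
  show "inversion_weight a r (inversion a r x) * inversion_weight a r x = 1" for x
    using r by (simp add: inversion_weight_def inversion_eq_center_iff norm_inversion_diff power2_eq_square)
  show "(\<integral>\<^sup>+x. g (inversion a r x) * ennreal (inversion_weight a r x ^ (2 * CARD('n))) \<partial>lborel) = (\<integral>\<^sup>+x. g x \<partial>lborel)"
    if "g \<in> borel_measurable borel" for g :: "real^'n \<Rightarrow> ennreal"
    unfolding nn_integral_inversion[OF r that, symmetric, of a]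
    by (intro nn_integral_cong_AE eventually_mono[OF AE_lborel_singleton[of a]]) (simp add: inversion_weight_def)
  fix x y :: "real^'n"
  {
    assume "x \<in> B \<or> inversion a r x \<in> B" "y \<in> B \<or> inversion a r y \<in> B"
    then have "x \<noteq> a" "y \<noteq> a" using B(2) by (auto simp: inversion_def)
    then show "norm (inversion a r x - inversion a r y) = inversion_weight a r x * inversion_weight a r y * norm (x - y)"
      using dist_inversion[OF _ _ r, of x a y] by (simp add: inversion_weight_def)
  next
    assume "x \<in> B" "y \<in> B"
    with B(2) show "inversion_weight a r y * norm (x - y) < norm (x - inversion a r y)"
      using inversion_closer[of y a r x] r side by (auto simp: inversion_weight_def)
  }
qed (use B r in \<open>auto simp: inversion_inversion\<close>)

lemma norm_inversion_less_iff:
  assumes "0 < r" "x \<noteq> a"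
  shows "norm (inversion a r x - a) < r \<longleftrightarrow> r < norm (x - a)" "r < norm (inversion a r x - a) \<longleftrightarrow> norm (x - a) < r"
  using assms by (auto simp: norm_inversion_diff power2_eq_square field_simps)

text \<open>The center is removed from the ball: by convention the inversion fixes it, which would
  contradict \<open>s_notin\<close>.\<close>

lemma conformal_reflection_ball:
  fixes a :: "real^'n"
  assumes r: "0 < r"
  shows "conformal_reflection (inversion a r) (inversion_weight a r) {x. x \<noteq> a \<and> norm (x - a) < r}"
proof (rule conformal_reflection_inversionI[OF r])
  fix x y :: "real^'n"
  assume "x \<in> {x. x \<noteq> a \<and> norm (x - a) < r}" "y \<in> {x. x \<noteq> a \<and> norm (x - a) < r}"
  then have "(norm (x - a))\<^sup>2 < r\<^sup>2" "(norm (y - a))\<^sup>2 < r\<^sup>2" using r by (auto intro!: power_strict_mono)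
  then show "0 < ((norm (x - a))\<^sup>2 - r\<^sup>2) * ((norm (y - a))\<^sup>2 - r\<^sup>2)" by (intro mult_neg_neg) auto
next
  show "{x. x \<noteq> a \<and> norm (x - a) < r} \<in> sets borel" by measurable
qed (use r in \<open>auto simp: norm_inversion_less_iff inversion_eq_center_iff\<close>)

lemma conformal_reflection_ball_complement:
  fixes a :: "real^'n"
  assumes r: "0 < r"
  shows "conformal_reflection (inversion a r) (inversion_weight a r) {x. r < norm (x - a)}"
proof (rule conformal_reflection_inversionI[OF r])
  fix x y :: "real^'n"
  assume "x \<in> {x. r < norm (x - a)}" "y \<in> {x. r < norm (x - a)}"
  then have "r\<^sup>2 < (norm (x - a))\<^sup>2" "r\<^sup>2 < (norm (y - a))\<^sup>2" using r by (auto intro!: power_strict_mono)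
  then show "0 < ((norm (x - a))\<^sup>2 - r\<^sup>2) * ((norm (y - a))\<^sup>2 - r\<^sup>2)" by (intro mult_pos_pos) auto
next
  show "{x. r < norm (x - a)} \<in> sets borel" by measurable
next
  fix x :: "real^'n" assume x: "x \<in> {x. r < norm (x - a)}"
  then have "x \<noteq> a" using r by auto
  with x show "inversion a r x \<notin> {x. r < norm (x - a)}" using r norm_inversion_less_iff[of r x a] by auto
qed (use r in \<open>auto simp: norm_inversion_less_iff\<close>)

lemma coord_reflection_eq: "coord_reflection i c y = y - (2 * (y $ i - c)) *\<^sub>R axis i 1"
  by (simp add: coord_reflection_def vec_eq_iff axis_def)

lemma norm_diff_coord_reflection:
  fixes x y :: "real^'n"
  shows "(norm (x - coord_reflection i c y))\<^sup>2 = (norm (x - y))\<^sup>2 + 4 * (x $ i - c) * (y $ i - c)"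
proof -
  define u where "u = x - y"
  define e where "e = (axis i 1 :: real^'n)"
  have e: "e \<bullet> e = 1" "u \<bullet> e = x $ i - y $ i" by (simp_all add: e_def u_def inner_axis inner_axis_axis)
  have "(norm (u + t *\<^sub>R e))\<^sup>2 = (norm u)\<^sup>2 + 2 * t * (u \<bullet> e) + t\<^sup>2 * (e \<bullet> e)" for t
    unfolding power2_norm_eq_inner by (simp add: inner_commute[of e u] power2_eq_square algebra_simps)
  moreover have "x - coord_reflection i c y = u + (2 * (y $ i - c)) *\<^sub>R e"
    by (simp add: coord_reflection_eq u_def e_def)
  ultimately have "(norm (x - coord_reflection i c y))\<^sup>2 =
      (norm u)\<^sup>2 + 2 * (2 * (y $ i - c)) * (u \<bullet> e) + (2 * (y $ i - c))\<^sup>2 * (e \<bullet> e)" by simp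
  also have "\<dots> = (norm u)\<^sup>2 + 4 * (x $ i - c) * (y $ i - c)"
    unfolding e by (simp add: power2_eq_square algebra_simps)
  finally show ?thesis by (simp add: u_def)
qed

lemma conformal_reflection_coordI:
  assumes B: "B \<in> sets borel" "\<And>x. x \<in> B \<Longrightarrow> coord_reflection i c x \<notin> B"
    and cover: "\<And>x. x $ i \<noteq> c \<Longrightarrow> x \<in> B \<or> coord_reflection i c x \<in> B"
    and side: "\<And>x y. x \<in> B \<Longrightarrow> y \<in> B \<Longrightarrow> 0 < (x $ i - c) * (y $ i - c)"
  shows "conformal_reflection (coord_reflection i c) (\<lambda>_. 1) B"
proof
  show "AE x in lborel. x \<in> B \<or> coord_reflection i c x \<in> B"
    using AE_lborel_not_hyperplane[of i c] by eventually_elim (rule cover)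
  fix x y assume "x \<in> B" "y \<in> B"
  then have "0 < 4 * ((x $ i - c) * (y $ i - c))" using side[of x y] by simp
  then have "(norm (x - y))\<^sup>2 < (norm (x - coord_reflection i c y))\<^sup>2"
    unfolding norm_diff_coord_reflection by (simp only: mult.assoc less_add_same_cancel1)
  then show "1 * norm (x - y) < norm (x - coord_reflection i c y)" by (simp add: power2_less_imp_less)
qed (use B in \<open>auto simp: coord_reflection_involution norm_coord_reflection_diff nn_integral_coord_reflection\<close>)

lemma conformal_reflection_halfspaces:
  fixes i :: "'n::finite"
  shows "conformal_reflection (coord_reflection i c) (\<lambda>_. 1) {x. x $ i < c}"
    and "conformal_reflection (coord_reflection i c) (\<lambda>_. 1) {x. c < x $ i}"
proof -
  have "open {x :: real^'n. x $ i < c}" "open {x :: real^'n. c < x $ i}"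
    by (rule open_halfspace_component_lt_cart open_halfspace_component_gt_cart)+
  then have [measurable]: "{x :: real^'n. x $ i < c} \<in> sets borel" "{x :: real^'n. c < x $ i} \<in> sets borel" by auto
  show "conformal_reflection (coord_reflection i c) (\<lambda>_. 1) {x. x $ i < c}"
    by (rule conformal_reflection_coordI) (auto simp: coord_reflection_def mult_neg_neg)
  show "conformal_reflection (coord_reflection i c) (\<lambda>_. 1) {x. c < x $ i}"
    by (rule conformal_reflection_coordI) (auto simp: coord_reflection_def)
qed

section \<open>Optimizers under inversions\<close>

lemma HLS_optimizer_pos: "b > 0 \<Longrightarrow> 0 < HLS_optimizer l a b x"
  by (simp add: HLS_optimizer_def add_pos_nonneg)

lemma HLS_optimizer_measurable [measurable]:
  fixes a :: "'a::euclidean_space" shows "HLS_optimizer l a b \<in> borel_measurable borel"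
  unfolding HLS_optimizer_def[abs_def] by measurable

text \<open>Drawing the weight into the power turns the base into a quadratic polynomial in
  \<open>x\<close>. The correction to the original base disappears if
  \<open>r\<^sup>2 = b\<^sup>2 + (norm (a - c))\<^sup>2\<close>; otherwise its sign tells on which
  side of the sphere the optimizer exceeds its pullback.\<close>

lemma pullback_inversion_optimizer:
  fixes a c x :: "real^'n"
  assumes r: "0 < r" and b: "0 < b" and x: "x \<noteq> a"
  shows "pullback (2 * real CARD('n) - l) (inversion a r) (inversion_weight a r) (HLS_optimizer l c b) x =
    (b\<^sup>2 + (norm (x - c))\<^sup>2 + ((norm (x - a))\<^sup>2 - r\<^sup>2) * ((b\<^sup>2 + (norm (a - c))\<^sup>2) / r\<^sup>2 - 1)) powr
      (- ((2 * real CARD('n) - l) / 2))"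
proof -
  define q where "q = 2 * real CARD('n) - l"
  define u e where "u = x - a" and "e = a - c"
  define n where "n = norm u"
  have n: "0 < n" using x by (simp add: n_def u_def)
  have "(norm (inversion a r x - c))\<^sup>2 = (norm e)\<^sup>2 + 2 * (r / n)\<^sup>2 * (e \<bullet> u) + ((r / n)\<^sup>2)\<^sup>2 * n\<^sup>2"
  proof -
    have "inversion a r x - c = e + (r / n)\<^sup>2 *\<^sub>R u" by (simp add: u_def e_def n_def inversion_def)
    moreover have "(norm (e + t *\<^sub>R u))\<^sup>2 = (norm e)\<^sup>2 + 2 * t * (e \<bullet> u) + t\<^sup>2 * (norm u)\<^sup>2" for t
      unfolding power2_norm_eq_inner by (simp add: inner_commute[of u e] power2_eq_square algebra_simps)
    ultimately show ?thesis by (simp add: n_def)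
  qed
  moreover have "(norm (x - c))\<^sup>2 = (norm e)\<^sup>2 + 2 * (e \<bullet> u) + n\<^sup>2"
  proof -
    have "x - c = e + u" by (simp add: u_def e_def)
    then have "(norm (x - c))\<^sup>2 = (norm (e + u))\<^sup>2" by simp
    also have "\<dots> = (norm e)\<^sup>2 + 2 * (e \<bullet> u) + n\<^sup>2"
      unfolding n_def power2_norm_eq_inner by (simp add: inner_commute[of u e] algebra_simps)
    finally show ?thesis .
  qed
  ultimately have base: "(n / r)\<^sup>2 * (b\<^sup>2 + (norm (inversion a r x - c))\<^sup>2) =
      b\<^sup>2 + (norm (x - c))\<^sup>2 + (n\<^sup>2 - r\<^sup>2) * ((b\<^sup>2 + (norm e)\<^sup>2) / r\<^sup>2 - 1)"
    using n r by (simp add: power_divide power2_eq_square field_simps)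
  have "inversion_weight a r x powr q = ((n / r)\<^sup>2) powr (- (q / 2))"
  proof -
    have "((n / r)\<^sup>2) powr (- (q / 2)) = ((n / r) powr 2) powr (- (q / 2))"
      using n r by (simp add: powr_numeral)
    also have "\<dots> = (n / r) powr (- q)" by (simp add: powr_powr)
    also have "\<dots> = (r / n) powr q" using n r by (simp add: powr_minus powr_divide field_simps)
    finally show ?thesis using x by (simp add: inversion_weight_def n_def u_def)
  qed
  then have "pullback q (inversion a r) (inversion_weight a r) (HLS_optimizer l c b) x =
      ((n / r)\<^sup>2 * (b\<^sup>2 + (norm (inversion a r x - c))\<^sup>2)) powr (- (q / 2))"
    using n r b by (simp add: pullback_def HLS_optimizer_def q_def powr_mult)
  then show ?thesis unfolding base by (simp add: q_def n_def u_def e_def)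
qed

lemma pullback_inversion_optimizer_eq:
  fixes a c x :: "real^'n"
  assumes "0 < b" and "x \<noteq> a" and r: "r\<^sup>2 = b\<^sup>2 + (norm (a - c))\<^sup>2" "0 < r"
  shows "pullback (2 * real CARD('n) - l) (inversion a r) (inversion_weight a r) (HLS_optimizer l c b) x = HLS_optimizer l c b x"
  using assms pullback_inversion_optimizer[OF r(2) assms(1,2), of l c] by (simp add: HLS_optimizer_def)

lemma pullback_inversion_optimizer_le:
  fixes a c x :: "real^'n"
  assumes b: "0 < b" and x: "x \<noteq> a" and r: "0 < r" and l: "l < 2 * real CARD('n)"
    and s: "0 \<le> ((norm (x - a))\<^sup>2 - r\<^sup>2) * ((b\<^sup>2 + (norm (a - c))\<^sup>2) / r\<^sup>2 - 1)"
  shows "pullback (2 * real CARD('n) - l) (inversion a r) (inversion_weight a r) (HLS_optimizer l c b) x \<le> HLS_optimizer l c b x"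
proof -
  have "0 < b\<^sup>2 + (norm (x - c))\<^sup>2" using b by (simp add: add_pos_nonneg)
  then show ?thesis
    unfolding pullback_inversion_optimizer[OF r b x] HLS_optimizer_def using s l
    by (simp, intro powr_mono2') auto
qed

section \<open>Order between a function and its reflection, and bisecting levels\<close>

context conformal_reflection begin

lemma pullback_le_iff: "pullback q s w f (s x) \<le> f (s x) \<longleftrightarrow> f x \<le> pullback q s w f x"
  "f (s x) \<le> pullback q s w f (s x) \<longleftrightarrow> pullback q s w f x \<le> f x"
proof -
  have pos: "0 < w x powr q" using w_pos[of x] by simp
  show "pullback q s w f (s x) \<le> f (s x) \<longleftrightarrow> f x \<le> pullback q s w f x"
    unfolding pullback_s[of x q f, symmetric] using pos by (subst mult_le_cancel_left_pos[OF pos, symmetric]) (simp add: pullback_def)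
  show "f (s x) \<le> pullback q s w f (s x) \<longleftrightarrow> pullback q s w f x \<le> f x"
    unfolding pullback_s[of x q f, symmetric] using pos by (subst mult_le_cancel_left_pos[OF pos, symmetric]) (simp add: pullback_def)
qed

text \<open>By change of variables the \<open>p\<close>-mass of the pullback on \<open>B\<close> is
  the \<open>p\<close>-mass of \<open>f\<close> on the other side, so bisection makes the masses of
  \<open>f\<close> and its pullback on \<open>B\<close> equal. Ordered functions with equal finite
  \<open>p\<close>-mass agree almost everywhere. The equality is then carried across the
  mirror.\<close>

lemma pullback_fixed_if_bisecting:
  assumes [measurable]: "f \<in> borel_measurable borel" and nn: "\<And>x. 0 \<le> f x"
    and pq: "p * q = 2 * real CARD('n)" and p: "0 < p"
    and fin: "(\<integral>\<^sup>+x. ennreal (f x powr p) \<partial>lborel) < \<infinity>"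
    and cmp: "(AE x in lborel. x \<in> B \<longrightarrow> pullback q s w f x \<le> f x) \<or> (AE x in lborel. x \<in> B \<longrightarrow> f x \<le> pullback q s w f x)"
    and bisect: "(\<integral>\<^sup>+x. ennreal (f x powr p) * indicator B x \<partial>lborel) = (\<integral>\<^sup>+x. ennreal (f x powr p) * indicator B (s x) \<partial>lborel)"
  shows "AE x in lborel. pullback q s w f x = f x"
proof -
  let ?J = "pullback q s w f"
  have Jnn: "0 \<le> ?J x" for x by (rule pullback_nonneg[OF nn])
  have "(\<integral>\<^sup>+x. ennreal (f x powr p) * indicator B (s x) \<partial>lborel) =
     (\<integral>\<^sup>+x. ennreal (f (s x) powr p) * indicator B (s (s x)) * ennreal (w x ^ (2 * CARD('n))) \<partial>lborel)"
    by (rule nn_integral_s[symmetric]) measurable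
  also have "\<dots> = (\<integral>\<^sup>+x. ennreal (?J x powr p) * indicator B x \<partial>lborel)"
  proof (intro nn_integral_cong)
    fix x
    have "w x ^ (2 * CARD('n)) = w x powr (p * q)"
      unfolding pq using powr_realpow[OF w_pos, of x "2 * CARD('n)"] by simp
    then have "f (s x) powr p * w x ^ (2 * CARD('n)) = ?J x powr p" using nn[of "s x"] w_pos[of x]
      by (simp add: pullback_def powr_mult powr_powr mult.commute)
    then show "ennreal (f (s x) powr p) * indicator B (s (s x)) * ennreal (w x ^ (2 * CARD('n))) = ennreal (?J x powr p) * indicator B x"
      by (auto split: split_indicator simp flip: ennreal_mult')
  qed
  finally have eq: "(\<integral>\<^sup>+x. ennreal (f x powr p) * indicator B x \<partial>lborel) = (\<integral>\<^sup>+x. ennreal (?J x powr p) * indicator B x \<partial>lborel)"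
    using bisect by simp
  have fin': "(\<integral>\<^sup>+x. ennreal (f x powr p) * indicator B x \<partial>lborel) < \<infinity>"
    using fin by (rule le_less_trans[rotated]) (intro nn_integral_mono, auto split: split_indicator)
  have gen: "AE x in lborel. x \<in> B \<longrightarrow> u x = v x"
    if [measurable]: "u \<in> borel_measurable borel" "v \<in> borel_measurable borel"
      and "\<And>x. 0 \<le> u x" "\<And>x. 0 \<le> v x" and ae: "AE x in lborel. x \<in> B \<longrightarrow> u x \<le> v x"
      and fin: "(\<integral>\<^sup>+x. ennreal (u x powr p) * indicator B x \<partial>lborel) < \<infinity>"
      and eq: "(\<integral>\<^sup>+x. ennreal (u x powr p) * indicator B x \<partial>lborel) = (\<integral>\<^sup>+x. ennreal (v x powr p) * indicator B x \<partial>lborel)"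
    for u v :: "real^'n \<Rightarrow> real"
  proof -
    let ?e = "\<lambda>x. ennreal (v x powr p - u x powr p) * indicator B x"
    have "(\<integral>\<^sup>+x. ennreal (v x powr p) * indicator B x \<partial>lborel) = (\<integral>\<^sup>+x. ennreal (u x powr p) * indicator B x + ?e x \<partial>lborel)"
    proof (rule nn_integral_cong_AE, use ae in eventually_elim)
      case (elim x)
      then have "x \<in> B \<Longrightarrow> u x powr p \<le> v x powr p" using that(3)[of x] p by (intro powr_mono2) auto
      then show ?case by (auto split: split_indicator simp flip: ennreal_plus)
    qed
    also have "\<dots> = (\<integral>\<^sup>+x. ennreal (u x powr p) * indicator B x \<partial>lborel) + (\<integral>\<^sup>+x. ?e x \<partial>lborel)"
      by (rule nn_integral_add) measurable
    finally have "(\<integral>\<^sup>+x. ennreal (u x powr p) * indicator B x \<partial>lborel) + (\<integral>\<^sup>+x. ?e x \<partial>lborel) \<le>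
        (\<integral>\<^sup>+x. ennreal (u x powr p) * indicator B x \<partial>lborel) + 0" using eq by simp
    then have "(\<integral>\<^sup>+x. ?e x \<partial>lborel) = 0" using fin by (subst (asm) ennreal_add_left_cancel_le) auto
    then have "AE x in lborel. ?e x = 0" by (subst (asm) nn_integral_0_iff_AE) auto
    with ae show ?thesis
    proof eventually_elim
      case (elim x)
      show ?case
      proof
        assume x: "x \<in> B"
        with elim have "v x powr p \<le> u x powr p" by (simp add: ennreal_eq_0_iff)
        moreover have "u x < v x \<Longrightarrow> u x powr p < v x powr p" using that(3)[of x] p by (intro powr_less_mono2) auto
        ultimately show "u x = v x" using elim x by fastforce
      qed
    qed
  qed
  have B: "AE x in lborel. x \<in> B \<longrightarrow> ?J x = f x"
    using cmp
  proof
    assume "AE x in lborel. x \<in> B \<longrightarrow> ?J x \<le> f x"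
    from gen[OF pullback_measurable[OF assms(1)] assms(1) Jnn nn this] show ?thesis
      using fin' unfolding eq by simp
  next
    assume "AE x in lborel. x \<in> B \<longrightarrow> f x \<le> ?J x"
    from gen[OF assms(1) pullback_measurable[OF assms(1)] nn Jnn this fin' eq]
    show ?thesis by eventually_elim simp
  qed
  from B AE_s[OF B] cover show ?thesis
  proof eventually_elim
    case (elim x)
    then show ?case using pullback_le_iff[where q = q and f = f and x = x] by (metis order_antisym order_refl)
  qed
qed

text \<open>Reflection reverses the order between \<open>f\<close> and its pullback. This is used
  when the polarization that respects the dominating function goes toward the opposite side.\<close>

lemma comparable_other_side:
  assumes "\<And>x. x \<in> B \<Longrightarrow> s x \<in> B'"
    and "(AE x in lborel. x \<in> B' \<longrightarrow> pullback q s w f x \<le> f x) \<or> (AE x in lborel. x \<in> B' \<longrightarrow> f x \<le> pullback q s w f x)"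
  shows "(AE x in lborel. x \<in> B \<longrightarrow> pullback q s w f x \<le> f x) \<or> (AE x in lborel. x \<in> B \<longrightarrow> f x \<le> pullback q s w f x)"
  using assms(2)
proof
  assume "AE x in lborel. x \<in> B' \<longrightarrow> pullback q s w f x \<le> f x"
  from AE_s[OF this] have "AE x in lborel. x \<in> B \<longrightarrow> f x \<le> pullback q s w f x"
    by eventually_elim (simp add: assms(1) pullback_le_iff)
  then show ?thesis ..
next
  assume "AE x in lborel. x \<in> B' \<longrightarrow> f x \<le> pullback q s w f x"
  from AE_s[OF this] have "AE x in lborel. x \<in> B \<longrightarrow> pullback q s w f x \<le> f x"
    by eventually_elim (simp add: assms(1) pullback_le_iff)
  then show ?thesis ..
qed

end

text \<open>The push-forward of the mass under \<open>T\<close> has no atoms because level sets of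
  \<open>T\<close> are null. Its distribution function is therefore continuous and takes half of the
  total mass as a value.\<close>

lemma ex_bisecting_level:
  fixes \<phi> :: "'a::euclidean_space \<Rightarrow> ennreal" and T :: "'a \<Rightarrow> real"
  assumes [measurable]: "\<phi> \<in> borel_measurable borel" "T \<in> borel_measurable borel"
    and null: "\<And>t. AE x in lborel. T x \<noteq> t"
    and fin: "(\<integral>\<^sup>+x. \<phi> x \<partial>lborel) < \<infinity>"
  shows "\<exists>t. (\<integral>\<^sup>+x. \<phi> x * indicator {x. T x < t} x \<partial>lborel) = (\<integral>\<^sup>+x. \<phi> x * indicator {x. t < T x} x \<partial>lborel)"
proof (cases "(\<integral>\<^sup>+x. \<phi> x \<partial>lborel) = 0")
  case True
  have "(\<integral>\<^sup>+x. \<phi> x * indicator {x. T x < 0} x \<partial>lborel) \<le> (\<integral>\<^sup>+x. \<phi> x \<partial>lborel)"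
     "(\<integral>\<^sup>+x. \<phi> x * indicator {x. 0 < T x} x \<partial>lborel) \<le> (\<integral>\<^sup>+x. \<phi> x \<partial>lborel)"
    by (intro nn_integral_mono; auto split: split_indicator)+
  with True show ?thesis by (intro exI[of _ 0]) simp
next
  case False
  define M where "M = distr (density lborel \<phi>) borel T"
  have emeasure_M: "emeasure M A = (\<integral>\<^sup>+x. \<phi> x * indicator {x. T x \<in> A} x \<partial>lborel)" if [measurable]: "A \<in> sets borel" for A
  proof -
    have "emeasure M A = emeasure (density lborel \<phi>) (T -` A \<inter> space (density lborel \<phi>))"
      unfolding M_def by (rule emeasure_distr) auto
    also have "\<dots> = (\<integral>\<^sup>+x. \<phi> x * indicator (T -` A \<inter> space lborel) x \<partial>lborel)"
      by (subst emeasure_density) (use measurable_sets_borel[of T borel A] in auto)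
    finally show ?thesis by (simp add: vimage_def)
  qed
  interpret finite_borel_measure M
  proof (intro finite_borel_measure.intro finite_borel_measure_axioms.intro finite_measureI)
    have "space M = UNIV" by (simp add: M_def)
    then show "emeasure M (space M) \<noteq> \<infinity>" using fin by (simp add: emeasure_M less_top)
    show "sets M = sets borel" by (simp add: M_def)
  qed
  have m0: "measure M {t} = 0" for t
  proof -
    have "emeasure M {t} = 0"
      by (subst emeasure_M, simp, subst nn_integral_0_iff_AE) (use null[of t] in \<open>auto simp: indicator_def\<close>)
    then show ?thesis by (simp add: measure_def)
  qed
  then have cont: "continuous_on UNIV (cdf M)" by (simp add: continuous_at_imp_continuous_on isCont_cdf)
  have spaceM: "space M = UNIV" by (simp add: M_def)
  have pos: "0 < measure M (space M)"
  proof -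
    have "emeasure M (space M) = (\<integral>\<^sup>+x. \<phi> x \<partial>lborel)" by (simp add: spaceM emeasure_M)
    then show ?thesis using False by (metis emeasure_eq_measure ennreal_0 measure_nonneg order_le_less)
  qed
  have "eventually (\<lambda>t. cdf M t < measure M (space M) / 2) at_bot"
    by (rule order_tendstoD[OF cdf_lim_at_bot]) (use pos in simp)
  then obtain t0 where t0: "cdf M t0 < measure M (space M) / 2" by (meson eventually_at_bot_linorder order_refl)
  have "eventually (\<lambda>t. measure M (space M) / 2 < cdf M t) at_top"
    by (rule order_tendstoD[OF cdf_lim_at_top]) (use pos in simp)
  then obtain t1 where t1: "measure M (space M) / 2 < cdf M t1" by (meson eventually_at_top_linorder order_refl)
  have "t0 \<le> t1"
  proof (rule ccontr)
    assume "\<not> t0 \<le> t1" then have "cdf M t1 \<le> cdf M t0" by (intro cdf_nondecreasing) simp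
    with t0 t1 show False by simp
  qed
  then obtain t where t: "cdf M t = measure M (space M) / 2"
    using IVT'[of "cdf M" t0 "measure M (space M) / 2" t1] t0 t1 cont continuous_on_subset by (metis less_imp_le subset_UNIV)
  have "measure M {..<t} = measure M {..t} - measure M {t}"
  proof -
    have "{..t} = {..<t} \<union> {t}" by auto
    moreover have "sets M = sets borel" by (simp add: M_def)
    ultimately show ?thesis using finite_measure_Union[of "{..<t}" "{t}"] by simp
  qed
  then have 1: "measure M {..<t} = measure M (space M) / 2" using t m0 by (simp add: cdf_def)
  have "measure M {t<..} = measure M (space M) - measure M {..t}"
  proof -
    have "{t<..} = space M - {..t}" by (auto simp: spaceM)
    moreover have "sets M = sets borel" by (simp add: M_def)
    ultimately show ?thesis using finite_measure_compl[of "{..t}"] by simp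
  qed
  then have "measure M {..<t} = measure M {t<..}" using 1 t by (simp add: cdf_def)
  then have "emeasure M {..<t} = emeasure M {t<..}" by (simp add: emeasure_eq_measure)
  then show ?thesis by (intro exI[of _ t]) (simp add: emeasure_M)
qed

section \<open>Functions comparable with all their reflections\<close>

lemma AE_lborel_ex:
  assumes "AE x in (lborel :: 'a::euclidean_space measure). P x"
  shows "\<exists>x. P x"
proof (rule ccontr)
  assume "\<not> ?thesis"
  with assms have "AE x in (lborel :: 'a measure). False" by simp
  then have "emeasure (lborel :: 'a measure) UNIV = 0" by (simp add: AE_iff_null_sets null_sets_def AE_iff_measurable[of UNIV])
  then show False by simp
qed

lemma AE_zero_if_norm_zero:
  fixes f :: "'a::euclidean_space \<Rightarrow> real"
  assumes [measurable]: "f \<in> borel_measurable borel" and nn: "\<And>x. 0 \<le> f x"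
    and "(\<integral>\<^sup>+x. ennreal (f x powr p) \<partial>lborel) = 0"
  shows "AE x in lborel. f x = 0"
proof -
  have "AE x in lborel. ennreal (f x powr p) = 0" using assms(3) by (subst (asm) nn_integral_0_iff_AE) auto
  then show ?thesis by eventually_elim (use nn in \<open>auto simp: ennreal_eq_0_iff\<close>)
qed

lemma nn_integral_point_reflection:
  fixes g :: "'a::euclidean_space \<Rightarrow> ennreal"
  assumes [measurable]: "g \<in> borel_measurable borel"
  shows "(\<integral>\<^sup>+x. g (t - x) \<partial>lborel) = (\<integral>\<^sup>+x. g x \<partial>lborel)"
proof -
  have "lborel = density (distr lborel borel (\<lambda>x :: 'a. t + (- 1) *\<^sub>R x)) (\<lambda>_. ennreal (\<bar>- 1\<bar> ^ DIM('a)))"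
    by (rule lborel_affine) simp
  then have "lborel = distr lborel borel (\<lambda>x :: 'a. t - x)" by (simp add: density_1)
  then have "(\<integral>\<^sup>+x. g x \<partial>lborel) = (\<integral>\<^sup>+x. g x \<partial>distr lborel borel (\<lambda>x :: 'a. t - x))" by simp
  also have "\<dots> = (\<integral>\<^sup>+x. g (t - x) \<partial>lborel)" by (rule nn_integral_distr) measurable
  finally show ?thesis by simp
qed

text \<open>A bisecting hyperplane in each coordinate direction gives a symmetry of
  \<open>f\<close>; the composition of all these coordinate reflections is the reflection in a
  point.\<close>

lemma ex_symmetric_center:
  fixes f :: "real^'n \<Rightarrow> real"
  assumes [measurable]: "f \<in> borel_measurable borel" and nn: "\<And>x. 0 \<le> f x"
    and pq: "p * q = 2 * real CARD('n)" and p: "0 < p"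
    and fin: "(\<integral>\<^sup>+x. ennreal (f x powr p) \<partial>lborel) < \<infinity>"
    and half: "\<And>i c. (AE x in lborel. x \<in> {x. x $ i < c} \<longrightarrow> pullback q (coord_reflection i c) (\<lambda>_. 1) f x \<le> f x) \<or>
       (AE x in lborel. x \<in> {x. x $ i < c} \<longrightarrow> f x \<le> pullback q (coord_reflection i c) (\<lambda>_. 1) f x)"
  shows "\<exists>c. AE x in lborel. f (2 *\<^sub>R c - x) = f x"
proof -
  have "\<exists>c. AE x in lborel. f (coord_reflection i c x) = f x" for i
  proof -
    have [measurable]: "(\<lambda>x :: real^'n. x $ i) \<in> borel_measurable borel"
      by (intro borel_measurable_continuous_onI continuous_intros)
    have "\<exists>t. (\<integral>\<^sup>+x. ennreal (f x powr p) * indicator {x. x $ i < t} x \<partial>lborel) =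
       (\<integral>\<^sup>+x. ennreal (f x powr p) * indicator {x. t < x $ i} x \<partial>lborel)"
      by (rule ex_bisecting_level[OF _ _ AE_lborel_not_hyperplane fin]) measurable
    then obtain t where t: "(\<integral>\<^sup>+x. ennreal (f x powr p) * indicator {x. x $ i < t} x \<partial>lborel) =
       (\<integral>\<^sup>+x. ennreal (f x powr p) * indicator {x. t < x $ i} x \<partial>lborel)" ..
    interpret conformal_reflection "coord_reflection i t" "\<lambda>_. 1" "{x. x $ i < t}"
      by (rule conformal_reflection_halfspaces)
    have "AE x in lborel. pullback q (coord_reflection i t) (\<lambda>_. 1) f x = f x"
    proof (rule pullback_fixed_if_bisecting[OF assms(1) nn pq p fin half])
      have "indicator {x. x $ i < t} (coord_reflection i t x) = (indicator {x. t < x $ i} x :: ennreal)" for x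
        by (auto simp: coord_reflection_def indicator_def)
      then show "(\<integral>\<^sup>+x. ennreal (f x powr p) * indicator {x. x $ i < t} x \<partial>lborel) =
        (\<integral>\<^sup>+x. ennreal (f x powr p) * indicator {x. x $ i < t} (coord_reflection i t x) \<partial>lborel)"
        using t by simp
    qed
    then show ?thesis by (auto simp: pullback_def)
  qed
  then obtain c where c: "\<And>i. AE x in lborel. f (coord_reflection i (c i) x) = f x" by metis
  \<comment> \<open>The partial composition, reflecting the coordinates in \<open>A\<close>; the
    induction adds one coordinate at a time.\<close>
  define \<rho> where "\<rho> A x = (\<chi> k. if k \<in> A then 2 * c k - x $ k else x $ k)" for A and x :: "real^'n"
  have "AE x in lborel. f (\<rho> A x) = f x" for A
  proof (induction A rule: finite_induct[OF finite])
    case 1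
    then show ?case by (simp add: \<rho>_def)
  next
    case (2 i A)
    interpret conformal_reflection "coord_reflection i (c i)" "\<lambda>_. 1" "{x. x $ i < c i}"
      by (rule conformal_reflection_halfspaces)
    have "\<rho> A (coord_reflection i (c i) x) = \<rho> (insert i A) x" for x
      using 2(2) by (auto simp: \<rho>_def coord_reflection_def vec_eq_iff)
    with AE_s[OF 2(3)] c[of i] show ?case by auto
  qed
  from this[of UNIV] have "AE x in lborel. f (2 *\<^sub>R (\<chi> k. c k) - x) = f x"
    by eventually_elim (simp add: \<rho>_def minus_vec_def scaleR_vec_def)
  then show ?thesis by blast
qed

text \<open>The map \<open>x \<mapsto> 2 *\<^sub>R c - inversion c r x\<close> is the antipodal map
  in stereographic coordinates. With \<open>R\<^sup>2 = r\<^sup>2 + (norm (a - c))\<^sup>2\<close>,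
  the squared distance of the image from \<open>a\<close>, minus \<open>R\<^sup>2\<close>, is a
  positive multiple of \<open>R\<^sup>2 - (norm (x - a))\<^sup>2\<close>.\<close>

lemma norm_antipodal_less_iff:
  fixes x a c :: "'a::real_inner"
  assumes "x \<noteq> c" "0 < r"
  shows "(norm (2 *\<^sub>R c - inversion c r x - a))\<^sup>2 < r\<^sup>2 + (norm (a - c))\<^sup>2 \<longleftrightarrow> r\<^sup>2 + (norm (a - c))\<^sup>2 < (norm (x - a))\<^sup>2"
proof -
  define y e where "y = x - c" and "e = a - c"
  define n where "n = norm y"
  have n: "0 < n" using assms by (simp add: n_def y_def)
  have gen: "(norm (- e - t *\<^sub>R y))\<^sup>2 = (norm e)\<^sup>2 + 2 * t * (e \<bullet> y) + t\<^sup>2 * (norm y)\<^sup>2" for t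
    unfolding power2_norm_eq_inner by (simp add: inner_commute[of y e] power2_eq_square algebra_simps)
  have 1: "2 *\<^sub>R c - inversion c r x - a = - e - (r / n)\<^sup>2 *\<^sub>R y"
    by (simp add: inversion_def y_def e_def n_def scaleR_2)
  have 2: "(norm (x - a))\<^sup>2 = n\<^sup>2 - 2 * (e \<bullet> y) + (norm e)\<^sup>2"
  proof -
    have "(norm (x - a))\<^sup>2 = (norm (- e - (- 1) *\<^sub>R y))\<^sup>2" by (simp add: y_def e_def)
    then show ?thesis unfolding gen by (simp add: n_def)
  qed
  have "(norm (- e - (r / n)\<^sup>2 *\<^sub>R y))\<^sup>2 - (r\<^sup>2 + (norm e)\<^sup>2) = (r / n)\<^sup>2 * (r\<^sup>2 + (norm e)\<^sup>2 - (norm (x - a))\<^sup>2)"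
    unfolding gen 2 n_def[symmetric] using n by (simp add: power_divide power2_eq_square field_simps)
  moreover have "0 < (r / n)\<^sup>2" using n assms by simp
  ultimately have "(norm (- e - (r / n)\<^sup>2 *\<^sub>R y))\<^sup>2 - (r\<^sup>2 + (norm e)\<^sup>2) < 0 \<longleftrightarrow> r\<^sup>2 + (norm e)\<^sup>2 - (norm (x - a))\<^sup>2 < 0"
    by (simp add: mult_less_0_iff)
  then show ?thesis unfolding 1 e_def[symmetric] by simp
qed

text \<open>The center is sought on the line through \<open>x\<close> and \<open>y\<close>, at
  parameter \<open>t\<close>. Being mirror images means \<open>(x - a) \<bullet> (y - a) = r\<^sup>2
  + (norm (a - c))\<^sup>2\<close>. Relative to \<open>c\<close> the square of the center cancels,
  which leaves a linear equation for \<open>t\<close> with coefficient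
  \<open>X \<bullet> X - Y \<bullet> Y\<close>; hence the two distances to \<open>c\<close> must
  differ.\<close>

lemma ex_inversion_swapping:
  fixes x y c :: "'a::real_inner"
  assumes r: "0 < r" and neq: "norm (y - c) \<noteq> norm (x - c)"
  obtains a where "a \<noteq> x" "inversion a (sqrt (r\<^sup>2 + (norm (a - c))\<^sup>2)) x = y"
proof -
  define X Y D where "X = x - c" and "Y = y - c" and "D = X - Y"
  define t where "t = - (r\<^sup>2 + Y \<bullet> Y) / (X \<bullet> X - Y \<bullet> Y)"
  define e where "e = Y + t *\<^sub>R D"
  have "X \<bullet> X \<noteq> Y \<bullet> Y" using neq by (metis X_def Y_def norm_eq)
  then have t: "t * (X \<bullet> X - Y \<bullet> Y) = - (r\<^sup>2 + Y \<bullet> Y)" by (simp add: t_def)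
  have "D \<bullet> (X + Y) = X \<bullet> X - Y \<bullet> Y" by (simp add: D_def inner_commute[of Y X] algebra_simps)
  then have eXY: "e \<bullet> (X + Y) = Y \<bullet> (X + Y) + t * (X \<bullet> X - Y \<bullet> Y)" by (simp only: e_def inner_add_left inner_scaleR_left)
  have "(X - e) \<bullet> (Y - e) = X \<bullet> Y - e \<bullet> (X + Y) + e \<bullet> e"
    by (simp add: inner_commute[of X e] algebra_simps)
  also have "\<dots> = r\<^sup>2 + e \<bullet> e" unfolding eXY t by (simp add: inner_commute[of Y X] algebra_simps)
  finally have R: "(X - e) \<bullet> (Y - e) = r\<^sup>2 + e \<bullet> e" .
  have Xe: "X - e = (1 - t) *\<^sub>R D" and Ye: "Y - e = (- t) *\<^sub>R D" by (simp_all add: e_def D_def algebra_simps)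
  have R': "- t * (1 - t) * (D \<bullet> D) = r\<^sup>2 + e \<bullet> e" unfolding R[symmetric] Xe Ye by simp
  have pos: "0 < r\<^sup>2 + e \<bullet> e" using r by (simp add: add_pos_nonneg)
  have t1: "1 - t \<noteq> 0" "D \<bullet> D \<noteq> 0" using R' pos by auto
  show thesis
  proof
    have xa: "x - (c + e) = (1 - t) *\<^sub>R D" unfolding Xe[symmetric] by (simp add: X_def)
    then show "c + e \<noteq> x" using t1 by auto
    have "(sqrt (r\<^sup>2 + (norm (c + e - c))\<^sup>2) / norm (x - (c + e)))\<^sup>2 = (r\<^sup>2 + e \<bullet> e) / ((1 - t)\<^sup>2 * (D \<bullet> D))"
      unfolding xa using pos by (simp add: power_divide power2_norm_eq_inner power_mult_distrib)
    also have "\<dots> = - t / (1 - t)" 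
    proof -
      have "- t * m * d / (m\<^sup>2 * d) = - t / m" if "m \<noteq> 0" "d \<noteq> 0" for m d :: real
        using that by (simp add: power2_eq_square)
      from this[OF t1] show ?thesis unfolding R'[symmetric] .
    qed
    finally have "inversion (c + e) (sqrt (r\<^sup>2 + (norm (c + e - c))\<^sup>2)) x = c + e + (- t / (1 - t)) *\<^sub>R (1 - t) *\<^sub>R D"
      unfolding inversion_def xa by simp
    also have "\<dots> = c + (e - t *\<^sub>R D)" using t1 by simp
    also have "\<dots> = y" by (simp add: e_def Y_def)
    finally show "inversion (c + e) (sqrt (r\<^sup>2 + (norm (c + e - c))\<^sup>2)) x = y" .
  qed
qed

text \<open>The point is fixed and the center varies: differentiability in the center makes a null
  set of centers yield a null set of images.\<close>

lemma differentiable_inversion_center: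
  fixes x c :: "'a::euclidean_space"
  assumes "x \<notin> S"
  shows "(\<lambda>a. inversion a (sqrt (r\<^sup>2 + (norm (a - c))\<^sup>2)) x) differentiable_on S"
proof -
  have eq: "(\<lambda>a. inversion a (sqrt (r\<^sup>2 + (norm (a - c))\<^sup>2)) x) =
      (\<lambda>a. a + ((r\<^sup>2 + (a - c) \<bullet> (a - c)) * inverse ((x - a) \<bullet> (x - a))) *\<^sub>R (x - a))"
    by (simp add: fun_eq_iff inversion_def power_divide power2_norm_eq_inner flip: divide_inverse)
  show ?thesis
    unfolding eq differentiable_on_def differentiable_def
  proof
    fix a assume "a \<in> S"
    then have n: "(x - a) \<bullet> (x - a) \<noteq> 0" using assms by auto
    show "\<exists>D. ((\<lambda>a. a + ((r\<^sup>2 + (a - c) \<bullet> (a - c)) * inverse ((x - a) \<bullet> (x - a))) *\<^sub>R (x - a)) has_derivative D) (at a within S)"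
      by (rule exI) (rule derivative_intros n)+
  qed
qed

text \<open>The optimizer \<open>h\<close> with center \<open>c\<close> and scale \<open>r\<close>
  is fixed by the same inversions as \<open>f\<close>, so \<open>F = f / h\<close> is invariant
  under composition with each of them. Any two points at different distances from \<open>c\<close>
  are exchanged by one of these inversions, which leaves no room for a nonconstant \<open>F\<close>;
  the work lies in the exceptional null sets.\<close>

lemma optimizer_if_comparable:
  fixes f :: "real^'n \<Rightarrow> real" and l :: real
  defines "q \<equiv> 2 * real CARD('n) - l"
  assumes [measurable]: "f \<in> borel_measurable borel" and nn: "\<And>x. 0 \<le> f x"
    and pq: "p * q = 2 * real CARD('n)" and p: "0 < p"
    and fin: "(\<integral>\<^sup>+x. ennreal (f x powr p) \<partial>lborel) < \<infinity>"
    and nz: "\<not> (AE x in lborel. f x = 0)"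
    and half: "\<And>i c. (AE x in lborel. x \<in> {x. x $ i < c} \<longrightarrow> pullback q (coord_reflection i c) (\<lambda>_. 1) f x \<le> f x) \<or>
       (AE x in lborel. x \<in> {x. x $ i < c} \<longrightarrow> f x \<le> pullback q (coord_reflection i c) (\<lambda>_. 1) f x)"
    and ball: "\<And>a r. 0 < r \<Longrightarrow>
       (AE x in lborel. x \<in> {x. x \<noteq> a \<and> norm (x - a) < r} \<longrightarrow> pullback q (inversion a r) (inversion_weight a r) f x \<le> f x) \<or>
       (AE x in lborel. x \<in> {x. x \<noteq> a \<and> norm (x - a) < r} \<longrightarrow> f x \<le> pullback q (inversion a r) (inversion_weight a r) f x)"
  shows "\<exists>a b c. 0 < b \<and> 0 < c \<and> (AE x in lborel. f x = c * HLS_optimizer l a b x)"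
proof -
  obtain c where even: "AE x in lborel. f (2 *\<^sub>R c - x) = f x"
    using ex_symmetric_center[OF assms(2) nn pq p fin half] by blast
  let ?\<phi> = "\<lambda>x. ennreal (f x powr p)"
  let ?B = "\<lambda>a r. {x. x \<noteq> a \<and> norm (x - a) < r}"
  have B_meas [measurable]: "?B a r \<in> sets borel" for a :: "real^'n" and r by measurable
  have nz': "(\<integral>\<^sup>+x. ?\<phi> x \<partial>lborel) \<noteq> 0"
  proof
    assume "(\<integral>\<^sup>+x. ?\<phi> x \<partial>lborel) = 0"
    then have "AE x in lborel. f x = 0" by (rule AE_zero_if_norm_zero[OF assms(2) nn])
    with nz show False by simp
  qed
  have fixed: "AE x in lborel. pullback q (inversion a r) (inversion_weight a r) f x = f x"
    if r: "0 < r" and bisect: "(\<integral>\<^sup>+x. ?\<phi> x * indicator {x. norm (x - a) < r} x \<partial>lborel) =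
      (\<integral>\<^sup>+x. ?\<phi> x * indicator {x. r < norm (x - a)} x \<partial>lborel)" for a r
  proof -
    interpret conformal_reflection "inversion a r" "inversion_weight a r" "?B a r"
      by (rule conformal_reflection_ball[OF r])
    show ?thesis
    proof (rule pullback_fixed_if_bisecting[OF assms(2) nn pq p fin ball[OF r]])
      have "(\<integral>\<^sup>+x. ?\<phi> x * indicator (?B a r) x \<partial>lborel) = (\<integral>\<^sup>+x. ?\<phi> x * indicator {x. norm (x - a) < r} x \<partial>lborel)"
        by (intro nn_integral_cong_AE eventually_mono[OF AE_lborel_singleton[of a]]) (auto simp: indicator_def)
      also note bisect
      also have "(\<integral>\<^sup>+x. ?\<phi> x * indicator {x. r < norm (x - a)} x \<partial>lborel) =
          (\<integral>\<^sup>+x. ?\<phi> x * indicator (?B a r) (inversion a r x) \<partial>lborel)"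
        by (intro nn_integral_cong_AE eventually_mono[OF AE_lborel_singleton[of a]])
           (use r in \<open>auto simp: indicator_def norm_inversion_less_iff inversion_eq_center_iff\<close>)
      finally show "(\<integral>\<^sup>+x. ?\<phi> x * indicator (?B a r) x \<partial>lborel) = (\<integral>\<^sup>+x. ?\<phi> x * indicator (?B a r) (inversion a r x) \<partial>lborel)" .
    qed
  qed
  have "\<exists>r. (\<integral>\<^sup>+x. ?\<phi> x * indicator {x. norm (x - c) < r} x \<partial>lborel) = (\<integral>\<^sup>+x. ?\<phi> x * indicator {x. r < norm (x - c)} x \<partial>lborel)"
    by (rule ex_bisecting_level[OF _ _ AE_lborel_not_sphere fin]) measurable
  then obtain r where bis: "(\<integral>\<^sup>+x. ?\<phi> x * indicator {x. norm (x - c) < r} x \<partial>lborel) = (\<integral>\<^sup>+x. ?\<phi> x * indicator {x. r < norm (x - c)} x \<partial>lborel)" ..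
  \<comment> \<open>For \<open>r \<le> 0\<close> the inside has no mass and the outside has all of
    it, so bisection would make the total mass zero.\<close>
  have r: "0 < r"
  proof (rule ccontr)
    assume "\<not> 0 < r"
    then have "(\<integral>\<^sup>+x. ?\<phi> x * indicator {x. norm (x - c) < r} x \<partial>lborel) = (\<integral>\<^sup>+x. 0 \<partial>(lborel :: (real^'n) measure))"
      by (intro nn_integral_cong) (auto simp: indicator_def dest: order.strict_trans1[OF norm_ge_zero])
    moreover have "(\<integral>\<^sup>+x. ?\<phi> x * indicator {x. r < norm (x - c)} x \<partial>lborel) = (\<integral>\<^sup>+x. ?\<phi> x \<partial>lborel)"
      by (intro nn_integral_cong_AE eventually_mono[OF AE_lborel_singleton[of c]])
         (use \<open>\<not> 0 < r\<close> in \<open>auto simp: indicator_def intro: order.strict_trans1[of r 0]\<close>)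
    ultimately show False using bis nz' by simp
  qed
  have inv: "AE x in lborel. pullback q (inversion c r) (inversion_weight c r) f x = f x" by (rule fixed[OF r bis])
  define R where "R a = sqrt (r\<^sup>2 + (norm (a - c))\<^sup>2)" for a
  have R: "0 < R a" "(R a)\<^sup>2 = r\<^sup>2 + (norm (a - c))\<^sup>2" for a
    using r by (simp_all add: R_def add_pos_nonneg)
  \<comment> \<open>The inversion at \<open>c\<close> and the point reflection both preserve the
    mass density of \<open>f\<close>, and their composition, the antipodal map, carries the inside
    of the sphere of radius \<open>R a\<close> about \<open>a\<close> to its outside. That sphere
    therefore bisects the mass.\<close>
  have fixedR: "AE x in lborel. pullback q (inversion a (R a)) (inversion_weight a (R a)) f x = f x" for a
  proof (rule fixed[OF R(1)])
    let ?b = "\<lambda>x. indicator {x. norm (x - a) < R a} x :: ennreal"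
    interpret conformal_reflection "inversion c r" "inversion_weight c r" "?B c r"
      by (rule conformal_reflection_ball[OF r])
    have "(\<integral>\<^sup>+x. ?\<phi> x * ?b x \<partial>lborel) = (\<integral>\<^sup>+x. ?\<phi> (inversion c r x) * ?b (inversion c r x) * ennreal (inversion_weight c r x ^ (2 * CARD('n))) \<partial>lborel)"
      by (rule nn_integral_s[symmetric]) measurable
    also have "\<dots> = (\<integral>\<^sup>+x. ?\<phi> x * ?b (inversion c r x) \<partial>lborel)"
    proof (rule nn_integral_cong_AE, use inv in eventually_elim)
      fix x assume x: "pullback q (inversion c r) (inversion_weight c r) f x = f x"
      have "inversion_weight c r x ^ (2 * CARD('n)) = inversion_weight c r x powr (p * q)"
        unfolding pq using powr_realpow[OF w_pos, of x "2 * CARD('n)"] by simp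
      then have "f (inversion c r x) powr p * inversion_weight c r x ^ (2 * CARD('n)) = f x powr p"
        unfolding x[symmetric] using nn[of "inversion c r x"] w_pos[of x]
        by (simp add: pullback_def powr_mult powr_powr mult.commute)
      then have eq: "?\<phi> (inversion c r x) * ennreal (inversion_weight c r x ^ (2 * CARD('n))) = ?\<phi> x" by (simp flip: ennreal_mult')
      show "?\<phi> (inversion c r x) * ?b (inversion c r x) * ennreal (inversion_weight c r x ^ (2 * CARD('n))) = ?\<phi> x * ?b (inversion c r x)"
        using arg_cong[OF eq, of "\<lambda>t. t * ?b (inversion c r x)"] by (simp only: mult_ac)
    qed
    also have "\<dots> = (\<integral>\<^sup>+x. ?\<phi> (2 *\<^sub>R c - x) * ?b (inversion c r (2 *\<^sub>R c - x)) \<partial>lborel)"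
      by (rule nn_integral_point_reflection[symmetric]) measurable
    also have "\<dots> = (\<integral>\<^sup>+x. ?\<phi> x * indicator {x. R a < norm (x - a)} x \<partial>lborel)"
    proof (rule nn_integral_cong_AE, use even AE_lborel_singleton[of c] in eventually_elim)
      fix x assume x: "f (2 *\<^sub>R c - x) = f x" "x \<noteq> c"
      have "inversion c r (2 *\<^sub>R c - x) = 2 *\<^sub>R c - inversion c r x"
      proof -
        have "2 *\<^sub>R c - x - c = - (x - c)" by (simp add: scaleR_2)
        then show ?thesis unfolding inversion_def by (simp only: norm_minus_cancel) (simp add: scaleR_2 algebra_simps)
      qed
      moreover have "norm (2 *\<^sub>R c - inversion c r x - a) < R a \<longleftrightarrow> R a < norm (x - a)"
      proof -
        have "norm (2 *\<^sub>R c - inversion c r x - a) < R a \<longleftrightarrow> (norm (2 *\<^sub>R c - inversion c r x - a))\<^sup>2 < (R a)\<^sup>2"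
          using R(1)[of a] by (meson norm_ge_zero order_less_imp_le power2_less_imp_less power_strict_mono zero_less_numeral)
        also have "\<dots> \<longleftrightarrow> (R a)\<^sup>2 < (norm (x - a))\<^sup>2" unfolding R by (rule norm_antipodal_less_iff[OF x(2) r])
        also have "\<dots> \<longleftrightarrow> R a < norm (x - a)"
          using R(1)[of a] by (meson norm_ge_zero order_less_imp_le power2_less_imp_less power_strict_mono zero_less_numeral)
        finally show ?thesis .
      qed
      ultimately show "?\<phi> (2 *\<^sub>R c - x) * ?b (inversion c r (2 *\<^sub>R c - x)) = ?\<phi> x * indicator {x. R a < norm (x - a)} x"
        using x by (simp add: indicator_def)
    qed
    finally show "(\<integral>\<^sup>+x. ?\<phi> x * ?b x \<partial>lborel) = (\<integral>\<^sup>+x. ?\<phi> x * indicator {x. R a < norm (x - a)} x \<partial>lborel)" .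
  qed
  define h where "h = HLS_optimizer l c r"
  define F where "F x = f x / h x" for x
  have [measurable]: "h \<in> borel_measurable borel" unfolding h_def by measurable
  have [measurable]: "F \<in> borel_measurable borel" unfolding F_def[abs_def] by measurable
  have [measurable]: "R \<in> borel_measurable borel" unfolding R_def[abs_def] by measurable
  have hpos: "0 < h x" for x unfolding h_def by (rule HLS_optimizer_pos[OF r])
  have F: "AE x in lborel. F (inversion a (R a) x) = F x" for a
    using fixedR[of a] AE_lborel_singleton[of a]
  proof eventually_elim
    fix x assume x: "pullback q (inversion a (R a)) (inversion_weight a (R a)) f x = f x" "x \<noteq> a"
    have "pullback q (inversion a (R a)) (inversion_weight a (R a)) h x = h x"
      unfolding h_def q_def by (rule pullback_inversion_optimizer_eq[OF r x(2) R(2) R(1)])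
    with x(1) have "F x = (inversion_weight a (R a) x powr q * f (inversion a (R a) x)) /
        (inversion_weight a (R a) x powr q * h (inversion a (R a) x))" by (simp add: F_def pullback_def)
    moreover have "0 < inversion_weight a (R a) x powr q" using x(2) R(1)[of a] by (simp add: inversion_weight_def)
    ultimately show "F (inversion a (R a) x) = F x" by (simp add: F_def)
  qed
  \<comment> \<open>The exceptional set of points depends on the center. Fubini's theorem exchanges
    the roles, so that one base point \<open>x0\<close> works for almost every center.\<close>
  have "AE x in lborel. AE a in lborel. F (inversion a (R a) x) = F x"
  proof (subst lborel_pair.AE_commute)
    show "{z \<in> space (lborel \<Otimes>\<^sub>M lborel). F (inversion (snd z) (R (snd z)) (fst z)) = F (fst z)} \<in> sets (lborel \<Otimes>\<^sub>M lborel)"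
      by measurable
  qed (use F in simp)
  then obtain x0 where x0: "AE a in lborel. F (inversion a (R a) x0) = F x0"
    using AE_lborel_ex by blast
  then obtain Z where Z: "Z \<in> null_sets lborel" "{a. F (inversion a (R a) x0) \<noteq> F x0} \<subseteq> Z"
    by (auto simp: eventually_ae_filter)
  have "negligible Z" using Z(1) by (simp add: negligible_iff_null_sets null_sets_completionI)
  \<comment> \<open>The bad centers form a null set, and so do the points to which they send
    \<open>x0\<close>. Every other point off the sphere through \<open>x0\<close> about
    \<open>c\<close> is reached from \<open>x0\<close> by a good center.\<close>
  then have "negligible ((\<lambda>a. inversion a (R a) x0) ` (Z - {x0}))"
    unfolding R_def by (intro negligible_differentiable_image_negligible differentiable_inversion_center)
      (auto intro: negligible_subset)
  then have "AE y in lebesgue. y \<notin> (\<lambda>a. inversion a (R a) x0) ` (Z - {x0})"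
    by (simp add: negligible_iff_null_sets AE_not_in)
  then have "AE y in lborel. y \<notin> (\<lambda>a. inversion a (R a) x0) ` (Z - {x0})" by (simp add: AE_completion_iff)
  then have Fc: "AE y in lborel. F y = F x0"
    using AE_lborel_not_sphere[of c "norm (x0 - c)"]
  proof eventually_elim
    fix y assume y: "y \<notin> (\<lambda>a. inversion a (R a) x0) ` (Z - {x0})" "norm (y - c) \<noteq> norm (x0 - c)"
    obtain a where a: "a \<noteq> x0" "inversion a (R a) x0 = y" using ex_inversion_swapping[OF r y(2)] unfolding R_def by blast
    with y(1) have "a \<notin> Z" by blast
    then have "F (inversion a (R a) x0) = F x0" using Z(2) by blast
    with a show "F y = F x0" by simp
  qed
  then have fh: "AE y in lborel. f y = F x0 * h y"
    by eventually_elim (use hpos in \<open>auto simp: F_def field_simps less_imp_neq[symmetric]\<close>)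
  have "F x0 \<noteq> 0" using nz fh by auto
  moreover have "0 \<le> F x0" using nn[of x0] hpos[of x0] by (simp add: F_def)
  ultimately show ?thesis using fh r unfolding h_def by (intro exI[of _ c] exI[of _ r] exI[of _ "F x0"]) auto
qed

section \<open>Positive definiteness\<close>

lemma nn_integral_gaussian_real:
  assumes t: "0 < t"
  shows "(\<integral>\<^sup>+x. ennreal (exp (- t * (x - m)\<^sup>2)) \<partial>lborel) = ennreal ((pi / t) powr (1 / 2))"
proof -
  \<comment> \<open>The standard deviation for which the integrand is an unnormalized normal
    density: \<open>2 * \<sigma>\<^sup>2 = 1 / t\<close>.\<close>
  define \<sigma> where "\<sigma> = sqrt (1 / (2 * t))"
  have \<sigma>: "0 < \<sigma>" "2 * \<sigma>\<^sup>2 = 1 / t" using t by (simp_all add: \<sigma>_def)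
  interpret prob_space "density lborel (normal_density m \<sigma>)" by (rule prob_space_normal_density[OF \<sigma>(1)])
  have 1: "(\<integral>\<^sup>+x. ennreal (normal_density m \<sigma> x) \<partial>lborel) = 1"
    using emeasure_space_1 by (simp add: emeasure_density)
  have c: "sqrt (2 * pi * \<sigma>\<^sup>2) = (pi / t) powr (1 / 2)"
  proof -
    have "2 * pi * \<sigma>\<^sup>2 = pi / t" using \<sigma>(2) by (metis mult.assoc mult.commute times_divide_eq_right mult.right_neutral)
    then show ?thesis using t by (simp add: powr_half_sqrt)
  qed
  have "ennreal (exp (- t * (x - m)\<^sup>2)) = ennreal ((pi / t) powr (1 / 2)) * ennreal (normal_density m \<sigma> x)" for x
  proof -
    have "(x - m)\<^sup>2 / (2 * \<sigma>\<^sup>2) = t * (x - m)\<^sup>2" unfolding \<sigma>(2) by simp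
    then show ?thesis using t by (simp add: normal_density_def c flip: ennreal_mult')
  qed
  then show ?thesis by (simp add: nn_integral_cmult 1)
qed

lemma nn_integral_gaussian:
  fixes z :: "'a::euclidean_space"
  assumes t: "0 < t"
  shows "(\<integral>\<^sup>+x. ennreal (exp (- t * (norm (x - z))\<^sup>2)) \<partial>lborel) = ennreal ((pi / t) powr (real DIM('a) / 2))"
proof -
  have "exp (- t * (norm (x - z))\<^sup>2) = (\<Prod>b\<in>Basis. exp (- t * (x \<bullet> b - z \<bullet> b)\<^sup>2))" for x
  proof -
    have "(norm (x - z))\<^sup>2 = (\<Sum>b\<in>Basis. (x \<bullet> b - z \<bullet> b)\<^sup>2)"
      unfolding power2_norm_eq_inner by (subst euclidean_inner) (simp add: inner_diff_left power2_eq_square)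
    then show ?thesis by (simp add: sum_distrib_left exp_sum flip: sum_negf)
  qed
  then have "(\<integral>\<^sup>+x. ennreal (exp (- t * (norm (x - z))\<^sup>2)) \<partial>lborel) =
      (\<integral>\<^sup>+x. (\<Prod>b\<in>Basis. ennreal (exp (- t * (x \<bullet> b - z \<bullet> b)\<^sup>2))) \<partial>lborel)"
    by (simp add: prod_ennreal)
  also have "\<dots> = (\<Prod>b\<in>(Basis :: 'a set). \<integral>\<^sup>+x. ennreal (exp (- t * (x - z \<bullet> b)\<^sup>2)) \<partial>lborel)"
    by (rule nn_integral_lborel_prod[where f = "\<lambda>b x. ennreal (exp (- t * (x - z \<bullet> b)\<^sup>2))"]) auto
  also have "\<dots> = ennreal ((pi / t) powr (1 / 2)) ^ DIM('a)"
    unfolding nn_integral_gaussian_real[OF t] by simp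
  also have "\<dots> = ennreal ((pi / t) powr (real DIM('a) / 2))"
    using t by (simp add: ennreal_power powr_powr flip: powr_realpow)
  finally show ?thesis .
qed

lemma nn_integral_Gamma:
  assumes s: "0 < s" and a: "0 < a"
  shows "(\<integral>\<^sup>+t. ennreal (t powr (s - 1) * exp (- a * t)) * indicator {0<..} t \<partial>lborel) = ennreal (Gamma s * a powr (- s))"
proof -
  have "ennreal (Gamma s) = (\<integral>\<^sup>+t. ennreal (t powr (s - 1) / exp t) * indicator {0..} t \<partial>lborel)"
    by (rule nn_integral_has_integral_lebesgue'[symmetric]) (use Gamma_integral_real[OF s] in auto)
  also have "\<dots> = (\<integral>\<^sup>+t. ennreal (t powr (s - 1) / exp t) * indicator {0<..} t \<partial>lborel)"
    by (intro nn_integral_cong_AE eventually_mono[OF AE_lborel_singleton[of 0]]) (auto simp: indicator_def)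
  also have "\<dots> = ennreal \<bar>a\<bar> * (\<integral>\<^sup>+t. ennreal ((0 + a * t) powr (s - 1) / exp (0 + a * t)) * indicator {0<..} (0 + a * t) \<partial>lborel)"
    by (rule nn_integral_real_affine) (use a in auto)
  also have "\<dots> = (\<integral>\<^sup>+t. ennreal a * (ennreal ((0 + a * t) powr (s - 1) / exp (0 + a * t)) * indicator {0<..} (0 + a * t)) \<partial>lborel)"
    using a by (subst nn_integral_cmult) auto
  also have "\<dots> = (\<integral>\<^sup>+t. ennreal (a powr s) * (ennreal (t powr (s - 1) * exp (- a * t)) * indicator {0<..} t) \<partial>lborel)"
  proof (intro nn_integral_cong)
    fix t
    have "a * ((a * t) powr (s - 1) / exp (a * t)) = a powr s * (t powr (s - 1) * exp (- a * t))" if "0 < t"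
    proof -
      have "a * a powr (s - 1) = a powr s" using a by (simp add: powr_diff)
      moreover have "(a * t) powr (s - 1) = a powr (s - 1) * t powr (s - 1)" using a that by (simp add: powr_mult)
      ultimately show ?thesis by (simp add: exp_minus divide_inverse mult.assoc flip: mult.assoc[of a])
    qed
    then show "ennreal a * (ennreal ((0 + a * t) powr (s - 1) / exp (0 + a * t)) * indicator {0<..} (0 + a * t)) =
      ennreal (a powr s) * (ennreal (t powr (s - 1) * exp (- a * t)) * indicator {0<..} t)"
      using a by (auto simp: indicator_def zero_less_mult_iff simp flip: ennreal_mult')
  qed
  also have "\<dots> = ennreal (a powr s) * (\<integral>\<^sup>+t. ennreal (t powr (s - 1) * exp (- a * t)) * indicator {0<..} t \<partial>lborel)"
    by (rule nn_integral_cmult) auto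
  finally have "ennreal (a powr (- s)) * ennreal (Gamma s) = ennreal (a powr (- s)) * (ennreal (a powr s) *
    (\<integral>\<^sup>+t. ennreal (t powr (s - 1) * exp (- a * t)) * indicator {0<..} t \<partial>lborel))" by simp
  also have "\<dots> = ennreal (a powr (- s) * a powr s) * (\<integral>\<^sup>+t. ennreal (t powr (s - 1) * exp (- a * t)) * indicator {0<..} t \<partial>lborel)"
    by (simp add: ennreal_mult' mult.assoc)
  also have "a powr (- s) * a powr s = 1" using a by (simp flip: powr_add)
  finally show ?thesis using Gamma_real_pos[OF s] by (simp add: mult.commute flip: ennreal_mult')
qed

text \<open>A Gamma integral in \<open>t\<close> writes the power as a superposition of Gaussians.
  Integrating over space first costs a factor \<open>t powr (- real DIM('a) / 2)\<close> and leaves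
  a Gamma integral with parameter \<open>s - real DIM('a) / 2\<close>, positive by
  hypothesis.\<close>

lemma nn_integral_japanese_bracket:
  fixes a :: "'a::euclidean_space"
  assumes b: "0 < b" and s: "real DIM('a) / 2 < s"
  shows "(\<integral>\<^sup>+x. ennreal ((b\<^sup>2 + (norm (x - a))\<^sup>2) powr (- s)) \<partial>lborel) =
    ennreal (pi powr (real DIM('a) / 2) * Gamma (s - real DIM('a) / 2) / Gamma s * b powr (real DIM('a) - 2 * s))"
proof -
  define d where "d = real DIM('a) / 2"
  have s0: "0 < s" "0 < s - d" using s by (auto simp: d_def intro: le_less_trans[rotated])
  have G: "0 < Gamma s" using s0 by (simp add: Gamma_real_pos)
  let ?f = "\<lambda>x t. ennreal (t powr (s - 1) * exp (- (b\<^sup>2 + (norm (x - a))\<^sup>2) * t)) * indicator {0<..} t"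
  have "ennreal (Gamma s) * (\<integral>\<^sup>+x. ennreal ((b\<^sup>2 + (norm (x - a))\<^sup>2) powr (- s)) \<partial>lborel) =
      (\<integral>\<^sup>+x. ennreal (Gamma s) * ennreal ((b\<^sup>2 + (norm (x - a))\<^sup>2) powr (- s)) \<partial>lborel)"
    by (rule nn_integral_cmult[symmetric]) measurable
  also have "\<dots> = (\<integral>\<^sup>+x. \<integral>\<^sup>+t. ?f x t \<partial>lborel \<partial>lborel)"
  proof (intro nn_integral_cong)
    fix x
    have "0 < b\<^sup>2 + (norm (x - a))\<^sup>2" using b by (simp add: add_pos_nonneg)
    from nn_integral_Gamma[OF s0(1) this]
    show "ennreal (Gamma s) * ennreal ((b\<^sup>2 + (norm (x - a))\<^sup>2) powr (- s)) = (\<integral>\<^sup>+t. ?f x t \<partial>lborel)"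
      using G by (simp flip: ennreal_mult')
  qed
  also have "\<dots> = (\<integral>\<^sup>+t. \<integral>\<^sup>+x. ?f x t \<partial>lborel \<partial>lborel)"
    by (rule lborel_pair.Fubini'[symmetric]) measurable
  also have "\<dots> = (\<integral>\<^sup>+t. ennreal (pi powr d) * (ennreal (t powr (s - d - 1) * exp (- b\<^sup>2 * t)) * indicator {0<..} t) \<partial>lborel)"
  proof (intro nn_integral_cong)
    fix t :: real
    show "(\<integral>\<^sup>+x. ?f x t \<partial>lborel) = ennreal (pi powr d) * (ennreal (t powr (s - d - 1) * exp (- b\<^sup>2 * t)) * indicator {0<..} t)"
    proof (cases "0 < t")
      case True
      have "(\<integral>\<^sup>+x. ?f x t \<partial>lborel) = (\<integral>\<^sup>+x. ennreal (t powr (s - 1) * exp (- b\<^sup>2 * t)) * ennreal (exp (- t * (norm (x - a))\<^sup>2)) \<partial>lborel)"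
        using True by (intro nn_integral_cong) (simp add: algebra_simps flip: ennreal_mult' exp_add exp_diff)
      also have "\<dots> = ennreal (t powr (s - 1) * exp (- b\<^sup>2 * t)) * ennreal ((pi / t) powr d)"
        unfolding d_def nn_integral_gaussian[OF True, of a, symmetric] by (rule nn_integral_cmult) measurable
      also have "\<dots> = ennreal (t powr (s - 1) * exp (- b\<^sup>2 * t) * (pi / t) powr d)" by (simp add: ennreal_mult')
      also have "t powr (s - 1) * exp (- b\<^sup>2 * t) * (pi / t) powr d = pi powr d * (t powr (s - d - 1) * exp (- b\<^sup>2 * t))"
      proof -
        have "t powr (s - 1) = t powr (s - d - 1) * t powr d" using True by (simp flip: powr_add)
        moreover have "(pi / t) powr d = pi powr d / t powr d" using True by (simp add: powr_divide)
        ultimately show ?thesis using True by simp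
      qed
      finally show ?thesis using True by (simp add: ennreal_mult')
    qed simp
  qed
  also have "\<dots> = ennreal (pi powr d) * (\<integral>\<^sup>+t. ennreal (t powr (s - d - 1) * exp (- b\<^sup>2 * t)) * indicator {0<..} t \<partial>lborel)"
    by (rule nn_integral_cmult) measurable
  also have "\<dots> = ennreal (pi powr d) * ennreal (Gamma (s - d) * (b\<^sup>2) powr (- (s - d)))"
    using nn_integral_Gamma[OF s0(2), of "b\<^sup>2"] b by simp
  also have "(b\<^sup>2) powr (- (s - d)) = b powr (2 * d - 2 * s)"
  proof -
    have "b\<^sup>2 = b powr 2" using b by (simp add: powr_numeral)
    then show ?thesis by (simp add: powr_powr algebra_simps)
  qed
  finally have eq: "ennreal (Gamma s) * (\<integral>\<^sup>+x. ennreal ((b\<^sup>2 + (norm (x - a))\<^sup>2) powr (- s)) \<partial>lborel) =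
      ennreal (pi powr d * (Gamma (s - d) * b powr (2 * d - 2 * s)))" by (simp add: ennreal_mult')
  have "(\<integral>\<^sup>+x. ennreal ((b\<^sup>2 + (norm (x - a))\<^sup>2) powr (- s)) \<partial>lborel) =
      ennreal (inverse (Gamma s)) * (ennreal (Gamma s) * (\<integral>\<^sup>+x. ennreal ((b\<^sup>2 + (norm (x - a))\<^sup>2) powr (- s)) \<partial>lborel))"
    unfolding mult.assoc[symmetric] using G by (simp flip: ennreal_mult')
  also have "\<dots> = ennreal (pi powr d * Gamma (s - d) / Gamma s * b powr (2 * d - 2 * s))"
    unfolding eq using G by (simp add: divide_inverse mult_ac flip: ennreal_mult')
  finally show ?thesis by (simp add: d_def)
qed

text \<open>The kernel is a Gamma integral of \<open>exp (- t * (norm (x - y))\<^sup>2)\<close>.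
  Each of these Gaussians is in turn the overlap of two Gaussians of exponent \<open>2 * t\<close>
  centered at \<open>x\<close> and \<open>y\<close>: completing the square about the midpoint of
  \<open>x\<close> and \<open>y\<close> leaves a Gaussian of exponent \<open>4 * t\<close> in
  \<open>z\<close>, whose integral is compensated by
  \<open>(4 * t / pi) powr (real DIM('a) / 2)\<close>.\<close>

lemma riesz_kernel_gaussian:
  fixes x y :: "'a::euclidean_space"
  assumes l: "0 < l" and xy: "x \<noteq> y"
  shows "ennreal (norm (x - y) powr (- l)) =
    (\<integral>\<^sup>+t. \<integral>\<^sup>+z. ennreal (t powr (l / 2 - 1) * (4 * t / pi) powr (real DIM('a) / 2) / Gamma (l / 2)) * indicator {0<..} t *
      ennreal (exp (- 2 * t * (norm (x - z))\<^sup>2)) * ennreal (exp (- 2 * t * (norm (y - z))\<^sup>2)) \<partial>lborel \<partial>lborel)"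
proof -
  define d where "d = real DIM('a) / 2"
  have G: "0 < Gamma (l / 2)" using l by (simp add: Gamma_real_pos)
  have gauss: "(\<integral>\<^sup>+z. ennreal (exp (- 2 * t * (norm (x - z))\<^sup>2)) * ennreal (exp (- 2 * t * (norm (y - z))\<^sup>2)) \<partial>lborel) =
      ennreal (exp (- (norm (x - y))\<^sup>2 * t)) * ennreal ((pi / (4 * t)) powr d)" if t: "0 < t" for t
  proof -
    define m where "m = (1 / 2) *\<^sub>R (x + y)"
    have sq: "(norm (x - z))\<^sup>2 + (norm (y - z))\<^sup>2 = 2 * (norm (z - m))\<^sup>2 + (norm (x - y))\<^sup>2 / 2" for z
    proof -
      define u v where "u = x - z" and "v = y - z"
      have "z - m = (- 1 / 2) *\<^sub>R (u + v)"
      proof -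
        have "z = (1 / 2) *\<^sub>R (z + z)" by (simp add: scaleR_2[symmetric])
        then show ?thesis unfolding m_def u_def v_def by (simp add: algebra_simps)
      qed
      moreover have "x - y = u - v" by (simp add: u_def v_def)
      moreover have "(norm u)\<^sup>2 + (norm v)\<^sup>2 = 2 * (norm ((- 1 / 2) *\<^sub>R (u + v)))\<^sup>2 + (norm (u - v))\<^sup>2 / 2"
        unfolding power2_norm_eq_inner by (simp add: inner_commute[of v u] inner_add_left inner_add_right inner_diff_left inner_diff_right field_simps)
      ultimately show ?thesis by (simp only: u_def v_def)
    qed
    have "- 2 * t * (norm (x - z))\<^sup>2 + - 2 * t * (norm (y - z))\<^sup>2 = - (norm (x - y))\<^sup>2 * t + - (4 * t) * (norm (z - m))\<^sup>2" for z
    proof -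
      have "- 2 * t * (norm (x - z))\<^sup>2 + - 2 * t * (norm (y - z))\<^sup>2 = - 2 * t * ((norm (x - z))\<^sup>2 + (norm (y - z))\<^sup>2)"
        by (simp add: algebra_simps)
      then show ?thesis unfolding sq by (simp add: algebra_simps)
    qed
    then have "(\<integral>\<^sup>+z. ennreal (exp (- 2 * t * (norm (x - z))\<^sup>2)) * ennreal (exp (- 2 * t * (norm (y - z))\<^sup>2)) \<partial>lborel) =
        (\<integral>\<^sup>+z. ennreal (exp (- (norm (x - y))\<^sup>2 * t)) * ennreal (exp (- (4 * t) * (norm (z - m))\<^sup>2)) \<partial>lborel)"
      by (simp only: exp_add[symmetric] ennreal_mult'[symmetric] exp_ge_zero)
    also have "\<dots> = ennreal (exp (- (norm (x - y))\<^sup>2 * t)) * (\<integral>\<^sup>+z. ennreal (exp (- (4 * t) * (norm (z - m))\<^sup>2)) \<partial>lborel)"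
      by (rule nn_integral_cmult) measurable
    finally show ?thesis using nn_integral_gaussian[of "4 * t" m] t by (simp add: d_def)
  qed
  have "(\<integral>\<^sup>+t. \<integral>\<^sup>+z. ennreal (t powr (l / 2 - 1) * (4 * t / pi) powr d / Gamma (l / 2)) * indicator {0<..} t *
      ennreal (exp (- 2 * t * (norm (x - z))\<^sup>2)) * ennreal (exp (- 2 * t * (norm (y - z))\<^sup>2)) \<partial>lborel \<partial>lborel) =
    (\<integral>\<^sup>+t. ennreal (inverse (Gamma (l / 2))) * (ennreal (t powr (l / 2 - 1) * exp (- (norm (x - y))\<^sup>2 * t)) * indicator {0<..} t) \<partial>lborel)"
  proof (intro nn_integral_cong)
    fix t :: real
    show "(\<integral>\<^sup>+z. ennreal (t powr (l / 2 - 1) * (4 * t / pi) powr d / Gamma (l / 2)) * indicator {0<..} t *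
        ennreal (exp (- 2 * t * (norm (x - z))\<^sup>2)) * ennreal (exp (- 2 * t * (norm (y - z))\<^sup>2)) \<partial>lborel) =
      ennreal (inverse (Gamma (l / 2))) * (ennreal (t powr (l / 2 - 1) * exp (- (norm (x - y))\<^sup>2 * t)) * indicator {0<..} t)"
    proof (cases "0 < t")
      case True
      have "(4 * t / pi) powr d * (pi / (4 * t)) powr d = 1" using True by (simp flip: powr_mult)
      then have "t powr (l / 2 - 1) * (4 * t / pi) powr d / Gamma (l / 2) * (exp (- (norm (x - y))\<^sup>2 * t) * (pi / (4 * t)) powr d)
        = inverse (Gamma (l / 2)) * (t powr (l / 2 - 1) * exp (- (norm (x - y))\<^sup>2 * t))"
      proof -
        have "u * v / G * (e * v') = inverse G * (u * e) * (v * v')" for u v v' e G :: real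
          by (simp add: divide_inverse)
        then show ?thesis using \<open>(4 * t / pi) powr d * (pi / (4 * t)) powr d = 1\<close> by simp
      qed
      then have eq: "ennreal (t powr (l / 2 - 1) * (4 * t / pi) powr d / Gamma (l / 2)) * (ennreal (exp (- (norm (x - y))\<^sup>2 * t)) * ennreal ((pi / (4 * t)) powr d))
        = ennreal (inverse (Gamma (l / 2))) * ennreal (t powr (l / 2 - 1) * exp (- (norm (x - y))\<^sup>2 * t))"
        using G by (simp only: ennreal_mult'[symmetric] exp_ge_zero powr_ge_zero mult_nonneg_nonneg inverse_nonnegative_iff_nonnegative less_imp_le divide_nonneg_nonneg)
      have "(\<integral>\<^sup>+z. ennreal (t powr (l / 2 - 1) * (4 * t / pi) powr d / Gamma (l / 2)) * indicator {0<..} t *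
          ennreal (exp (- 2 * t * (norm (x - z))\<^sup>2)) * ennreal (exp (- 2 * t * (norm (y - z))\<^sup>2)) \<partial>lborel) =
        (\<integral>\<^sup>+z. ennreal (t powr (l / 2 - 1) * (4 * t / pi) powr d / Gamma (l / 2)) *
          (ennreal (exp (- 2 * t * (norm (x - z))\<^sup>2)) * ennreal (exp (- 2 * t * (norm (y - z))\<^sup>2))) \<partial>lborel)"
        using True by (intro nn_integral_cong) (simp add: mult.assoc)
      also have "\<dots> = ennreal (t powr (l / 2 - 1) * (4 * t / pi) powr d / Gamma (l / 2)) *
          (ennreal (exp (- (norm (x - y))\<^sup>2 * t)) * ennreal ((pi / (4 * t)) powr d))"
        unfolding gauss[OF True, symmetric] by (rule nn_integral_cmult) measurable
      finally show ?thesis unfolding eq using True by (simp add: mult.assoc)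
    qed simp
  qed
  also have "\<dots> = ennreal (inverse (Gamma (l / 2))) * ennreal (Gamma (l / 2) * ((norm (x - y))\<^sup>2) powr (- (l / 2)))"
    using nn_integral_Gamma[of "l / 2" "(norm (x - y))\<^sup>2"] l xy by (subst nn_integral_cmult) auto
  also have "\<dots> = ennreal (((norm (x - y))\<^sup>2) powr (- (l / 2)))"
    using G by (simp add: ennreal_mult'[symmetric] mult.assoc[symmetric])
  also have "((norm (x - y))\<^sup>2) powr (- (l / 2)) = norm (x - y) powr (- l)"
  proof -
    have "(norm (x - y))\<^sup>2 = norm (x - y) powr 2" using xy by (simp add: powr_numeral)
    then show ?thesis by (simp only: powr_powr) simp
  qed
  finally show ?thesis by (simp add: d_def)
qed

text \<open>After Tonelli the variables \<open>x\<close> and \<open>y\<close> separate: the form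
  becomes an integral, with nonnegative weight, of products of Gaussian averages of \<open>f\<close>
  and \<open>g\<close>.\<close>

lemma riesz_form_gaussian:
  fixes f g :: "'a::euclidean_space \<Rightarrow> real"
  assumes [measurable]: "f \<in> borel_measurable borel" "g \<in> borel_measurable borel"
    and nn: "\<And>x. 0 \<le> f x" "\<And>x. 0 \<le> g x" and l: "0 < l"
  shows "riesz_form l f g = (\<integral>\<^sup>+t. \<integral>\<^sup>+z. ennreal (t powr (l / 2 - 1) * (4 * t / pi) powr (real DIM('a) / 2) / Gamma (l / 2)) * indicator {0<..} t *
     ((\<integral>\<^sup>+x. ennreal (f x) * ennreal (exp (- 2 * t * (norm (x - z))\<^sup>2)) \<partial>lborel) *
      (\<integral>\<^sup>+y. ennreal (g y) * ennreal (exp (- 2 * t * (norm (y - z))\<^sup>2)) \<partial>lborel)) \<partial>lborel \<partial>lborel)"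
proof -
  let ?W = "\<lambda>t. ennreal (t powr (l / 2 - 1) * (4 * t / pi) powr (real DIM('a) / 2) / Gamma (l / 2)) * indicator {0<..} t"
  let ?f = "\<lambda>t z x. ennreal (f x) * ennreal (exp (- 2 * t * (norm (x - z))\<^sup>2))"
  let ?g = "\<lambda>t z x. ennreal (g x) * ennreal (exp (- 2 * t * (norm (x - z))\<^sup>2))"
  have [measurable]: "?W \<in> borel_measurable borel" by measurable
  have "riesz_form l f g = (\<integral>\<^sup>+x. \<integral>\<^sup>+y. \<integral>\<^sup>+t. \<integral>\<^sup>+z. ?W t * (?f t z x * ?g t z y) \<partial>lborel \<partial>lborel \<partial>lborel \<partial>lborel)"
    unfolding riesz_form_def
  proof (rule nn_integral_cong, rule nn_integral_cong_AE)
    fix x :: 'a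
    show "AE y in lborel. ennreal (f x * g y * norm (x - y) powr (- l)) = (\<integral>\<^sup>+t. \<integral>\<^sup>+z. ?W t * (?f t z x * ?g t z y) \<partial>lborel \<partial>lborel)"
      using AE_lborel_singleton[of x]
    proof eventually_elim
      fix y assume "y \<noteq> x"
      then have "ennreal (f x * g y * norm (x - y) powr (- l)) = ennreal (f x * g y) * ennreal (norm (x - y) powr (- l))"
        using nn by (simp add: ennreal_mult')
      also have "\<dots> = (\<integral>\<^sup>+t. ennreal (f x * g y) * \<integral>\<^sup>+z. ?W t * ennreal (exp (- 2 * t * (norm (x - z))\<^sup>2)) * ennreal (exp (- 2 * t * (norm (y - z))\<^sup>2)) \<partial>lborel \<partial>lborel)"
        using \<open>y \<noteq> x\<close> by (subst riesz_kernel_gaussian[OF l]) (auto simp: nn_integral_cmult)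
      also have "\<dots> = (\<integral>\<^sup>+t. \<integral>\<^sup>+z. ennreal (f x * g y) * (?W t * ennreal (exp (- 2 * t * (norm (x - z))\<^sup>2)) * ennreal (exp (- 2 * t * (norm (y - z))\<^sup>2))) \<partial>lborel \<partial>lborel)"
        by (intro nn_integral_cong nn_integral_cmult[symmetric]) measurable
      also have "\<dots> = (\<integral>\<^sup>+t. \<integral>\<^sup>+z. ?W t * (?f t z x * ?g t z y) \<partial>lborel \<partial>lborel)"
        unfolding ennreal_mult'[OF nn(1)] by (intro nn_integral_cong) (simp only: mult_ac)
      finally show "ennreal (f x * g y * norm (x - y) powr (- l)) = (\<integral>\<^sup>+t. \<integral>\<^sup>+z. ?W t * (?f t z x * ?g t z y) \<partial>lborel \<partial>lborel)" .
    qed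
  qed
  also have "\<dots> = (\<integral>\<^sup>+x. \<integral>\<^sup>+t. \<integral>\<^sup>+y. \<integral>\<^sup>+z. ?W t * (?f t z x * ?g t z y) \<partial>lborel \<partial>lborel \<partial>lborel \<partial>lborel)"
    by (intro nn_integral_cong, subst lborel_pair.Fubini') simp_all
  also have "\<dots> = (\<integral>\<^sup>+t. \<integral>\<^sup>+x. \<integral>\<^sup>+y. \<integral>\<^sup>+z. ?W t * (?f t z x * ?g t z y) \<partial>lborel \<partial>lborel \<partial>lborel \<partial>lborel)"
    by (subst lborel_pair.Fubini') simp_all
  also have "\<dots> = (\<integral>\<^sup>+t. \<integral>\<^sup>+x. \<integral>\<^sup>+z. \<integral>\<^sup>+y. ?W t * (?f t z x * ?g t z y) \<partial>lborel \<partial>lborel \<partial>lborel \<partial>lborel)"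
    by (rule nn_integral_cong, rule nn_integral_cong, rule lborel_pair.Fubini'[symmetric]) measurable
  also have "\<dots> = (\<integral>\<^sup>+t. \<integral>\<^sup>+z. \<integral>\<^sup>+x. \<integral>\<^sup>+y. ?W t * (?f t z x * ?g t z y) \<partial>lborel \<partial>lborel \<partial>lborel \<partial>lborel)"
    by (rule nn_integral_cong, rule lborel_pair.Fubini'[symmetric]) measurable
  also have "\<dots> = (\<integral>\<^sup>+t. \<integral>\<^sup>+z. ?W t * ((\<integral>\<^sup>+x. ?f t z x \<partial>lborel) * (\<integral>\<^sup>+y. ?g t z y \<partial>lborel)) \<partial>lborel \<partial>lborel)"
  proof (intro nn_integral_cong)
    fix t z
    have "(\<integral>\<^sup>+x. \<integral>\<^sup>+y. ?W t * (?f t z x * ?g t z y) \<partial>lborel \<partial>lborel) = (\<integral>\<^sup>+x. ?W t * (?f t z x * (\<integral>\<^sup>+y. ?g t z y \<partial>lborel)) \<partial>lborel)"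
      by (intro nn_integral_cong) (subst nn_integral_cmult, measurable, subst nn_integral_cmult, measurable)
    also have "\<dots> = ?W t * ((\<integral>\<^sup>+x. ?f t z x \<partial>lborel) * (\<integral>\<^sup>+y. ?g t z y \<partial>lborel))"
      by (subst nn_integral_cmult, measurable, subst nn_integral_multc, measurable)
    finally show "(\<integral>\<^sup>+x. \<integral>\<^sup>+y. ?W t * (?f t z x * ?g t z y) \<partial>lborel \<partial>lborel) = ?W t * ((\<integral>\<^sup>+x. ?f t z x \<partial>lborel) * (\<integral>\<^sup>+y. ?g t z y \<partial>lborel))" .
  qed
  finally show ?thesis .
qed

lemma ennreal_two_mult_le: "2 * (a * b) \<le> a * a + b * b" for a b :: ennreal
proof (cases a; cases b)
  fix x y assume "0 \<le> x" "a = ennreal x" "0 \<le> y" "b = ennreal y"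
  moreover have "2 * (x * y) \<le> x * x + y * y" using sum_squares_bound[of x y] by (simp add: power2_eq_square)
  ultimately show ?thesis
    by (simp add: ennreal_mult'[symmetric] ennreal_plus[symmetric] ennreal_numeral[symmetric] ennreal_leI del: ennreal_plus ennreal_numeral)
qed (auto simp: ennreal_top_mult ennreal_mult_top)

text \<open>In the Gaussian representation this is \<open>2 * (a * b) \<le> a * a + b * b\<close>
  under the integral. The additive form avoids the difference \<open>f - g\<close> and remains
  meaningful for infinite values.\<close>

lemma riesz_form_positive_definite:
  fixes f g :: "'a::euclidean_space \<Rightarrow> real"
  assumes [measurable]: "f \<in> borel_measurable borel" "g \<in> borel_measurable borel"
    and nn: "\<And>x. 0 \<le> f x" "\<And>x. 0 \<le> g x" and l: "0 < l"
  shows "2 * riesz_form l f g \<le> riesz_form l f f + riesz_form l g g"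
proof -
  let ?W = "\<lambda>t. ennreal (t powr (l / 2 - 1) * (4 * t / pi) powr (real DIM('a) / 2) / Gamma (l / 2)) * indicator {0<..} t"
  let ?G = "\<lambda>h t z. \<integral>\<^sup>+x. ennreal (h x) * ennreal (exp (- 2 * t * (norm (x - z :: 'a))\<^sup>2)) \<partial>lborel"
  have "2 * riesz_form l f g = (\<integral>\<^sup>+t. \<integral>\<^sup>+z. 2 * (?W t * (?G f t z * ?G g t z)) \<partial>lborel \<partial>lborel)"
    by (subst riesz_form_gaussian[OF assms]) (simp add: nn_integral_cmult)
  also have "\<dots> \<le> (\<integral>\<^sup>+t. \<integral>\<^sup>+z. ?W t * (?G f t z * ?G f t z) + ?W t * (?G g t z * ?G g t z) \<partial>lborel \<partial>lborel)"
  proof (intro nn_integral_mono)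
    have "2 * (c * (a * b)) \<le> c * (a * a) + c * (b * b)" for a b c :: ennreal
      using mult_left_mono[OF ennreal_two_mult_le[of a b], of c] by (simp add: distrib_left mult.left_commute)
    then show "2 * (?W t * (?G f t z * ?G g t z)) \<le> ?W t * (?G f t z * ?G f t z) + ?W t * (?G g t z * ?G g t z)" for t z .
  qed
  also have "\<dots> = riesz_form l f f + riesz_form l g g"
    by (subst (1 2) riesz_form_gaussian) (use assms in \<open>simp_all add: nn_integral_add\<close>)
  finally show ?thesis .
qed

section \<open>Optimizers and the bathtub principle\<close>

text \<open>Young's inequality with exponents \<open>p\<close> and \<open>p / (p - 1)\<close>;
  geometrically, the graph of the power function lies above its tangent at \<open>b\<close>.\<close>

lemma powr_tangent_le:
  fixes a b p :: real
  assumes "0 \<le> a" "0 \<le> b" "1 < p"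
  shows "p * (a * b powr (p - 1)) \<le> a powr p + (p - 1) * b powr p"
proof -
  define p' where "p' = p / (p - 1)"
  have p': "1 < p'" "1 / p + 1 / p' = 1" using assms by (simp_all add: p'_def field_simps)
  have "a * b powr (p - 1) \<le> a powr p / p + (b powr (p - 1)) powr p' / p'"
    by (rule Youngs_inequality) (use assms p' in auto)
  also have "(b powr (p - 1)) powr p' = b powr p" using assms by (simp add: powr_powr p'_def)
  finally have "p * (a * b powr (p - 1)) \<le> p * (a powr p / p + b powr p / p')" using assms by (intro mult_left_mono) auto
  also have "\<dots> = a powr p + (p - 1) * b powr p" using assms by (simp add: p'_def field_simps)
  finally show ?thesis .
qed

text \<open>A Lagrange multiplier \<open>\<mu>\<close> for the norm constraint makes the problem
  pointwise: on the interval from \<open>0\<close> to \<open>C * h x\<close> the concave function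
  \<open>f * u x - \<mu> / p * f powr p\<close> has an explicit maximizer. It remains to choose
  \<open>\<mu>\<close> so that the constraint is met with equality, or to notice that it is never
  active.\<close>

lemma ex_bathtub_maximizer:
  fixes h u :: "'a::euclidean_space \<Rightarrow> real"
  assumes [measurable]: "h \<in> borel_measurable borel" "u \<in> borel_measurable borel"
    and h: "\<And>x. 0 < h x" and u: "\<And>x. 0 \<le> u x" and p: "1 < p" and C: "0 < C"
    and int_h: "integrable lborel (\<lambda>x. h x powr p)" and int_hu: "integrable lborel (\<lambda>x. h x * u x)"
  shows "\<exists>\<phi>\<in>borel_measurable borel. (\<forall>x. 0 \<le> \<phi> x \<and> \<phi> x \<le> C * h x) \<and> (\<integral>x. \<phi> x powr p \<partial>lborel) \<le> 1 \<and>
    (\<forall>f\<in>borel_measurable borel. (\<forall>x. 0 \<le> f x \<and> f x \<le> C * h x) \<longrightarrow> (\<integral>x. f x powr p \<partial>lborel) \<le> 1 \<longrightarrow>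
      (\<integral>x. f x * u x \<partial>lborel) \<le> (\<integral>x. \<phi> x * u x \<partial>lborel))"
proof -
  define e where "e = 1 / (p - 1)"
  have e: "0 < e" "e * (p - 1) = 1" using p by (simp_all add: e_def)
  \<comment> \<open>The critical point of the concave function, where \<open>\<mu>\<close> times the
    power \<open>p - 1\<close> equals \<open>u x\<close>, cut off at the upper bound.\<close>
  define \<phi> where "\<phi> \<mu> x = min (C * h x) ((u x / \<mu>) powr e)" for \<mu> x
  have [measurable]: "\<phi> \<mu> \<in> borel_measurable borel" for \<mu> unfolding \<phi>_def[abs_def] by measurable
  have \<phi>: "0 \<le> \<phi> \<mu> x" "\<phi> \<mu> x \<le> C * h x" for \<mu> x using h[of x] C by (auto simp: \<phi>_def)
  have Chp: "integrable lborel (\<lambda>x. (C * h x) powr p)"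
    using int_h C h by (simp add: powr_mult less_imp_le)
  have Chu: "integrable lborel (\<lambda>x. C * h x * u x)" using int_hu by (simp add: mult.assoc)
  have int_p: "integrable lborel (\<lambda>x. f x powr p)"
    if [measurable]: "f \<in> borel_measurable borel" and "\<And>x. 0 \<le> f x" "\<And>x. f x \<le> C * h x" for f
    by (rule Bochner_Integration.integrable_bound[OF Chp]) (use that p in \<open>auto intro!: powr_mono2\<close>)
  have int_u: "integrable lborel (\<lambda>x. f x * u x)"
    if [measurable]: "f \<in> borel_measurable borel" and "\<And>x. 0 \<le> f x" "\<And>x. f x \<le> C * h x" for f
    by (rule Bochner_Integration.integrable_bound[OF Chu]) (use that u C h in \<open>auto intro!: mult_right_mono simp: abs_mult less_imp_le\<close>)
  have pw: "f * u x - \<mu> / p * f powr p \<le> \<phi> \<mu> x * u x - \<mu> / p * \<phi> \<mu> x powr p"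
    if f: "0 \<le> f" "f \<le> C * h x" and \<mu>: "0 < \<mu>" for f \<mu> x
  proof -
    define v where "v = \<phi> \<mu> x"
    have v: "0 \<le> v" by (simp add: v_def \<phi>)
    have vp: "v powr p = v * v powr (p - 1)"
      using v by (cases "v = 0") (simp_all add: powr_diff)
    define c where "c = \<mu> / p"
    have c: "0 < c" "\<mu> = c * p" using \<mu> p by (simp_all add: c_def)
    have "c * (p * (f * v powr (p - 1))) \<le> c * (f powr p + (p - 1) * v powr p)"
      using powr_tangent_le[OF f(1) v p] c by (intro mult_left_mono) auto
    then have 1: "\<mu> * f * v powr (p - 1) \<le> \<mu> / p * f powr p + \<mu> * v powr p - \<mu> / p * v powr p"
      unfolding c_def[symmetric] c(2) by (simp add: algebra_simps)
    \<comment> \<open>First-order condition: at an interior critical point the second factor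
      vanishes; at the cap it is nonnegative, while no admissible \<open>f\<close> exceeds
      \<open>v\<close>.\<close>
    have 2: "(f - v) * (u x - \<mu> * v powr (p - 1)) \<le> 0"
    proof (cases "C * h x < (u x / \<mu>) powr e")
      case True
      then have v': "v = C * h x" by (simp add: v_def \<phi>_def)
      have "v powr (p - 1) \<le> ((u x / \<mu>) powr e) powr (p - 1)"
        using True v' v p by (intro powr_mono2) auto
      also have "\<dots> = u x / \<mu>" using e(2) u[of x] \<mu> by (simp add: powr_powr)
      finally have "\<mu> * v powr (p - 1) \<le> u x" using \<mu> by (simp add: field_simps)
      then show ?thesis using f(2) v' by (intro mult_nonpos_nonneg) auto
    next
      case False
      then have "v = (u x / \<mu>) powr e" by (simp add: v_def \<phi>_def)
      then have "v powr (p - 1) = u x / \<mu>" using e(2) u[of x] \<mu> by (simp add: powr_powr)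
      then show ?thesis using \<mu> by simp
    qed
    have "(f - v) * (u x - \<mu> * v powr (p - 1)) = f * u x - v * u x - \<mu> * f * v powr (p - 1) + \<mu> * v powr p"
      unfolding vp by (simp add: algebra_simps)
    with 1 2 show ?thesis unfolding v_def[symmetric] by linarith
  qed
  define m where "m \<mu> = (\<integral>x. \<phi> \<mu> x powr p \<partial>lborel)" for \<mu>
  have dom: "norm (\<phi> \<mu> x powr p) \<le> (C * h x) powr p" for \<mu> x using \<phi>[of \<mu> x] p by (auto intro!: powr_mono2)
  have cont: "continuous_on {a..b} m" if "0 < a" for a b
    unfolding continuous_on_sequentially
  proof (intro ballI allI impI)
    fix \<mu> X assume \<mu>: "\<mu> \<in> {a..b}" and X: "(\<forall>n. X n \<in> {a..b}) \<and> X \<longlonglongrightarrow> \<mu>"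
    have "(\<lambda>n. \<phi> (X n) x powr p) \<longlonglongrightarrow> \<phi> \<mu> x powr p" for x
    proof -
      have "(\<lambda>n. u x / X n) \<longlonglongrightarrow> u x / \<mu>" using X \<mu> that by (intro tendsto_divide) auto
      moreover have "\<forall>\<^sub>F n in sequentially. 0 \<le> u x / X n"
      proof (intro always_eventually allI divide_nonneg_nonneg u)
        fix n
        have "a \<le> X n" using X by simp
        with that show "0 \<le> X n" by linarith
      qed
      ultimately have "(\<lambda>n. (u x / X n) powr e) \<longlonglongrightarrow> (u x / \<mu>) powr e"
        using e by (intro tendsto_powr') auto
      then have "(\<lambda>n. \<phi> (X n) x) \<longlonglongrightarrow> \<phi> \<mu> x" unfolding \<phi>_def by (intro tendsto_min tendsto_const)
      then show ?thesis using p \<phi> by (intro tendsto_powr') auto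
    qed
    then have "(\<lambda>n. m (X n)) \<longlonglongrightarrow> m \<mu>"
      unfolding m_def by (intro integral_dominated_convergence[OF _ _ Chp]) (use dom in auto)
    then show "(m \<circ> X) \<longlonglongrightarrow> m \<mu>" by (simp add: o_def)
  qed
  show ?thesis
  proof (cases "\<exists>\<mu>1>0. 1 \<le> m \<mu>1")
    case True
    then obtain \<mu>1 where \<mu>1: "0 < \<mu>1" "1 \<le> m \<mu>1" by blast
    have "(\<lambda>n. m (real (Suc n))) \<longlonglongrightarrow> (\<integral>x. 0 \<partial>(lborel :: 'a measure))"
      unfolding m_def
    proof (rule integral_dominated_convergence[OF _ _ Chp])
      show "AE x in lborel. (\<lambda>n. \<phi> (real (Suc n)) x powr p) \<longlonglongrightarrow> 0"
      proof (intro AE_I2)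
        fix x
        have "(\<lambda>n. u x / real (Suc n)) \<longlonglongrightarrow> 0"
          by (rule LIMSEQ_Suc[OF lim_const_over_n])
        then have "(\<lambda>n. (u x / real (Suc n)) powr e) \<longlonglongrightarrow> 0"
          using e u[of x] by (intro tendsto_eq_rhs[OF tendsto_powr'[of _ 0 _ "\<lambda>_. e" e]]) auto
        then have "(\<lambda>n. \<phi> (real (Suc n)) x) \<longlonglongrightarrow> 0"
        proof (rule Lim_null_comparison[rotated])
          have "\<phi> (real (Suc n)) x \<le> (u x / real (Suc n)) powr e" for n by (simp add: \<phi>_def)
          then show "\<forall>\<^sub>F n in sequentially. norm (\<phi> (real (Suc n)) x) \<le> (u x / real (Suc n)) powr e"
            using \<phi>(1) by (intro always_eventually allI) (simp only: real_norm_def abs_of_nonneg)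
        qed
        then show "(\<lambda>n. \<phi> (real (Suc n)) x powr p) \<longlonglongrightarrow> 0"
          using p \<phi> by (intro tendsto_eq_rhs[OF tendsto_powr'[of _ 0 _ "\<lambda>_. p" p]]) auto
      qed
    qed (use dom in auto)
    then have "(\<lambda>n. m (real (Suc n))) \<longlonglongrightarrow> 0" by simp
    then have "\<forall>\<^sub>F n in sequentially. m (real (Suc n)) < 1" by (rule order_tendstoD) simp
    moreover have "\<forall>\<^sub>F n in sequentially. \<mu>1 \<le> real (Suc n)"
      using eventually_ge_at_top[of "nat \<lceil>\<mu>1\<rceil>"] by eventually_elim linarith
    ultimately obtain n where n: "m (real (Suc n)) < 1" "\<mu>1 \<le> real (Suc n)"
      using eventually_conj eventually_happens'[OF sequentially_bot] by blast
    \<comment> \<open>The mass \<open>m\<close> is continuous, at least \<open>1\<close> at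
      \<open>\<mu>1\<close> and tends to \<open>0\<close> for large multipliers, so some multiplier
      gives exactly \<open>1\<close>.\<close>
    obtain \<mu> where \<mu>: "\<mu>1 \<le> \<mu>" "m \<mu> = 1"
      using IVT2'[of m "real (Suc n)" 1 \<mu>1] n \<mu>1 cont by (meson less_imp_le)
    have \<mu>0: "0 < \<mu>" using \<mu> \<mu>1 by simp
    show ?thesis
    proof (intro bexI[of _ "\<phi> \<mu>"] conjI allI ballI impI)
      show "(\<integral>x. \<phi> \<mu> x powr p \<partial>lborel) \<le> 1" using \<mu>(2) by (simp add: m_def)
      fix f :: "'a \<Rightarrow> real" assume [measurable]: "f \<in> borel_measurable borel"
        and f: "\<forall>x. 0 \<le> f x \<and> f x \<le> C * h x" and f1: "(\<integral>x. f x powr p \<partial>lborel) \<le> 1"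
      have "(\<integral>x. f x * u x - \<mu> / p * f x powr p \<partial>lborel) \<le> (\<integral>x. \<phi> \<mu> x * u x - \<mu> / p * \<phi> \<mu> x powr p \<partial>lborel)"
        using f pw[OF _ _ \<mu>0] \<phi> by (intro integral_mono Bochner_Integration.integrable_diff integrable_mult_right int_u int_p) auto
      then have "(\<integral>x. f x * u x \<partial>lborel) - \<mu> / p * (\<integral>x. f x powr p \<partial>lborel) \<le> (\<integral>x. \<phi> \<mu> x * u x \<partial>lborel) - \<mu> / p * m \<mu>"
        using f \<phi> by (simp add: int_u int_p m_def)
      moreover have "\<mu> / p * (\<integral>x. f x powr p \<partial>lborel) \<le> \<mu> / p * 1"
        using \<mu>0 p f1 by (intro mult_left_mono) auto
      ultimately show "(\<integral>x. f x * u x \<partial>lborel) \<le> (\<integral>x. \<phi> \<mu> x * u x \<partial>lborel)" using \<mu>(2) by simp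
    qed (use \<phi> in auto)
  next
    case False
    \<comment> \<open>Here the mass stays below \<open>1\<close> for every multiplier. The limit for
      multipliers tending to \<open>0\<close> fills the bound wherever \<open>u\<close> is positive;
      it inherits mass at most \<open>1\<close> and is optimal pointwise.\<close>
    define \<psi> where "\<psi> x = C * h x * indicator {x. 0 < u x} x" for x
    have [measurable]: "\<psi> \<in> borel_measurable borel" unfolding \<psi>_def[abs_def] by measurable
    have \<psi>: "0 \<le> \<psi> x" "\<psi> x \<le> C * h x" for x using h[of x] C by (auto simp: \<psi>_def indicator_def)
    have "(\<lambda>n. m (inverse (real (Suc n)))) \<longlonglongrightarrow> (\<integral>x. \<psi> x powr p \<partial>lborel)"
      unfolding m_def
    proof (rule integral_dominated_convergence[OF _ _ Chp])
      show "AE x in lborel. (\<lambda>n. \<phi> (inverse (real (Suc n))) x powr p) \<longlonglongrightarrow> \<psi> x powr p"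
      proof (intro AE_I2)
        fix x
        have "\<forall>\<^sub>F n in sequentially. \<phi> (inverse (real (Suc n))) x = \<psi> x"
        proof (cases "0 < u x")
          case True
          have "\<forall>\<^sub>F n in sequentially. (C * h x) powr (1 / e) / u x \<le> real (Suc n)"
            using eventually_ge_at_top[of "nat \<lceil>(C * h x) powr (1 / e) / u x\<rceil>"] by eventually_elim linarith
          then show ?thesis
          proof eventually_elim
            case (elim n)
            then have "(C * h x) powr (1 / e) \<le> u x / inverse (real (Suc n))" using True by (simp add: field_simps)
            then have "((C * h x) powr (1 / e)) powr e \<le> (u x / inverse (real (Suc n))) powr e"
              using e by (intro powr_mono2) auto
            moreover have "((C * h x) powr (1 / e)) powr e = C * h x" using e C h[of x] by (simp add: powr_powr)
            ultimately show ?case using True by (simp add: \<phi>_def \<psi>_def)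
          qed
        next
          case False
          then have "u x = 0" using u[of x] by simp
          then show ?thesis using C h[of x] e by (simp add: \<phi>_def \<psi>_def)
        qed
        then show "(\<lambda>n. \<phi> (inverse (real (Suc n))) x powr p) \<longlonglongrightarrow> \<psi> x powr p"
          by (intro tendsto_eventually) (auto elim: eventually_mono)
      qed
    qed (use dom in auto)
    moreover have "m (inverse (real (Suc n))) \<le> 1" for n using False by (auto simp: not_le less_imp_le)
    ultimately have \<psi>1: "(\<integral>x. \<psi> x powr p \<partial>lborel) \<le> 1" by (intro LIMSEQ_le_const2) auto
    show ?thesis
    proof (intro bexI[of _ \<psi>] conjI allI ballI impI)
      fix f :: "'a \<Rightarrow> real" assume [measurable]: "f \<in> borel_measurable borel"
        and f: "\<forall>x. 0 \<le> f x \<and> f x \<le> C * h x"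
      show "(\<integral>x. f x * u x \<partial>lborel) \<le> (\<integral>x. \<psi> x * u x \<partial>lborel)"
      proof (intro integral_mono int_u)
        show "f x * u x \<le> \<psi> x * u x" for x
          using f u[of x] by (cases "0 < u x") (auto simp: \<psi>_def)
      qed (use f \<psi> in auto)
    qed (use \<psi> \<psi>1 in auto)
  qed
qed

section \<open>Exact integrals of the optimizers\<close>

lemma nn_integral_optimizer:
  fixes a :: "real^'n"
  assumes b: "0 < b" and l: "l < real CARD('n)"
  shows "(\<integral>\<^sup>+x. ennreal (HLS_optimizer l a b x) \<partial>lborel) =
    ennreal (pi powr (real CARD('n) / 2) * Gamma ((real CARD('n) - l) / 2) / Gamma (real CARD('n) - l / 2) * b powr (l - real CARD('n)))"
proof -
  define s where "s = (2 * real CARD('n) - l) / 2"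
  have s: "real CARD('n) / 2 < s" using l by (simp add: s_def field_simps)
  have opt: "HLS_optimizer l a b x = (b\<^sup>2 + (norm (x - a))\<^sup>2) powr (- s)" for x
    by (simp add: HLS_optimizer_def s_def)
  have int: "(\<integral>\<^sup>+x. ennreal ((b\<^sup>2 + (norm (x - a))\<^sup>2) powr (- s)) \<partial>lborel) =
    ennreal (pi powr (real CARD('n) / 2) * Gamma (s - real CARD('n) / 2) / Gamma s * b powr (real CARD('n) - 2 * s))"
    using nn_integral_japanese_bracket[OF b, of s a] s by simp
  have eqs: "s - real CARD('n) / 2 = (real CARD('n) - l) / 2" "real CARD('n) - 2 * s = l - real CARD('n)"
    by (simp_all add: s_def field_simps)
  have eq: "s = real CARD('n) - l / 2" by (simp add: s_def field_simps)
  show ?thesis unfolding opt int eqs unfolding eq ..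
qed

lemma HLS_optimizer_powr:
  fixes a :: "real^'n"
  assumes b: "0 < b" and pq: "p * (2 * real CARD('n) - l) = 2 * real CARD('n)"
  shows "HLS_optimizer l a b x powr p = (b\<^sup>2 + (norm (x - a))\<^sup>2) powr (- real CARD('n))"
proof -
  have "- ((2 * real CARD('n) - l) / 2) * p = - real CARD('n)" using pq by (simp add: field_simps)
  then show ?thesis by (simp add: HLS_optimizer_def powr_powr)
qed

lemma nn_integral_optimizer_powr:
  fixes a :: "real^'n"
  assumes b: "0 < b" and pq: "p * (2 * real CARD('n) - l) = 2 * real CARD('n)"
  shows "(\<integral>\<^sup>+x. ennreal (HLS_optimizer l a b x powr p) \<partial>lborel) =
    ennreal (pi powr (real CARD('n) / 2) * Gamma (real CARD('n) / 2) / Gamma (real CARD('n)) * b powr (- real CARD('n)))"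
  unfolding HLS_optimizer_powr[OF b pq]
  by (subst nn_integral_japanese_bracket[OF b]) (simp_all add: field_simps)

text \<open>
  The inversion centered at \<open>x\<close> that preserves the optimizer cancels the kernel up to a constant factor.
\<close>

lemma riesz_potential_optimizer:
  fixes a x :: "real^'n"
  assumes b: "0 < b"
  shows "(\<integral>\<^sup>+y. ennreal (HLS_optimizer l a b y * norm (x - y) powr (- l)) \<partial>lborel) =
    (\<integral>\<^sup>+y. ennreal (HLS_optimizer l a b y) \<partial>lborel) * ennreal ((b\<^sup>2 + (norm (x - a))\<^sup>2) powr (- (l / 2)))"
proof -
  let ?h = "HLS_optimizer l a b"
  define r where "r = sqrt (b\<^sup>2 + (norm (x - a))\<^sup>2)"
  have r2: "r\<^sup>2 = b\<^sup>2 + (norm (x - a))\<^sup>2" by (simp add: r_def)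
  have r: "0 < r" using b by (simp add: r_def add_pos_nonneg)
  have hpos: "0 \<le> ?h y" for y using HLS_optimizer_pos[OF b, of l a y] by simp
  interpret conformal_reflection "inversion x r" "inversion_weight x r" "{y. y \<noteq> x \<and> norm (y - x) < r}"
    by (rule conformal_reflection_ball[OF r])
  let ?w = "inversion_weight x r"
  have "(\<integral>\<^sup>+y. ennreal (?h y * norm (x - y) powr (- l)) \<partial>lborel) =
     (\<integral>\<^sup>+y. ennreal (?h (inversion x r y) * norm (x - inversion x r y) powr (- l)) * ennreal (?w y ^ (2 * CARD('n))) \<partial>lborel)"
    by (rule nn_integral_s[symmetric]) measurable
  also have "\<dots> = (\<integral>\<^sup>+y. ennreal (?h y) * ennreal (r powr (- l)) \<partial>lborel)"
  proof (rule nn_integral_cong_AE, use AE_lborel_singleton[of x] in eventually_elim)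
    fix y :: "real^'n" assume y: "y \<noteq> x"
    define n where "n = norm (y - x)"
    have n: "0 < n" using y by (simp add: n_def)
    have "?w y powr (2 * real CARD('n) - l) * ?h (inversion x r y) = ?h y"
      using pullback_inversion_optimizer_eq[OF b y r2 r, of l] by (simp add: pullback_def)
    have "norm (x - inversion x r y) = r\<^sup>2 / n"
      using norm_inversion_diff[of x r y] by (simp add: norm_minus_commute n_def)
    have "(r\<^sup>2 / n) powr (- l) * ?w y powr l = r powr (- l)"
    proof -
      have "(r\<^sup>2 / n) powr (- l) = (r / n) powr (- l) * r powr (- l)"
        using n r by (simp add: power2_eq_square flip: powr_mult)
      moreover have "(r / n) powr (- l) * (r / n) powr l = 1" using n r by (simp flip: powr_add)
      ultimately show ?thesis using y by (simp add: inversion_weight_def n_def)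
    qed
    have "?h (inversion x r y) * norm (x - inversion x r y) powr (- l) * ?w y ^ (2 * CARD('n)) = ?h y * r powr (- l)"
    proof -
      have "h' * k * (wq * wl) = (wq * h') * (k * wl)" for h' k wq wl :: real by (simp only: mult_ac)
      from this[of "?h (inversion x r y)" "(r\<^sup>2 / n) powr (- l)" "?w y powr (2 * real CARD('n) - l)" "?w y powr l"]
      show ?thesis unfolding w_powr_split[of y l] \<open>norm (x - inversion x r y) = r\<^sup>2 / n\<close>
        \<open>?w y powr (2 * real CARD('n) - l) * ?h (inversion x r y) = ?h y\<close> \<open>(r\<^sup>2 / n) powr (- l) * ?w y powr l = r powr (- l)\<close> .
    qed
    then show "ennreal (?h (inversion x r y) * norm (x - inversion x r y) powr (- l)) * ennreal (?w y ^ (2 * CARD('n))) =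
        ennreal (?h y) * ennreal (r powr (- l))"
      using hpos by (simp flip: ennreal_mult')
  qed
  also have "\<dots> = (\<integral>\<^sup>+y. ennreal (?h y) \<partial>lborel) * ennreal (r powr (- l))"
    by (rule nn_integral_multc) measurable
  also have "r powr (- l) = (b\<^sup>2 + (norm (x - a))\<^sup>2) powr (- (l / 2))"
  proof -
    have "r\<^sup>2 = r powr 2" using r by (simp add: powr_numeral)
    then show ?thesis unfolding r2[symmetric] by (simp only: powr_powr) simp
  qed
  finally show ?thesis .
qed

lemma riesz_form_iterated:
  fixes f g :: "'a::euclidean_space \<Rightarrow> real"
  assumes [measurable]: "f \<in> borel_measurable borel" "g \<in> borel_measurable borel" and nn: "\<And>x. 0 \<le> f x"
  shows "riesz_form l f g = (\<integral>\<^sup>+x. ennreal (f x) * (\<integral>\<^sup>+y. ennreal (g y * norm (x - y) powr (- l)) \<partial>lborel) \<partial>lborel)"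
  unfolding riesz_form_def using nn by (simp add: mult.assoc ennreal_mult' nn_integral_cmult)

text \<open>The potential of the optimizer is its integral \<open>A\<close> times the power with
  exponent \<open>- (l / 2)\<close>. The exponents \<open>(2 * N - l) / 2\<close> and
  \<open>l / 2\<close> add up to \<open>N\<close>, so the form is \<open>A\<close> times the
  \<open>p\<close>-mass \<open>P\<close>. The sharp constant is the resulting quotient of
  \<open>A * P\<close> and \<open>P powr (2 / p)\<close>.\<close>

lemma riesz_form_optimizer:
  fixes a :: "real^'n"
  assumes b: "0 < b" and l: "0 < l" "l < real CARD('n)" and pq: "p * (2 * real CARD('n) - l) = 2 * real CARD('n)"
  obtains P where "0 < P" "(\<integral>\<^sup>+x. ennreal (HLS_optimizer l a b x powr p) \<partial>lborel) = ennreal P"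
    "riesz_form l (HLS_optimizer l a b) (HLS_optimizer l a b) = ennreal (HLS_const CARD('n) l * P powr (2 / p))"
proof -
  let ?h = "HLS_optimizer l a b"
  define N where "N = real CARD('n)"
  have N: "0 < N" by (simp add: N_def)
  have q: "0 < 2 * N - l" using l N unfolding N_def by linarith
  have peq: "p = 2 * N / (2 * N - l)" using pq q unfolding N_def[symmetric] by (simp add: eq_divide_eq)
  have p: "0 < p" "2 / p = 2 - l / N"
    unfolding peq using q N by (intro divide_pos_pos, simp_all add: field_simps)
  define A P where "A = pi powr (N / 2) * Gamma ((N - l) / 2) / Gamma (N - l / 2) * b powr (l - N)"
    and "P = pi powr (N / 2) * Gamma (N / 2) / Gamma N * b powr (- N)"
  have G: "0 < Gamma ((N - l) / 2)" "0 < Gamma (N - l / 2)" "0 < Gamma (N / 2)" "0 < Gamma N"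
    using l N by (auto simp: N_def intro!: Gamma_real_pos)
  have pos: "0 < A" "0 < P" using G b by (simp_all add: A_def P_def)
  have A: "(\<integral>\<^sup>+x. ennreal (?h x) \<partial>lborel) = ennreal A" unfolding A_def N_def by (rule nn_integral_optimizer[OF b l(2)])
  have P: "(\<integral>\<^sup>+x. ennreal (?h x powr p) \<partial>lborel) = ennreal P" unfolding P_def N_def by (rule nn_integral_optimizer_powr[OF b pq])
  have "riesz_form l ?h ?h = (\<integral>\<^sup>+x. ennreal A * ennreal (?h x powr p) \<partial>lborel)"
  proof (subst riesz_form_iterated, simp_all add: riesz_potential_optimizer[OF b] A less_imp_le[OF HLS_optimizer_pos[OF b]], intro nn_integral_cong)
    fix x
    have "?h x * (b\<^sup>2 + (norm (x - a))\<^sup>2) powr (- (l / 2)) = ?h x powr p"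
      unfolding HLS_optimizer_powr[OF b pq] by (simp add: HLS_optimizer_def field_simps flip: powr_add)
    then show "ennreal (?h x) * (ennreal A * ennreal ((b\<^sup>2 + (norm (x - a))\<^sup>2) powr (- (l / 2)))) = ennreal A * ennreal (?h x powr p)"
      using less_imp_le[OF HLS_optimizer_pos[OF b, of l a x]] by (simp add: mult.left_commute flip: ennreal_mult')
  qed
  also have "\<dots> = ennreal (A * P)" using pos P by (simp add: nn_integral_cmult ennreal_mult')
  also have "A * P = HLS_const CARD('n) l * P powr (2 / p)"
  proof -
    \<comment> \<open>This is \<open>2 / p - 1\<close>. In \<open>A / P powr \<theta>\<close> the
      powers of \<open>b\<close> cancel, which leaves the Gamma quotients of the constant.\<close>
    define \<theta> where "\<theta> = 1 - l / N"
    define R where "R = Gamma (N / 2) / Gamma N"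
    have R: "0 < R" using G by (simp add: R_def)
    have "P powr (2 / p) = P * P powr \<theta>" using pos by (simp add: p(2) \<theta>_def powr_mult_base)
    moreover have "P powr \<theta> = pi powr (N / 2 * \<theta>) * R powr \<theta> * b powr (- N * \<theta>)"
      unfolding P_def using R b by (simp add: R_def powr_mult powr_powr times_divide_eq_right[symmetric] del: times_divide_eq_right)
    moreover have "(Gamma N / Gamma (N / 2)) powr \<theta> * R powr \<theta> = 1"
      unfolding R_def using G by (simp flip: powr_mult)
    moreover have "pi powr (l / 2) * pi powr (N / 2 * \<theta>) = pi powr (N / 2)"
    proof -
      have "l / 2 + N / 2 * \<theta> = N / 2" using N by (simp add: \<theta>_def field_simps)
      then show ?thesis by (simp only: powr_add[symmetric])
    qed
    moreover have "- N * \<theta> = l - N" using N by (simp add: \<theta>_def field_simps)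
    ultimately have eqs: "P powr (2 / p) = P * (pi powr (N / 2 * \<theta>) * R powr \<theta> * b powr (l - N))"
      "(Gamma N / Gamma (N / 2)) powr \<theta> * R powr \<theta> = 1" "pi powr (l / 2) * pi powr (N / 2 * \<theta>) = pi powr (N / 2)" by simp_all
    have "HLS_const CARD('n) l * P powr (2 / p) = (pi powr (l / 2) * pi powr (N / 2 * \<theta>)) *
        (Gamma ((N - l) / 2) / Gamma (N - l / 2)) * ((Gamma N / Gamma (N / 2)) powr \<theta> * R powr \<theta>) * b powr (l - N) * P"
      unfolding HLS_const_def eqs(1) N_def[symmetric] \<theta>_def[symmetric] by (simp only: mult_ac)
    then show ?thesis unfolding eqs(2,3) by (simp add: A_def)
  qed
  finally show thesis using that pos P by blast
qed

section \<open>Existence of maximizers among dominated functions\<close>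

definition dominated_class :: "real \<Rightarrow> real \<Rightarrow> ('a::euclidean_space \<Rightarrow> real) \<Rightarrow> ('a \<Rightarrow> real) set" where
  "dominated_class p C h = {f \<in> borel_measurable borel.
     (\<forall>x. 0 \<le> f x \<and> f x \<le> C * h x) \<and> (\<integral>\<^sup>+x. ennreal (f x powr p) \<partial>lborel) \<le> 1}"

text \<open>Scheffe's lemma: the integrands converge for almost every \<open>y\<close>, and their
  total masses \<open>k (X n)\<close> converge to \<open>k x\<close>. The resulting convergence in
  mean gives equicontinuity of all potentials of functions dominated by \<open>h\<close>, without
  splitting off the singularity.\<close>

lemma riesz_kernel_continuity:
  fixes h :: "'a::euclidean_space \<Rightarrow> real"
  assumes [measurable]: "h \<in> borel_measurable borel" and h: "\<And>x. 0 \<le> h x" and k: "\<And>x. 0 \<le> k x"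
    and pot: "\<And>x. (\<integral>\<^sup>+y. ennreal (h y * norm (x - y) powr (- l)) \<partial>lborel) = ennreal (k x)"
    and cont: "isCont k x" and X: "X \<longlonglongrightarrow> x"
  shows "(\<lambda>n. \<integral>y. \<bar>h y * norm (X n - y) powr (- l) - h y * norm (x - y) powr (- l)\<bar> \<partial>lborel) \<longlonglongrightarrow> 0"
proof -
  let ?K = "\<lambda>x y. h y * norm (x - y) powr (- l)"
  have int: "integrable lborel (?K z)" for z
    by (rule integrableI_nonneg) (use pot[of z] h in auto)
  have nn: "(\<integral>\<^sup>+y. ennreal (norm (?K z y)) \<partial>lborel) = ennreal (k z)" for z
    using pot[of z] h by (simp add: abs_mult)
  have "(\<lambda>n. \<integral>\<^sup>+y. ennreal (norm (?K (X n) y - ?K x y)) \<partial>lborel) \<longlonglongrightarrow> 0"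
  proof (rule Scheffe_lemma1)
    show "AE y in lborel. (\<lambda>n. ?K (X n) y) \<longlonglongrightarrow> ?K x y"
      using AE_lborel_singleton[of x]
    proof eventually_elim
      fix y assume "y \<noteq> x"
      then show "(\<lambda>n. ?K (X n) y) \<longlonglongrightarrow> ?K x y" using X by (intro tendsto_intros) auto
    qed
    have "(\<lambda>n. ennreal (k (X n))) \<longlonglongrightarrow> ennreal (k x)"
      by (intro tendsto_ennrealI isCont_tendsto_compose[OF cont X])
    then show "limsup (\<lambda>n. \<integral>\<^sup>+y. ennreal (norm (?K (X n) y)) \<partial>lborel) \<le> (\<integral>\<^sup>+y. ennreal (norm (?K x y)) \<partial>lborel)"
      unfolding nn by (simp add: lim_imp_Limsup)
  qed (rule int)+
  moreover have "(\<integral>\<^sup>+y. ennreal (norm (?K (X n) y - ?K x y)) \<partial>lborel) = ennreal (\<integral>y. \<bar>?K (X n) y - ?K x y\<bar> \<partial>lborel)" for n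
    unfolding real_norm_def by (rule nn_integral_eq_integral) (auto intro!: integrable_abs Bochner_Integration.integrable_diff int)
  ultimately have "(\<lambda>n. ennreal (\<integral>y. \<bar>?K (X n) y - ?K x y\<bar> \<partial>lborel)) \<longlonglongrightarrow> ennreal 0" by simp
  then show ?thesis by (rule tendsto_ennrealD) auto
qed

text \<open>
  Along a maximizing sequence \<open>f\<^sub>n\<close> the potentials are equicontinuous, so a subsequence of them converges
  pointwise to some \<open>u\<close>. The bathtub maximizer \<open>\<phi>\<close> of \<open>f \<mapsto> \<integral> f u\<close> is then optimal,
  because positive definiteness bounds \<open>I(\<phi>, \<phi>)\<close> below by \<open>2 I(\<phi>, f\<^sub>n) - I(f\<^sub>n, f\<^sub>n)\<close>; no weak compactness is needed.
\<close>

lemma ex_maximizer: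
  assumes l: "0 < l" "l < real CARD('n)" and pq: "p * (2 * real CARD('n) - l) = 2 * real CARD('n)" and C: "0 < C"
  defines "h \<equiv> HLS_optimizer l (0 :: real^'n) 1"
  shows "\<exists>\<phi>\<in>dominated_class p C h. \<forall>f\<in>dominated_class p C h. riesz_form l f f \<le> riesz_form l \<phi> \<phi>"
proof -
  have q: "0 < 2 * real CARD('n) - l" using l by linarith
  have p: "1 < p"
  proof -
    have "p = 2 * real CARD('n) / (2 * real CARD('n) - l)" using pq q by (simp add: eq_divide_eq)
    then show ?thesis using q l by simp
  qed
  let ?\<K> = "dominated_class p C h"
  let ?K = "\<lambda>x y :: real^'n. norm (x - y) powr (- l)"
  define k where "k x = (1 + (norm x)\<^sup>2) powr (- (l / 2))" for x :: "real^'n"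
  have [measurable]: "h \<in> borel_measurable borel" unfolding h_def by measurable
  have [measurable]: "k \<in> borel_measurable borel" unfolding k_def[abs_def] by measurable
  have h: "0 < h x" for x unfolding h_def by (rule HLS_optimizer_pos) simp
  have k: "0 \<le> k x" for x by (simp add: k_def)
  define A where "A = enn2real (\<integral>\<^sup>+x. ennreal (h x) \<partial>lborel)"
  have "(\<integral>\<^sup>+x. ennreal (h x) \<partial>lborel) < \<infinity>"
    unfolding h_def by (subst nn_integral_optimizer) (use l in simp_all)
  then have A: "0 \<le> A" "(\<integral>\<^sup>+x. ennreal (h x) \<partial>lborel) = ennreal A" by (simp_all add: A_def)
  have pot: "(\<integral>\<^sup>+y. ennreal (h y * ?K x y) \<partial>lborel) = ennreal (A * k x)" for x
    using riesz_potential_optimizer[of 1 l 0 x] A unfolding h_def[symmetric] by (simp add: k_def ennreal_mult')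
  have hk: "h x * k x = h x powr p" for x
    using HLS_optimizer_powr[of 1 p l 0 x] pq by (simp add: h_def k_def HLS_optimizer_def field_simps flip: powr_add)
  have int_hp: "integrable lborel (\<lambda>x. h x powr p)"
  proof (rule integrableI_nonneg)
    show "(\<integral>\<^sup>+x. ennreal (h x powr p) \<partial>lborel) < \<infinity>"
      unfolding h_def by (subst nn_integral_optimizer_powr[OF _ pq]) simp_all
  qed auto
  have int_hK: "integrable lborel (\<lambda>y. h y * ?K x y)" for x
    by (rule integrableI_nonneg) (use pot[of x] h in \<open>auto simp: less_imp_le\<close>)
  have lint_hK: "(\<integral>y. h y * ?K x y \<partial>lborel) = A * k x" for x
    using pot[of x] A k h by (subst integral_eq_nn_integral) (auto simp: less_imp_le)
  have \<K>D: "f \<in> borel_measurable borel" "\<And>x. 0 \<le> f x" "\<And>x. f x \<le> C * h x" "(\<integral>\<^sup>+x. ennreal (f x powr p) \<partial>lborel) \<le> 1"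
    if "f \<in> ?\<K>" for f
    using that by (auto simp: dominated_class_def)
  define U where "U f x = (\<integral>y. f y * ?K x y \<partial>lborel)" for f and x :: "real^'n"
  have U_meas [measurable]: "U f \<in> borel_measurable borel" if [measurable]: "f \<in> borel_measurable borel" for f
    unfolding U_def[abs_def] by measurable
  have int_fK: "integrable lborel (\<lambda>y. f y * ?K x y)" if f: "f \<in> ?\<K>" for f x
  proof (rule Bochner_Integration.integrable_bound)
    show "integrable lborel (\<lambda>y. C * (h y * ?K x y))" using int_hK by simp
    show "AE y in lborel. norm (f y * ?K x y) \<le> norm (C * (h y * ?K x y))"
      using \<K>D[OF f] C h by (auto simp: abs_mult less_imp_le mult.assoc[symmetric] intro!: mult_right_mono)
  qed (use \<K>D(1)[OF f] in measurable)
  have U_nn: "0 \<le> U f x" if f: "f \<in> ?\<K>" for f x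
    unfolding U_def using \<K>D[OF f] by (intro integral_nonneg_AE) auto
  have U_le: "U f x \<le> C * A * k x" if f: "f \<in> ?\<K>" for f x
  proof -
    have "U f x \<le> (\<integral>y. C * (h y * ?K x y) \<partial>lborel)"
      unfolding U_def
    proof (intro integral_mono int_fK[OF f] integrable_mult_right int_hK)
      show "f y * ?K x y \<le> C * (h y * ?K x y)" for y
        using mult_right_mono[OF \<K>D(3)[OF f, of y], of "?K x y"] by (simp add: mult.assoc)
    qed
    then show ?thesis by (simp add: lint_hK)
  qed
  define J where "J f g = (\<integral>x. f x * U g x \<partial>lborel)" for f g
  have int_bound: "integrable lborel (\<lambda>x. C * h x * (C * A * k x))"
  proof -
    have eq: "(\<lambda>x. C * h x * (C * A * k x)) = (\<lambda>x. (C * C * A) * h x powr p)" by (simp add: fun_eq_iff hk[symmetric])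
    show ?thesis unfolding eq by (rule integrable_mult_right[OF int_hp])
  qed
  have prod_le: "\<bar>f x * v\<bar> \<le> C * h x * (C * A * k x)" if f: "f \<in> ?\<K>" and v: "0 \<le> v" "v \<le> C * A * k x" for f x v
  proof -
    have "0 \<le> C * h x" using C h[of x] by simp
    from mult_mono[OF \<K>D(3)[OF f, of x] v(2) this v(1)] show ?thesis
      using \<K>D(2)[OF f, of x] v(1) by simp
  qed
  have bound_nn: "0 \<le> C * h x * (C * A * k x)" for x using C h[of x] A k[of x] by simp
  have int_fu: "integrable lborel (\<lambda>x. f x * u x)"
    if f: "f \<in> ?\<K>" and [measurable]: "u \<in> borel_measurable borel" and u: "\<And>x. 0 \<le> u x" "\<And>x. u x \<le> C * A * k x" for f u
  proof (rule Bochner_Integration.integrable_bound[OF int_bound])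
    show "AE x in lborel. norm (f x * u x) \<le> norm (C * h x * (C * A * k x))"
      using prod_le[OF f u] bound_nn by (simp add: abs_of_nonneg)
  qed (use \<K>D(1)[OF f] in measurable)
  have I_eq: "riesz_form l f g = ennreal (J f g)" if f: "f \<in> ?\<K>" and g: "g \<in> ?\<K>" for f g
  proof -
    have "riesz_form l f g = (\<integral>\<^sup>+x. ennreal (f x) * (\<integral>\<^sup>+y. ennreal (g y * ?K x y) \<partial>lborel) \<partial>lborel)"
      using \<K>D[OF f] \<K>D[OF g] by (intro riesz_form_iterated)
    also have "\<dots> = (\<integral>\<^sup>+x. ennreal (f x * U g x) \<partial>lborel)"
    proof (intro nn_integral_cong)
      fix x
      have "(\<integral>\<^sup>+y. ennreal (g y * ?K x y) \<partial>lborel) = ennreal (U g x)"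
        unfolding U_def using \<K>D[OF g] by (intro nn_integral_eq_integral int_fK[OF g]) auto
      then show "ennreal (f x) * (\<integral>\<^sup>+y. ennreal (g y * ?K x y) \<partial>lborel) = ennreal (f x * U g x)"
        using \<K>D[OF f] by (simp add: ennreal_mult')
    qed
    also have "\<dots> = ennreal (J f g)"
      unfolding J_def using \<K>D[OF f] \<K>D[OF g] U_nn[OF g] U_le[OF g]
      by (intro nn_integral_eq_integral int_fu[OF f]) auto
    finally show ?thesis .
  qed
  have J_le: "J f g \<le> (\<integral>x. C * h x * (C * A * k x) \<partial>lborel)" if f: "f \<in> ?\<K>" and g: "g \<in> ?\<K>" for f g
    unfolding J_def
  proof (intro integral_mono int_fu[OF f] int_bound U_meas \<K>D(1)[OF g] U_nn[OF g] U_le[OF g])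
    show "f x * U g x \<le> C * h x * (C * A * k x)" for x
      using prod_le[OF f U_nn[OF g] U_le[OF g], of x] by linarith
  qed
  have J_nn: "0 \<le> J f g" if f: "f \<in> ?\<K>" and g: "g \<in> ?\<K>" for f g
    unfolding J_def using \<K>D[OF f] U_nn[OF g] by (intro integral_nonneg_AE) auto
  have "0 \<le> C * h x" for x using C h[of x] by simp
  then have zero: "(\<lambda>_. 0) \<in> ?\<K>" by (simp add: dominated_class_def)
  define S where "S = (SUP f\<in>?\<K>. J f f)"
  have bdd: "bdd_above ((\<lambda>f. J f f) ` ?\<K>)" using J_le by (intro bdd_aboveI2) auto
  have S_ge: "J f f \<le> S" if "f \<in> ?\<K>" for f unfolding S_def by (rule cSUP_upper[OF that bdd])
  have "\<exists>f\<in>?\<K>. S - 1 / real (Suc n) < J f f" for n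
  proof -
    have "S - 1 / real (Suc n) < S" by simp
    then show ?thesis unfolding S_def using less_cSUP_iff[OF _ bdd] zero by blast
  qed
  then obtain F0 where F0: "\<And>n. F0 n \<in> ?\<K>" "\<And>n. S - 1 / real (Suc n) < J (F0 n) (F0 n)" by metis
  have lim0: "(\<lambda>n. J (F0 n) (F0 n)) \<longlonglongrightarrow> S"
  proof (rule real_tendsto_sandwich)
    show "(\<lambda>n. S - 1 / real (Suc n)) \<longlonglongrightarrow> S"
      using tendsto_diff[OF tendsto_const LIMSEQ_Suc[OF lim_1_over_n], of S] by simp
    show "(\<lambda>n. S) \<longlonglongrightarrow> S" by simp
  qed (use F0 S_ge in \<open>auto intro!: always_eventually less_imp_le\<close>)
  obtain D :: "(real^'n) set" where D: "countable D" "\<And>X. open X \<Longrightarrow> X \<noteq> {} \<Longrightarrow> \<exists>d\<in>D. d \<in> X"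
    using countable_dense_setE by blast
  have k_le: "k x \<le> 1" for x
  proof -
    have "0 < 1 + (norm x)\<^sup>2" by (simp add: add_pos_nonneg)
    moreover have "(1 + (norm x)\<^sup>2) powr (- (l / 2)) \<le> (1 + (norm x)\<^sup>2) powr 0"
      using l by (intro powr_mono) auto
    ultimately show ?thesis unfolding k_def by simp
  qed
  have "norm (U (F0 n) x) \<le> C * A" for n x
  proof -
    have "C * A * k x \<le> C * A * 1" using C A k_le by (intro mult_left_mono) auto
    then show ?thesis using U_nn[OF F0(1), of n x] U_le[OF F0(1), of n x] by simp
  qed
  then obtain \<sigma> :: "nat \<Rightarrow> nat" where \<sigma>: "strict_mono \<sigma>" "\<And>x. x \<in> D \<Longrightarrow> \<exists>c. (\<lambda>n. U (F0 (\<sigma> n)) x) \<longlonglongrightarrow> c"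
    using function_convergent_subsequence[OF D(1), of "\<lambda>n. U (F0 n)" "C * A"] by metis
  define F where "F n = F0 (\<sigma> n)" for n
  have F: "F n \<in> ?\<K>" for n by (simp add: F_def F0)
  have limF: "(\<lambda>n. J (F n) (F n)) \<longlonglongrightarrow> S"
    unfolding F_def using LIMSEQ_subseq_LIMSEQ[OF lim0 \<sigma>(1)] by (simp add: o_def)
  \<comment> \<open>Up to the factor \<open>C\<close>, a modulus of continuity shared by the
    potentials of all members of the class.\<close>
  define E where "E x x' = (\<integral>y. \<bar>h y * ?K x y - h y * ?K x' y\<bar> \<partial>lborel)" for x x'
  have U_diff: "\<bar>U f x - U f x'\<bar> \<le> C * E x x'" if f: "f \<in> ?\<K>" for f x x'
  proof -
    have "U f x - U f x' = (\<integral>y. f y * ?K x y - f y * ?K x' y \<partial>lborel)"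
      unfolding U_def by (simp add: int_fK[OF f])
    also have "\<bar>\<dots>\<bar> \<le> (\<integral>y. \<bar>f y * ?K x y - f y * ?K x' y\<bar> \<partial>lborel)"
      using integral_norm_bound[of lborel "\<lambda>y. f y * ?K x y - f y * ?K x' y"] by simp
    also have "\<dots> \<le> (\<integral>y. C * \<bar>h y * ?K x y - h y * ?K x' y\<bar> \<partial>lborel)"
    proof (intro integral_mono)
      fix y
      have "\<bar>f y * ?K x y - f y * ?K x' y\<bar> = f y * \<bar>?K x y - ?K x' y\<bar>"
        using \<K>D(2)[OF f, of y] by (simp add: abs_mult flip: right_diff_distrib)
      also have "\<dots> \<le> C * h y * \<bar>?K x y - ?K x' y\<bar>"
        using \<K>D(3)[OF f] by (intro mult_right_mono) auto
      also have "\<dots> = C * \<bar>h y * ?K x y - h y * ?K x' y\<bar>"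
        using h[of y] by (simp add: abs_mult flip: right_diff_distrib)
      finally show "\<bar>f y * ?K x y - f y * ?K x' y\<bar> \<le> C * \<bar>h y * ?K x y - h y * ?K x' y\<bar>" .
    qed (auto intro!: integrable_abs Bochner_Integration.integrable_diff int_fK[OF f] int_hK integrable_mult_right)
    finally show ?thesis by (simp add: E_def)
  qed
  \<comment> \<open>The subsequence converges on the dense set \<open>D\<close>. The common modulus
    \<open>E\<close> transfers the Cauchy property from nearby points of \<open>D\<close> to every
    \<open>x\<close>.\<close>
  have "convergent (\<lambda>n. U (F n) x)" for x
  proof -
    have "\<exists>d\<in>D. dist d x < 1 / real (Suc m)" for m
      using D(2)[of "ball x (1 / real (Suc m))"] by (auto simp: dist_commute)
    then obtain d where d: "\<And>m. d m \<in> D" "\<And>m. dist (d m) x < 1 / real (Suc m)" by metis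
    have dlim: "d \<longlonglongrightarrow> x"
    proof (subst tendsto_dist_iff, rule Lim_null_comparison[OF always_eventually LIMSEQ_Suc[OF lim_1_over_n]])
      show "\<forall>m. norm (dist (d m) x) \<le> 1 / real (Suc m)" using d(2) by (simp add: less_imp_le)
    qed
    have Elim: "(\<lambda>m. E (d m) x) \<longlonglongrightarrow> 0"
      unfolding E_def
    proof (rule riesz_kernel_continuity[where k = "\<lambda>x. A * k x", OF _ _ _ pot _ dlim])
      show "isCont (\<lambda>x. A * k x) x"
        unfolding k_def by (intro continuous_intros) (auto simp: add_nonneg_eq_0_iff)
    qed (use h A k in \<open>auto simp: less_imp_le\<close>)
    have "Cauchy (\<lambda>n. U (F n) x)"
    proof (rule metric_CauchyI)
      fix \<epsilon> :: real assume \<epsilon>: "0 < \<epsilon>"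
      have "\<forall>\<^sub>F m in sequentially. E (d m) x < \<epsilon> / (3 * C)"
        using \<epsilon> C by (intro order_tendstoD[OF Elim]) simp
      then obtain m where m: "E (d m) x < \<epsilon> / (3 * C)" using eventually_happens'[OF sequentially_bot] by blast
      then have m: "C * E (d m) x < \<epsilon> / 3" using C by (simp add: field_simps)
      have "Cauchy (\<lambda>n. U (F n) (d m))" using \<sigma>(2)[OF d(1)[of m]] LIMSEQ_imp_Cauchy unfolding F_def by blast
      then obtain M where M: "\<And>i j. i \<ge> M \<Longrightarrow> j \<ge> M \<Longrightarrow> dist (U (F i) (d m)) (U (F j) (d m)) < \<epsilon> / 3"
        using \<epsilon> unfolding Cauchy_def by (metis divide_pos_pos zero_less_numeral)
      show "\<exists>M. \<forall>i\<ge>M. \<forall>j\<ge>M. dist (U (F i) x) (U (F j) x) < \<epsilon>"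
      proof (intro exI allI impI)
        fix i j assume "M \<le> i" "M \<le> j"
        from M[OF this] U_diff[OF F, of i "d m" x] U_diff[OF F, of j "d m" x] m
        show "dist (U (F i) x) (U (F j) x) < \<epsilon>" unfolding dist_real_def by linarith
      qed
    qed
    then show ?thesis by (simp add: Cauchy_convergent)
  qed
  then have "\<exists>c. (\<lambda>n. U (F n) x) \<longlonglongrightarrow> c" for x by (simp add: convergent_def)
  then obtain u where u: "\<And>x. (\<lambda>n. U (F n) x) \<longlonglongrightarrow> u x" by metis
  have [measurable]: "F n \<in> borel_measurable borel" for n using \<K>D(1)[OF F] .
  have u_meas [measurable]: "u \<in> borel_measurable borel"
    by (rule borel_measurable_LIMSEQ_real[OF u]) measurable
  have u_bd: "0 \<le> u x" "u x \<le> C * A * k x" for x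
    using U_nn[OF F] U_le[OF F] by (auto intro: LIMSEQ_le_const[OF u] LIMSEQ_le_const2[OF u])
  have int_hu: "integrable lborel (\<lambda>x. h x * u x)"
  proof (rule Bochner_Integration.integrable_bound)
    have eq: "(\<lambda>x. h x * (C * A * k x)) = (\<lambda>x. (C * A) * h x powr p)" by (simp add: fun_eq_iff hk[symmetric])
    show "integrable lborel (\<lambda>x. h x * (C * A * k x))" unfolding eq by (rule integrable_mult_right[OF int_hp])
    show "AE x in lborel. norm (h x * u x) \<le> norm (h x * (C * A * k x))"
    proof (intro AE_I2)
      fix x
      have "0 \<le> h x * u x" using h[of x] u_bd(1)[of x] by simp
      moreover have "h x * u x \<le> h x * (C * A * k x)"
        by (rule mult_left_mono[OF u_bd(2) less_imp_le[OF h]])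
      ultimately show "norm (h x * u x) \<le> norm (h x * (C * A * k x))" unfolding real_norm_def by linarith
    qed
  qed measurable
  have lint_\<K>: "(\<integral>x. f x powr p \<partial>lborel) \<le> 1" if f: "f \<in> ?\<K>" for f
  proof -
    have "(\<integral>x. f x powr p \<partial>lborel) = enn2real (\<integral>\<^sup>+x. ennreal (f x powr p) \<partial>lborel)"
      using \<K>D(1)[OF f] by (intro integral_eq_nn_integral) auto
    also have "\<dots> \<le> enn2real 1" using \<K>D(4)[OF f] by (intro enn2real_mono) auto
    finally show ?thesis by simp
  qed
  from ex_bathtub_maximizer[OF _ u_meas h u_bd(1) p C int_hp int_hu] obtain \<phi>
    where \<phi>: "\<phi> \<in> borel_measurable borel" "\<forall>x. 0 \<le> \<phi> x \<and> \<phi> x \<le> C * h x" "(\<integral>x. \<phi> x powr p \<partial>lborel) \<le> 1"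
      and max: "\<forall>f\<in>borel_measurable borel. (\<forall>x. 0 \<le> f x \<and> f x \<le> C * h x) \<longrightarrow> (\<integral>x. f x powr p \<partial>lborel) \<le> 1 \<longrightarrow>
         (\<integral>x. f x * u x \<partial>lborel) \<le> (\<integral>x. \<phi> x * u x \<partial>lborel)" by auto
  note \<phi>(1)[measurable]
  have \<phi>\<K>: "\<phi> \<in> ?\<K>"
  proof -
    have "integrable lborel (\<lambda>x. \<phi> x powr p)"
    proof (rule Bochner_Integration.integrable_bound)
      show "integrable lborel (\<lambda>x. (C * h x) powr p)" using int_hp C h by (simp add: powr_mult less_imp_le)
      show "AE x in lborel. norm (\<phi> x powr p) \<le> norm ((C * h x) powr p)"
        using \<phi>(2) p by (auto intro!: powr_mono2)
    qed measurable
    then have "(\<integral>\<^sup>+x. ennreal (\<phi> x powr p) \<partial>lborel) = ennreal (\<integral>x. \<phi> x powr p \<partial>lborel)"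
      by (rule nn_integral_eq_integral) simp
    then show ?thesis using \<phi> by (simp add: dominated_class_def ennreal_le_1)
  qed
  have lim1: "(\<lambda>n. J \<phi> (F n)) \<longlonglongrightarrow> (\<integral>x. \<phi> x * u x \<partial>lborel)"
    unfolding J_def
  proof (rule integral_dominated_convergence[OF _ _ int_bound])
    show "AE x in lborel. norm (\<phi> x * U (F n) x) \<le> C * h x * (C * A * k x)" for n
      using prod_le[OF \<phi>\<K> U_nn[OF F] U_le[OF F]] by simp
  qed (auto intro!: tendsto_mult u)
  \<comment> \<open>The functions \<open>F n\<close> need not converge. Replacing their potentials
    by \<open>u\<close> nevertheless costs at most the integral of
    \<open>C * h x * \<bar>U (F n) x - u x\<bar>\<close>, which tends to zero by domination.\<close>
  have lim2: "(\<lambda>n. J (F n) (F n) - (\<integral>x. F n x * u x \<partial>lborel)) \<longlonglongrightarrow> 0"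
  proof (rule Lim_null_comparison[OF always_eventually])
    have "(\<lambda>n. \<integral>x. C * h x * \<bar>U (F n) x - u x\<bar> \<partial>lborel) \<longlonglongrightarrow> (\<integral>x. 0 \<partial>(lborel :: (real^'n) measure))"
    proof (rule integral_dominated_convergence[OF _ _ int_bound])
      show "AE x in lborel. norm (C * h x * \<bar>U (F n) x - u x\<bar>) \<le> C * h x * (C * A * k x)" for n
      proof (intro AE_I2)
        fix x
        have "\<bar>U (F n) x - u x\<bar> \<le> C * A * k x"
          using U_nn[OF F, of n x] U_le[OF F, of n x] u_bd[of x] by linarith
        then show "norm (C * h x * \<bar>U (F n) x - u x\<bar>) \<le> C * h x * (C * A * k x)"
          using C h[of x] by (auto simp: abs_mult intro!: mult_left_mono)
      qed
      show "AE x in lborel. (\<lambda>n. C * h x * \<bar>U (F n) x - u x\<bar>) \<longlonglongrightarrow> 0"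
      proof (intro AE_I2)
        fix x
        have "(\<lambda>n. C * h x * \<bar>U (F n) x - u x\<bar>) \<longlonglongrightarrow> C * h x * \<bar>u x - u x\<bar>" by (intro tendsto_intros u)
        then show "(\<lambda>n. C * h x * \<bar>U (F n) x - u x\<bar>) \<longlonglongrightarrow> 0" by simp
      qed
    qed measurable
    then show "(\<lambda>n. \<integral>x. C * h x * \<bar>U (F n) x - u x\<bar> \<partial>lborel) \<longlonglongrightarrow> 0" by simp
    show "\<forall>n. norm (J (F n) (F n) - (\<integral>x. F n x * u x \<partial>lborel)) \<le> (\<integral>x. C * h x * \<bar>U (F n) x - u x\<bar> \<partial>lborel)"
    proof
      fix n
      have int: "integrable lborel (\<lambda>x. F n x * U (F n) x)" "integrable lborel (\<lambda>x. F n x * u x)"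
        using U_nn[OF F] U_le[OF F] u_bd by (auto intro!: int_fu[OF F])
      have "J (F n) (F n) - (\<integral>x. F n x * u x \<partial>lborel) = (\<integral>x. F n x * U (F n) x - F n x * u x \<partial>lborel)"
        unfolding J_def using int by simp
      also have "norm \<dots> \<le> (\<integral>x. norm (F n x * U (F n) x - F n x * u x) \<partial>lborel)" by (rule integral_norm_bound)
      also have "\<dots> \<le> (\<integral>x. C * h x * \<bar>U (F n) x - u x\<bar> \<partial>lborel)"
      proof (rule integral_mono)
        show "integrable lborel (\<lambda>x. C * h x * \<bar>U (F n) x - u x\<bar>)"
        proof (rule Bochner_Integration.integrable_bound[OF int_bound])
          show "AE x in lborel. norm (C * h x * \<bar>U (F n) x - u x\<bar>) \<le> norm (C * h x * (C * A * k x))"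
          proof (intro AE_I2)
            fix x
            have "\<bar>U (F n) x - u x\<bar> \<le> \<bar>C * A * k x\<bar>"
              using U_nn[OF F, of n x] U_le[OF F, of n x] u_bd[of x] by linarith
            then show "norm (C * h x * \<bar>U (F n) x - u x\<bar>) \<le> norm (C * h x * (C * A * k x))"
              using C h[of x] by (auto simp: abs_mult intro!: mult_left_mono)
          qed
        qed measurable
        show "norm (F n x * U (F n) x - F n x * u x) \<le> C * h x * \<bar>U (F n) x - u x\<bar>" for x
          using \<K>D(2,3)[OF F, of n x] by (auto simp: abs_mult right_diff_distrib[symmetric] intro!: mult_right_mono)
      qed (use int in auto)
      finally show "norm (J (F n) (F n) - (\<integral>x. F n x * u x \<partial>lborel)) \<le> (\<integral>x. C * h x * \<bar>U (F n) x - u x\<bar> \<partial>lborel)" .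
    qed
  qed
  have S_le: "S \<le> (\<integral>x. \<phi> x * u x \<partial>lborel)"
  proof (rule LIMSEQ_le_const2)
    show "(\<lambda>n. \<integral>x. F n x * u x \<partial>lborel) \<longlonglongrightarrow> S"
      using tendsto_diff[OF limF lim2] by simp
    show "\<exists>N. \<forall>n\<ge>N. (\<integral>x. F n x * u x \<partial>lborel) \<le> (\<integral>x. \<phi> x * u x \<partial>lborel)"
      using max \<K>D[OF F] lint_\<K>[OF F] by auto
  qed
  have "2 * J \<phi> (F n) - J (F n) (F n) \<le> J \<phi> \<phi>" for n
  proof -
    have "2 * riesz_form l \<phi> (F n) \<le> riesz_form l \<phi> \<phi> + riesz_form l (F n) (F n)"
      using \<K>D[OF F] \<K>D[OF \<phi>\<K>] l by (intro riesz_form_positive_definite) auto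
    then have "ennreal (2 * J \<phi> (F n)) \<le> ennreal (J \<phi> \<phi> + J (F n) (F n))"
      using J_nn[OF \<phi>\<K> \<phi>\<K>] J_nn[OF F F] J_nn[OF \<phi>\<K> F]
      by (simp add: I_eq[OF \<phi>\<K> F] I_eq[OF \<phi>\<K> \<phi>\<K>] I_eq[OF F F] ennreal_mult')
    then show ?thesis using J_nn[OF \<phi>\<K> \<phi>\<K>] J_nn[OF F F] by (subst (asm) ennreal_le_iff) auto
  qed
  then have "2 * (\<integral>x. \<phi> x * u x \<partial>lborel) - S \<le> J \<phi> \<phi>"
    by (intro LIMSEQ_le_const2[OF tendsto_diff[OF tendsto_mult[OF tendsto_const lim1] limF]]) auto
  then have "S \<le> J \<phi> \<phi>" using S_le by linarith
  then show ?thesis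
    using \<phi>\<K> S_ge by (intro bexI[of _ \<phi>]) (auto simp: I_eq intro!: ennreal_leI intro: order_trans)
qed

section \<open>The sharp inequality for nonnegative functions\<close>

lemma HLS_optimizer_antimono:
  fixes a x y :: "real^'n"
  assumes "0 < b" "l < 2 * real CARD('n)" "norm (x - a) \<le> norm (y - a)"
  shows "HLS_optimizer l a b y \<le> HLS_optimizer l a b x"
proof -
  have "(norm (x - a))\<^sup>2 \<le> (norm (y - a))\<^sup>2" using assms by (intro power_mono) auto
  moreover have "0 < b\<^sup>2 + (norm (x - a))\<^sup>2" using assms by (simp add: add_pos_nonneg)
  ultimately show ?thesis unfolding HLS_optimizer_def using assms by (simp, intro powr_mono2') auto
qed

text \<open>The hypothesis \<open>max\<close> covers exactly the polarizations that move mass to the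
  side favored by the standard optimizer. This suits a maximizer of the dominated class as well as a
  function attaining equality. For each mirror the favored side is found, and comparability is
  transferred to the other side if necessary.\<close>

lemma optimizer_if_polarization_maximal:
  fixes f :: "real^'n \<Rightarrow> real" and l :: real
  defines "q \<equiv> 2 * real CARD('n) - l"
  assumes f: "f \<in> borel_measurable borel" and nn: "\<And>x. 0 \<le> f x"
    and l: "0 < l" "l < real CARD('n)"
    and pq: "p * q = 2 * real CARD('n)" and p: "0 < p"
    and fin: "(\<integral>\<^sup>+x. ennreal (f x powr p) \<partial>lborel) < \<infinity>" and finI: "riesz_form l f f < \<infinity>"
    and nz: "\<not> (AE x in lborel. f x = 0)"
    and max: "\<And>s w B. conformal_reflection s w B \<Longrightarrow>
      (\<And>x. x \<in> B \<Longrightarrow> pullback q s w (HLS_optimizer l 0 1) x \<le> HLS_optimizer l 0 1 x) \<Longrightarrow>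
      riesz_form l (polarization q s w B f) (polarization q s w B f) \<le> riesz_form l f f"
  shows "\<exists>a b c. 0 < b \<and> 0 < c \<and> (AE x in lborel. f x = c * HLS_optimizer l a b x)"
proof -
  let ?h = "HLS_optimizer l (0 :: real^'n) 1"
  have l2: "l < 2 * real CARD('n)" using l by linarith
  have cmp: "(AE x in lborel. x \<in> B \<longrightarrow> pullback q s w f x \<le> f x) \<or> (AE x in lborel. x \<in> B \<longrightarrow> f x \<le> pullback q s w f x)"
    if cr: "conformal_reflection s w B" and h: "\<And>x. x \<in> B \<Longrightarrow> pullback q s w ?h x \<le> ?h x" for s w B
  proof -
    interpret conformal_reflection s w B by (rule cr)
    show ?thesis unfolding q_def
      by (rule polarization_eq_imp_comparable[OF f nn l(1) finI]) (use max[OF cr h] in \<open>simp add: q_def\<close>)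
  qed
  have coord: "(norm (coord_reflection i c x))\<^sup>2 = (norm x)\<^sup>2 + 4 * c * (c - x $ i)" for i c and x :: "real^'n"
    using norm_diff_coord_reflection[of 0 i c x] by (simp add: algebra_simps)
  show ?thesis
  proof (rule optimizer_if_comparable[where p = p, OF f nn _ p fin nz])
    show "p * (2 * real CARD('n) - l) = 2 * real CARD('n)" using pq by (simp add: q_def)
    fix i :: 'n and c :: real
    interpret half: conformal_reflection "coord_reflection i c" "\<lambda>_. 1" "{x. x $ i < c}"
      by (rule conformal_reflection_halfspaces)
    show "(AE x in lborel. x \<in> {x. x $ i < c} \<longrightarrow> pullback (2 * real CARD('n) - l) (coord_reflection i c) (\<lambda>_. 1) f x \<le> f x) \<or>
         (AE x in lborel. x \<in> {x. x $ i < c} \<longrightarrow> f x \<le> pullback (2 * real CARD('n) - l) (coord_reflection i c) (\<lambda>_. 1) f x)"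
    \<comment> \<open>The favored half-space is the one whose closure contains the origin, the
      center of the standard optimizer: its points are no farther from the origin than their mirror
      images.\<close>
    proof (cases "0 \<le> c")
      case True
      have "norm x \<le> norm (coord_reflection i c x)" if "x \<in> {x. x $ i < c}" for x
      proof (rule power2_le_imp_le)
        have "0 \<le> 4 * c * (c - x $ i)" using True that by (intro mult_nonneg_nonneg) auto
        then show "(norm x)\<^sup>2 \<le> (norm (coord_reflection i c x))\<^sup>2" unfolding coord by linarith
      qed simp
      then show ?thesis
        using cmp[OF half.conformal_reflection_axioms] HLS_optimizer_antimono[of 1 l _ "0 :: real^'n"] l2
        unfolding q_def[symmetric] by (simp add: pullback_def)
    next
      case False
      have "norm x \<le> norm (coord_reflection i c x)" if "x \<in> {x. c < x $ i}" for x
      proof (rule power2_le_imp_le)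
        have "0 \<le> (- c) * (x $ i - c)" using False that by (intro mult_nonneg_nonneg) auto
        then have "0 \<le> 4 * ((- c) * (x $ i - c))" by simp
        also have "\<dots> = 4 * c * (c - x $ i)" by (simp add: algebra_simps)
        finally show "(norm x)\<^sup>2 \<le> (norm (coord_reflection i c x))\<^sup>2" unfolding coord by linarith
      qed simp
      then have "(AE x in lborel. x \<in> {x. c < x $ i} \<longrightarrow> pullback q (coord_reflection i c) (\<lambda>_. 1) f x \<le> f x) \<or>
         (AE x in lborel. x \<in> {x. c < x $ i} \<longrightarrow> f x \<le> pullback q (coord_reflection i c) (\<lambda>_. 1) f x)"
        using HLS_optimizer_antimono[of 1 l _ "0 :: real^'n"] l2
        by (intro cmp conformal_reflection_halfspaces) (simp add: pullback_def)
      then show ?thesis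
        unfolding q_def by (rule half.comparable_other_side[rotated]) (simp add: coord_reflection_def)
    qed
  next
    fix a :: "real^'n" and r :: real assume r: "0 < r"
    interpret ball: conformal_reflection "inversion a r" "inversion_weight a r" "{x. x \<noteq> a \<and> norm (x - a) < r}"
      by (rule conformal_reflection_ball[OF r])
    \<comment> \<open>The sign compares \<open>r\<close> with the radius at which the inversion
      about \<open>a\<close> fixes the standard optimizer. For larger spheres the inside is favored,
      for smaller ones the outside.\<close>
    define \<kappa> where "\<kappa> = (1\<^sup>2 + (norm (a - 0))\<^sup>2) / r\<^sup>2 - 1"
    have le: "pullback q (inversion a r) (inversion_weight a r) ?h x \<le> ?h x"
      if "x \<noteq> a" "0 \<le> ((norm (x - a))\<^sup>2 - r\<^sup>2) * \<kappa>" for x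
      unfolding q_def using that r l2 by (intro pullback_inversion_optimizer_le) (auto simp: \<kappa>_def)
    show "(AE x in lborel. x \<in> {x. x \<noteq> a \<and> norm (x - a) < r} \<longrightarrow> pullback (2 * real CARD('n) - l) (inversion a r) (inversion_weight a r) f x \<le> f x) \<or>
         (AE x in lborel. x \<in> {x. x \<noteq> a \<and> norm (x - a) < r} \<longrightarrow> f x \<le> pullback (2 * real CARD('n) - l) (inversion a r) (inversion_weight a r) f x)"
    proof (cases "\<kappa> \<le> 0")
      case True
      show ?thesis
        unfolding q_def[symmetric]
      proof (rule cmp[OF ball.conformal_reflection_axioms], rule le)
        fix x assume x: "x \<in> {x. x \<noteq> a \<and> norm (x - a) < r}"
        then have "(norm (x - a))\<^sup>2 \<le> r\<^sup>2" by (intro power_mono) auto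
        then show "0 \<le> ((norm (x - a))\<^sup>2 - r\<^sup>2) * \<kappa>" using True by (intro mult_nonpos_nonpos) auto
      qed simp
    next
      case False
      have "(AE x in lborel. x \<in> {x. r < norm (x - a)} \<longrightarrow> pullback q (inversion a r) (inversion_weight a r) f x \<le> f x) \<or>
         (AE x in lborel. x \<in> {x. r < norm (x - a)} \<longrightarrow> f x \<le> pullback q (inversion a r) (inversion_weight a r) f x)"
      proof (rule cmp[OF conformal_reflection_ball_complement[OF r]], rule le)
        fix x assume x: "x \<in> {x. r < norm (x - a)}"
        then have "r\<^sup>2 \<le> (norm (x - a))\<^sup>2" using r by (intro power_mono) auto
        then show "0 \<le> ((norm (x - a))\<^sup>2 - r\<^sup>2) * \<kappa>" using False by (intro mult_nonneg_nonneg) auto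
        show "x \<noteq> a" using x r by auto
      qed
      then show ?thesis
        unfolding q_def by (rule ball.comparable_other_side[rotated]) (use r in \<open>simp add: norm_inversion_less_iff\<close>)
    qed
  qed
qed

section \<open>Elementary rules for the form\<close>

lemma riesz_form_cong_AE:
  assumes "AE x in lborel. f x = f' x" "AE x in lborel. g x = g' x"
  shows "riesz_form l f g = riesz_form l f' g'"
  unfolding riesz_form_def
proof (rule nn_integral_cong_AE, use assms(1) in eventually_elim)
  fix x assume "f x = f' x"
  then show "(\<integral>\<^sup>+y. ennreal (f x * g y * norm (x - y) powr (- l)) \<partial>lborel) = (\<integral>\<^sup>+y. ennreal (f' x * g' y * norm (x - y) powr (- l)) \<partial>lborel)"
    by (intro nn_integral_cong_AE eventually_mono[OF assms(2)]) simp
qed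

lemma riesz_form_scale:
  fixes f g :: "'a::euclidean_space \<Rightarrow> real"
  assumes [measurable]: "f \<in> borel_measurable borel" "g \<in> borel_measurable borel" and c: "0 \<le> c" "0 \<le> d"
  shows "riesz_form l (\<lambda>x. c * f x) (\<lambda>x. d * g x) = ennreal (c * d) * riesz_form l f g"
proof -
  have "ennreal (c * f x * (d * g y) * norm (x - y) powr (- l)) = ennreal (c * d) * ennreal (f x * g y * norm (x - y) powr (- l))" for x y :: 'a
    using c by (simp add: mult_ac flip: ennreal_mult')
  then show ?thesis unfolding riesz_form_def by (simp add: nn_integral_cmult)
qed

lemma riesz_form_commute:
  fixes f g :: "'a::euclidean_space \<Rightarrow> real"
  assumes [measurable]: "f \<in> borel_measurable borel" "g \<in> borel_measurable borel"
  shows "riesz_form l f g = riesz_form l g f"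
proof -
  have "riesz_form l f g = (\<integral>\<^sup>+y. \<integral>\<^sup>+x. ennreal (f x * g y * norm (x - y) powr (- l)) \<partial>lborel \<partial>lborel)"
    unfolding riesz_form_def by (rule lborel_pair.Fubini'[symmetric]) measurable
  then show ?thesis unfolding riesz_form_def by (simp add: norm_minus_commute mult.commute)
qed

lemma riesz_form_add:
  fixes f g :: "'a::euclidean_space \<Rightarrow> real"
  assumes [measurable]: "f \<in> borel_measurable borel" "g \<in> borel_measurable borel"
    and nn: "\<And>x. 0 \<le> f x" "\<And>x. 0 \<le> g x"
  shows "riesz_form l (\<lambda>x. f x + g x) (\<lambda>x. f x + g x) = riesz_form l f f + 2 * riesz_form l f g + riesz_form l g g"
proof -
  have "ennreal ((f x + g x) * (f y + g y) * norm (x - y) powr (- l)) =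
      ennreal (f x * f y * norm (x - y) powr (- l)) + ennreal (f x * g y * norm (x - y) powr (- l)) +
      (ennreal (g x * f y * norm (x - y) powr (- l)) + ennreal (g x * g y * norm (x - y) powr (- l)))" for x y
    using nn by (simp add: algebra_simps flip: ennreal_plus)
  then have "riesz_form l (\<lambda>x. f x + g x) (\<lambda>x. f x + g x) = riesz_form l f f + riesz_form l f g + (riesz_form l g f + riesz_form l g g)"
    unfolding riesz_form_def by (simp add: nn_integral_add)
  then show ?thesis
    unfolding riesz_form_commute[OF assms(2,1)] by (simp add: mult_2 ac_simps)
qed

text \<open>By the mean value theorem on the two halves of the interval, the increments are governed
  by the strictly increasing derivative, so the second increment is strictly larger.\<close>

lemma powr_midpoint_less:
  fixes a b p :: real
  assumes "0 \<le> a" "a < b" "1 < p"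
  shows "((a + b) / 2) powr p < (a powr p + b powr p) / 2"
proof -
  define m where "m = (a + b) / 2"
  have m: "a < m" "m < b" using assms by (simp_all add: m_def)
  have mv: "\<exists>\<xi>. x < \<xi> \<and> \<xi> < y \<and> y powr p - x powr p = (y - x) * (p * \<xi> powr (p - 1))" if "0 \<le> x" "x < y" for x y
  proof -
    have "continuous_on {x..y} (\<lambda>t. t powr p)" using that assms by (intro continuous_on_powr' continuous_intros) auto
    moreover have "((\<lambda>t. t powr p) has_derivative (\<lambda>h. h * (p * t powr (p - 1)))) (at t)" if "x < t" "t < y" for t
      using has_real_derivative_powr[of t p] that \<open>0 \<le> x\<close>
      by (simp add: has_field_derivative_def mult.commute[of _ "p * t powr (p - 1)"])
    ultimately show ?thesis using mvt[OF \<open>x < y\<close>, of "\<lambda>t. t powr p" "\<lambda>t h. h * (p * t powr (p - 1))"] by metis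
  qed
  obtain \<xi> where \<xi>: "a < \<xi>" "\<xi> < m" "m powr p - a powr p = (m - a) * (p * \<xi> powr (p - 1))" using mv[of a m] assms m by auto
  obtain \<eta> where \<eta>: "m < \<eta>" "\<eta> < b" "b powr p - m powr p = (b - m) * (p * \<eta> powr (p - 1))" using mv[of m b] assms m by auto
  have "\<xi> powr (p - 1) < \<eta> powr (p - 1)" using \<xi> \<eta> assms by (intro powr_less_mono2) auto
  then have "(m - a) * (p * \<xi> powr (p - 1)) < (m - a) * (p * \<eta> powr (p - 1))" using m assms by simp
  moreover have "m - a = b - m" by (simp add: m_def field_simps)
  ultimately have "m powr p - a powr p < b powr p - m powr p" by (metis \<xi>(3) \<eta>(3))
  then show ?thesis unfolding m_def[symmetric] by simp
qed

section \<open>The sharp inequality and its equality cases for nonnegative functions\<close>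

context
  fixes l p :: real
  assumes l: "0 < l" "l < real CARD('n::finite)"
    and pq: "p * (2 * real CARD('n) - l) = 2 * real CARD('n)"
begin

lemma p_gt_1: "1 < p"
proof -
  have q: "0 < 2 * real CARD('n) - l" using l by linarith
  then have "p = 2 * real CARD('n) / (2 * real CARD('n) - l)" using pq by (simp add: eq_divide_eq)
  then show ?thesis using q l by simp
qed

lemma HLS_const_pos: "0 < HLS_const CARD('n) l"
proof -
  have "0 < Gamma (real CARD('n))" "0 < Gamma (real CARD('n) / 2)" "0 < Gamma ((real CARD('n) - l) / 2)" "0 < Gamma (real CARD('n) - l / 2)"
    using l by (auto intro!: Gamma_real_pos)
  then have "0 < (Gamma (real CARD('n)) / Gamma (real CARD('n) / 2)) powr (1 - l / real CARD('n))"
    by (simp only: powr_gt_zero divide_pos_pos less_imp_neq[symmetric] not_False_eq_True)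
  moreover have "0 < Gamma ((real CARD('n) - l) / 2) / Gamma (real CARD('n) - l / 2)"
    using \<open>0 < Gamma ((real CARD('n) - l) / 2)\<close> \<open>0 < Gamma (real CARD('n) - l / 2)\<close> by (rule divide_pos_pos)
  ultimately show ?thesis unfolding HLS_const_def by (intro mult_pos_pos) simp_all
qed

lemma riesz_form_scaled_optimizer:
  fixes a :: "real^'n" and f :: "real^'n \<Rightarrow> real"
  assumes b: "0 < b" and c: "0 \<le> c" and f: "AE x in lborel. f x = c * HLS_optimizer l a b x"
    and P: "(\<integral>\<^sup>+x. ennreal (f x powr p) \<partial>lborel) = ennreal P" "0 \<le> P"
  shows "riesz_form l f f = ennreal (HLS_const CARD('n) l * P powr (2 / p))"
proof -
  let ?h = "HLS_optimizer l a b"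
  obtain Q where Q: "0 < Q" "(\<integral>\<^sup>+x. ennreal (?h x powr p) \<partial>lborel) = ennreal Q"
    "riesz_form l ?h ?h = ennreal (HLS_const CARD('n) l * Q powr (2 / p))"
    using riesz_form_optimizer[OF b l pq] by blast
  have hnn: "0 \<le> ?h x" for x using HLS_optimizer_pos[OF b, of l a x] by simp
  have "ennreal P = (\<integral>\<^sup>+x. ennreal (c powr p) * ennreal (?h x powr p) \<partial>lborel)"
    unfolding P(1)[symmetric]
    by (intro nn_integral_cong_AE eventually_mono[OF f]) (use c hnn in \<open>simp add: powr_mult ennreal_mult'\<close>)
  also have "\<dots> = ennreal (c powr p * Q)" by (simp add: nn_integral_cmult Q ennreal_mult')
  finally have "P = c powr p * Q" using P(2) Q(1) by simp
  then have "P powr (2 / p) = c * c * Q powr (2 / p)"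
    using c Q(1) p_gt_1 by (simp add: powr_mult powr_powr powr_numeral power2_eq_square)
  moreover have "riesz_form l f f = ennreal (c * c) * riesz_form l ?h ?h"
    unfolding riesz_form_cong_AE[OF f f] by (rule riesz_form_scale) (use c in auto)
  ultimately show ?thesis unfolding Q(3) using c by (simp add: mult_ac flip: ennreal_mult')
qed

text \<open>A maximizer of the class exists, and polarizing it toward the favored side does not
  leave the class; hence it vanishes or is a multiple of an optimizer, for which the form is known.
  Its \<open>p\<close>-mass \<open>P\<close> might be below \<open>1\<close>, which only lowers the
  value.\<close>

lemma riesz_form_dominated_le:
  fixes f :: "real^'n \<Rightarrow> real"
  assumes C: "0 < C" and f: "f \<in> dominated_class p C (HLS_optimizer l 0 1)"
  shows "riesz_form l f f \<le> ennreal (HLS_const CARD('n) l)"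
proof -
  let ?h = "HLS_optimizer l (0 :: real^'n) 1"
  obtain \<phi> where \<phi>: "\<phi> \<in> dominated_class p C ?h" "\<And>f. f \<in> dominated_class p C ?h \<Longrightarrow> riesz_form l f f \<le> riesz_form l \<phi> \<phi>"
    using ex_maximizer[OF l pq C] by blast
  have \<phi>D: "\<phi> \<in> borel_measurable borel" "\<And>x. 0 \<le> \<phi> x" "\<And>x. \<phi> x \<le> C * ?h x" "(\<integral>\<^sup>+x. ennreal (\<phi> x powr p) \<partial>lborel) \<le> 1"
    using \<phi>(1) by (auto simp: dominated_class_def)
  have fin: "(\<integral>\<^sup>+x. ennreal (\<phi> x powr p) \<partial>lborel) < \<infinity>" using \<phi>D(4) by (rule le_less_trans) simp
  have finI: "riesz_form l \<phi> \<phi> < \<infinity>"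
  proof -
    have "riesz_form l \<phi> \<phi> \<le> riesz_form l (\<lambda>x. C * ?h x) (\<lambda>x. C * ?h x)"
      unfolding riesz_form_def
    proof (intro nn_integral_mono ennreal_leI mult_right_mono mult_mono \<phi>D(2,3))
      show "0 \<le> C * ?h x" for x using C HLS_optimizer_pos[of 1 l "0 :: real^'n" x] by simp
    qed simp
    also have "\<dots> = ennreal (C * C) * riesz_form l ?h ?h" using C by (intro riesz_form_scale) auto
    also have "\<dots> < \<infinity>"
    proof -
      obtain Q where "riesz_form l ?h ?h = ennreal Q"
        using riesz_form_optimizer[OF zero_less_one l pq, of "0 :: real^'n"] by blast
      then show ?thesis by (simp add: ennreal_mult_less_top)
    qed
    finally show ?thesis .
  qed
  have "riesz_form l \<phi> \<phi> \<le> ennreal (HLS_const CARD('n) l)"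
  proof (cases "AE x in lborel. \<phi> x = 0")
    case True
    from riesz_form_cong_AE[OF True True, of l] show ?thesis by (simp add: riesz_form_def)
  next
    case False
    have "\<exists>a b c. 0 < b \<and> 0 < c \<and> (AE x in lborel. \<phi> x = c * HLS_optimizer l a b x)"
    proof (rule optimizer_if_polarization_maximal[OF \<phi>D(1,2) l pq _ fin finI False])
      show "0 < p" using p_gt_1 by simp
      fix s :: "real^'n \<Rightarrow> real^'n" and w B
      assume cr: "conformal_reflection s w B"
        and h: "\<And>x. x \<in> B \<Longrightarrow> pullback (2 * real CARD('n) - l) s w ?h x \<le> ?h x"
      interpret conformal_reflection s w B by (rule cr)
      let ?P = "polarization (2 * real CARD('n) - l) s w B \<phi>"
      have "?P \<in> dominated_class p C ?h"
        unfolding dominated_class_def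
      proof (intro CollectI conjI allI)
        show "?P \<in> borel_measurable borel" using \<phi>D(1) by (rule polarization_measurable)
        show "0 \<le> ?P x" for x using \<phi>D(2) by (rule polarization_nonneg)
        show "(\<integral>\<^sup>+x. ennreal (?P x powr p) \<partial>lborel) \<le> 1"
          using \<phi>D(4) p_gt_1 by (subst nn_integral_polarization[OF \<phi>D(1,2) pq]) auto
        \<comment> \<open>Off \<open>B\<close> polarization does not raise the value. On
          \<open>B\<close> the maximum may be the pullback of \<open>\<phi>\<close>, which is at
          most \<open>C\<close> times the pullback of \<open>?h\<close>, and this is at most
          \<open>C * ?h x\<close> by the choice of side.\<close>
        show "?P x \<le> C * ?h x" for x
        proof (cases "x \<in> B")
          case True
          have "pullback (2 * real CARD('n) - l) s w \<phi> x \<le> C * pullback (2 * real CARD('n) - l) s w ?h x"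
            unfolding pullback_def using \<phi>D(3)[of "s x"] by (simp add: mult.left_commute[of C] mult_left_mono)
          also have "\<dots> \<le> C * ?h x" using h[OF True] C by simp
          finally show ?thesis using \<phi>D(3)[of x] True by (simp add: polarization_def)
        next
          case False
          then show ?thesis using \<phi>D(3)[of x] by (simp add: polarization_def min_le_iff_disj)
        qed
      qed
      then show "riesz_form l ?P ?P \<le> riesz_form l \<phi> \<phi>" by (rule \<phi>(2))
    qed
    then obtain a b c where abc: "0 < b" "0 < c" "AE x in lborel. \<phi> x = c * HLS_optimizer l a b x" by blast
    obtain P where P: "0 \<le> P" "(\<integral>\<^sup>+x. ennreal (\<phi> x powr p) \<partial>lborel) = ennreal P"
      using fin by (cases "\<integral>\<^sup>+x. ennreal (\<phi> x powr p) \<partial>lborel") auto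
    have "riesz_form l \<phi> \<phi> = ennreal (HLS_const CARD('n) l * P powr (2 / p))"
      by (rule riesz_form_scaled_optimizer[OF abc(1) _ abc(3) P(2,1)]) (use abc in simp)
    also have "\<dots> \<le> ennreal (HLS_const CARD('n) l)"
    proof (intro ennreal_leI)
      have "P \<le> 1" using \<phi>D(4) unfolding P(2) by simp
      then have "P powr (2 / p) \<le> 1" using P(1) p_gt_1 by (intro powr_le1) auto
      then show "HLS_const CARD('n) l * P powr (2 / p) \<le> HLS_const CARD('n) l"
        using HLS_const_pos by simp
    qed
    finally show ?thesis .
  qed
  with \<phi>(2)[OF f] show ?thesis by (rule order_trans)
qed

text \<open>Truncation by growing multiples of the optimizer puts \<open>f\<close> into the
  dominated classes. The bound does not depend on the multiple and survives the limit by Fatou's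
  lemma in each variable.\<close>

lemma riesz_form_unit_le:
  fixes f :: "real^'n \<Rightarrow> real"
  assumes [measurable]: "f \<in> borel_measurable borel" and nn: "\<And>x. 0 \<le> f x"
    and f1: "(\<integral>\<^sup>+x. ennreal (f x powr p) \<partial>lborel) \<le> 1"
  shows "riesz_form l f f \<le> ennreal (HLS_const CARD('n) l)"
proof -
  let ?h = "HLS_optimizer l (0 :: real^'n) 1"
  let ?f = "\<lambda>n x. min (f x) (real (Suc n) * ?h x)"
  let ?k = "\<lambda>n x y. ennreal (?f n x * ?f n y * norm (x - y) powr (- l))"
  have hpos: "0 < ?h x" for x by (rule HLS_optimizer_pos) simp
  have "?f n \<in> dominated_class p (real (Suc n)) ?h" for n
    unfolding dominated_class_def
  proof (intro CollectI conjI allI)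
    show "?f n \<in> borel_measurable borel" by measurable
    show "0 \<le> ?f n x" for x using nn[of x] hpos[of x] by (simp add: less_imp_le)
    then have "?f n x powr p \<le> f x powr p" for x using p_gt_1 by (intro powr_mono2) auto
    then have "(\<integral>\<^sup>+x. ennreal (?f n x powr p) \<partial>lborel) \<le> (\<integral>\<^sup>+x. ennreal (f x powr p) \<partial>lborel)"
      by (intro nn_integral_mono ennreal_leI)
    with f1 show "(\<integral>\<^sup>+x. ennreal (?f n x powr p) \<partial>lborel) \<le> 1" by (rule order_trans[rotated])
  qed simp
  then have le: "riesz_form l (?f n) (?f n) \<le> ennreal (HLS_const CARD('n) l)" for n
    by (rule riesz_form_dominated_le[rotated]) simp
  have lim: "(\<lambda>n. ?f n x) \<longlonglongrightarrow> f x" for x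
  proof (rule tendsto_eventually)
    show "\<forall>\<^sub>F n in sequentially. ?f n x = f x"
      using eventually_ge_at_top[of "nat \<lceil>f x / ?h x\<rceil>"]
    proof eventually_elim
      case (elim n)
      then have "f x / ?h x \<le> real (Suc n)" by linarith
      then show ?case using hpos[of x] by (simp add: field_simps min_def)
    qed
  qed
  have "riesz_form l f f = (\<integral>\<^sup>+x. \<integral>\<^sup>+y. liminf (\<lambda>n. ?k n x y) \<partial>lborel \<partial>lborel)"
    unfolding riesz_form_def
    by (intro nn_integral_cong lim_imp_Liminf[symmetric] tendsto_ennrealI tendsto_mult lim tendsto_const) simp
  also have "\<dots> \<le> (\<integral>\<^sup>+x. liminf (\<lambda>n. \<integral>\<^sup>+y. ?k n x y \<partial>lborel) \<partial>lborel)"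
    by (intro nn_integral_mono nn_integral_liminf) measurable
  also have "\<dots> \<le> liminf (\<lambda>n. \<integral>\<^sup>+x. \<integral>\<^sup>+y. ?k n x y \<partial>lborel \<partial>lborel)"
    by (intro nn_integral_liminf) measurable
  also have "\<dots> \<le> ennreal (HLS_const CARD('n) l)"
    using le unfolding riesz_form_def by (intro Liminf_le always_eventually) auto
  finally show ?thesis .
qed

lemma nn_integral_normalized:
  fixes f :: "real^'n \<Rightarrow> real"
  assumes [measurable]: "f \<in> borel_measurable borel" and nn: "\<And>x. 0 \<le> f x"
    and P: "(\<integral>\<^sup>+x. ennreal (f x powr p) \<partial>lborel) = ennreal P" "0 < P"
  shows "(\<integral>\<^sup>+x. ennreal ((inverse (P powr (1 / p)) * f x) powr p) \<partial>lborel) = 1"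
proof -
  have p: "1 < p" by (rule p_gt_1)
  define c where "c = P powr (1 / p)"
  have c: "0 < c" "c powr p = P" using P p by (simp_all add: c_def powr_powr)
  have "(\<integral>\<^sup>+x. ennreal ((inverse c * f x) powr p) \<partial>lborel) = ennreal (inverse P) * (\<integral>\<^sup>+x. ennreal (f x powr p) \<partial>lborel)"
    using c nn P
    by (subst nn_integral_cmult[symmetric]) (simp_all add: powr_mult inverse_powr c(2) ennreal_mult'[of "inverse P"] flip: inverse_eq_divide)
  also have "\<dots> = 1" using P by (simp flip: ennreal_mult')
  finally show ?thesis unfolding c_def .
qed

lemma riesz_form_le:
  fixes f :: "real^'n \<Rightarrow> real"
  assumes [measurable]: "f \<in> borel_measurable borel" and nn: "\<And>x. 0 \<le> f x"
    and P: "(\<integral>\<^sup>+x. ennreal (f x powr p) \<partial>lborel) = ennreal P" "0 \<le> P"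
  shows "riesz_form l f f \<le> ennreal (HLS_const CARD('n) l * P powr (2 / p))"
proof (cases "P = 0")
  case True
  have 0: "AE x in lborel. f x = 0"
    by (rule AE_zero_if_norm_zero[OF assms(1) nn]) (use P True in simp)
  from riesz_form_cong_AE[OF 0 0, of l] show ?thesis by (simp add: riesz_form_def)
next
  case False
  with P have P0: "0 < P" by simp
  define c where "c = P powr (1 / p)"
  have c: "0 < c" "c * c = P powr (2 / p)"
    using P0 p_gt_1 by (simp_all add: c_def flip: powr_add)
  let ?g = "\<lambda>x. inverse c * f x"
  have "(\<integral>\<^sup>+x. ennreal (?g x powr p) \<partial>lborel) = 1"
    unfolding c_def by (rule nn_integral_normalized[OF assms(1) nn P(1) P0])
  then have "riesz_form l ?g ?g \<le> ennreal (HLS_const CARD('n) l)"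
    using c nn by (intro riesz_form_unit_le) auto
  then have "ennreal (c * c) * riesz_form l ?g ?g \<le> ennreal (c * c) * ennreal (HLS_const CARD('n) l)" by (rule mult_left_mono) simp
  moreover have "ennreal (c * c) * riesz_form l ?g ?g = riesz_form l f f"
    using c by (subst riesz_form_scale[symmetric]) (auto simp flip: mult.assoc)
  ultimately show ?thesis using c HLS_const_pos by (simp add: mult.commute flip: ennreal_mult')
qed

text \<open>A polarization keeps the \<open>p\<close>-mass \<open>P\<close>, so the inequality
  bounds its form by the value that \<open>f\<close> already attains. Every polarization is thus
  harmless, and the rigidity argument applies to \<open>f\<close> itself.\<close>

lemma riesz_form_eq_imp_optimizer:
  fixes f :: "real^'n \<Rightarrow> real"
  assumes f: "f \<in> borel_measurable borel" and nn: "\<And>x. 0 \<le> f x"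
    and P: "(\<integral>\<^sup>+x. ennreal (f x powr p) \<partial>lborel) = ennreal P" "0 < P"
    and eq: "riesz_form l f f = ennreal (HLS_const CARD('n) l * P powr (2 / p))"
  shows "\<exists>a b c. 0 < b \<and> 0 < c \<and> (AE x in lborel. f x = c * HLS_optimizer l a b x)"
proof (rule optimizer_if_polarization_maximal[OF f nn l pq])
  show "0 < p" using p_gt_1 by simp
  show "\<not> (AE x in lborel. f x = 0)"
  proof
    assume "AE x in lborel. f x = 0"
    then have "(\<integral>\<^sup>+x. ennreal (f x powr p) \<partial>lborel) = (\<integral>\<^sup>+x. 0 \<partial>(lborel :: (real^'n) measure))"
      by (intro nn_integral_cong_AE) (auto elim: eventually_mono)
    then show False using P by simp
  qed
  fix s :: "real^'n \<Rightarrow> real^'n" and w B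
  assume cr: "conformal_reflection s w B"
  interpret conformal_reflection s w B by (rule cr)
  show "riesz_form l (polarization (2 * real CARD('n) - l) s w B f) (polarization (2 * real CARD('n) - l) s w B f) \<le> riesz_form l f f"
    unfolding eq
  proof (rule riesz_form_le[OF polarization_measurable[OF f] polarization_nonneg[OF nn]])
    show "(\<integral>\<^sup>+x. ennreal (polarization (2 * real CARD('n) - l) s w B f x powr p) \<partial>lborel) = ennreal P"
      using P p_gt_1 by (subst nn_integral_polarization[OF f nn pq]) auto
  qed (use P in simp)
qed (use P eq in auto)

text \<open>Positive definiteness bounds the mixed form by the mean of the two diagonal ones, each
  at most the constant \<open>H\<close>. If the mixed form equals \<open>H\<close>, so do the
  diagonal ones, and then the form of the midpoint of \<open>f\<close> and \<open>g\<close> equals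
  \<open>H\<close> too. Strict convexity would make the norm of the midpoint less than
  \<open>1\<close>, were \<open>f\<close> and \<open>g\<close> different.\<close>

lemma riesz_form_unit_pair:
  fixes f g :: "real^'n \<Rightarrow> real"
  assumes [measurable]: "f \<in> borel_measurable borel" "g \<in> borel_measurable borel"
    and nn: "\<And>x. 0 \<le> f x" "\<And>x. 0 \<le> g x"
    and 1: "(\<integral>\<^sup>+x. ennreal (f x powr p) \<partial>lborel) = 1" "(\<integral>\<^sup>+x. ennreal (g x powr p) \<partial>lborel) = 1"
  shows "riesz_form l f g \<le> ennreal (HLS_const CARD('n) l)"
    and "riesz_form l f g = ennreal (HLS_const CARD('n) l) \<Longrightarrow>
      (AE x in lborel. f x = g x) \<and> riesz_form l f f = ennreal (HLS_const CARD('n) l)"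
proof -
  let ?H = "HLS_const CARD('n) l"
  have H: "0 < ?H" by (rule HLS_const_pos)
  have p: "1 < p" by (rule p_gt_1)
  have "riesz_form l f f \<le> ennreal ?H" "riesz_form l g g \<le> ennreal ?H"
    using riesz_form_unit_le[of f] riesz_form_unit_le[of g] nn 1 by simp_all
  then obtain a b where a: "riesz_form l f f = ennreal a" "0 \<le> a" "a \<le> ?H" and b: "riesz_form l g g = ennreal b" "0 \<le> b" "b \<le> ?H"
    using H by (cases "riesz_form l f f"; cases "riesz_form l g g") (auto simp: top_unique)
  have pd: "2 * riesz_form l f g \<le> ennreal (a + b)"
    using riesz_form_positive_definite[OF assms(1,2) nn l(1)] a b by simp
  then have "2 * riesz_form l f g < \<infinity>" by (rule le_less_trans) simp
  moreover have "1 * riesz_form l f g \<le> 2 * riesz_form l f g" by (rule mult_right_mono) simp_all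
  ultimately have "riesz_form l f g < \<infinity>" by (simp only: mult_1 le_less_trans)
  then obtain c where c: "riesz_form l f g = ennreal c" "0 \<le> c" by (cases "riesz_form l f g") auto
  have "ennreal (2 * c) \<le> ennreal (a + b)" using pd c by (simp add: ennreal_mult')
  then have cab: "2 * c \<le> a + b" using a b by (subst (asm) ennreal_le_iff) auto
  then show "riesz_form l f g \<le> ennreal ?H" unfolding c(1) using a b by (intro ennreal_leI) linarith
  assume "riesz_form l f g = ennreal ?H"
  then have "c = ?H" using c H by simp
  with cab a b have abc: "a = ?H" "b = ?H" "c = ?H" by linarith+
  let ?m = "\<lambda>x. 1 / 2 * (f x + g x)"
  have "riesz_form l ?m ?m = ennreal (1 / 2 * (1 / 2)) * (riesz_form l f f + 2 * riesz_form l f g + riesz_form l g g)"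
    by (subst riesz_form_scale, simp_all add: riesz_form_add nn)
  also have "riesz_form l f f + 2 * riesz_form l f g + riesz_form l g g = ennreal (4 * ?H)"
    unfolding a(1) b(1) c(1) abc using H by (simp add: ennreal_mult'[symmetric] ennreal_plus[symmetric] ennreal_numeral[symmetric] del: ennreal_plus ennreal_numeral)
  also have "ennreal (1 / 2 * (1 / 2)) * ennreal (4 * ?H) = ennreal ?H" using H by (simp flip: ennreal_mult')
  finally have Im: "riesz_form l ?m ?m = ennreal ?H" .
  have conv: "?m x powr p \<le> 1 / 2 * (f x powr p + g x powr p)" "?m x powr p = 1 / 2 * (f x powr p + g x powr p) \<Longrightarrow> f x = g x" for x
    using powr_midpoint_less[of "f x" "g x" p] powr_midpoint_less[of "g x" "f x" p] nn p
    by (cases "f x" "g x" rule: linorder_cases; simp add: add.commute)+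
  have half: "(\<integral>\<^sup>+x. ennreal (1 / 2 * (f x powr p + g x powr p)) \<partial>lborel) = 1"
  proof -
    have "(\<integral>\<^sup>+x. ennreal (1 / 2 * (f x powr p + g x powr p)) \<partial>lborel) =
        (\<integral>\<^sup>+x. ennreal (1 / 2) * (ennreal (f x powr p) + ennreal (g x powr p)) \<partial>lborel)"
      by (intro nn_integral_cong) (simp only: ennreal_mult' ennreal_plus powr_ge_zero add_nonneg_nonneg zero_le_divide_1_iff zero_le_numeral)
    also have "\<dots> = ennreal (1 / 2) * (1 + 1)"
      by (subst nn_integral_cmult, measurable, subst nn_integral_add, measurable, simp only: 1)
    also have "1 + 1 = ennreal 2" by simp
    also have "ennreal (1 / 2) * ennreal 2 = 1" by (subst ennreal_mult'[symmetric]) simp_all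
    finally show ?thesis .
  qed
  have "(\<integral>\<^sup>+x. ennreal (?m x powr p) \<partial>lborel) \<le> 1"
    unfolding half[symmetric] using conv(1) by (intro nn_integral_mono ennreal_leI)
  then obtain R where R: "(\<integral>\<^sup>+x. ennreal (?m x powr p) \<partial>lborel) = ennreal R" "0 \<le> R" "R \<le> 1"
    by (cases "\<integral>\<^sup>+x. ennreal (?m x powr p) \<partial>lborel") (auto simp: top_unique)
  \<comment> \<open>The inequality for the midpoint, whose form is \<open>H\<close> although its
    \<open>p\<close>-mass \<open>R\<close> is at most \<open>1\<close>. This forces
    \<open>R = 1\<close>, so convexity is an equality almost everywhere.\<close>
  have "ennreal ?H \<le> ennreal (?H * R powr (2 / p))"
    unfolding Im[symmetric] by (rule riesz_form_le[OF _ _ R(1,2)]) (use nn in auto)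
  then have "?H * 1 \<le> ?H * R powr (2 / p)" using H by (subst (asm) ennreal_le_iff) auto
  then have "1 \<le> R powr (2 / p)" using H by (subst (asm) mult_le_cancel_left_pos) auto
  then have R1: "R = 1"
    using R(2,3) p powr_less_mono2[of "2 / p" R 1] by (cases "R < 1") auto
  let ?e = "\<lambda>x. 1 / 2 * (f x powr p + g x powr p) - ?m x powr p"
  have "1 = (\<integral>\<^sup>+x. ennreal (?m x powr p) + ennreal (?e x) \<partial>lborel)"
    unfolding half[symmetric] using conv(1)
    by (intro nn_integral_cong) (subst ennreal_plus[symmetric], auto)
  also have "\<dots> = 1 + (\<integral>\<^sup>+x. ennreal (?e x) \<partial>lborel)"
    by (subst nn_integral_add) (simp_all only: R R1 ennreal_1, measurable)
  finally have "1 + (\<integral>\<^sup>+x. ennreal (?e x) \<partial>lborel) \<le> 1 + (0 :: ennreal)" by simp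
  then have "(\<integral>\<^sup>+x. ennreal (?e x) \<partial>lborel) = 0" by (subst (asm) ennreal_add_left_cancel_le) simp
  then have "AE x in lborel. ennreal (?e x) = 0" by (subst (asm) nn_integral_0_iff_AE) auto
  then have "AE x in lborel. f x = g x"
    by eventually_elim (rule conv(2), rule antisym[OF conv(1)], simp add: ennreal_eq_0_iff)
  then show "(AE x in lborel. f x = g x) \<and> riesz_form l f f = ennreal ?H" using a abc by simp
qed

text \<open>Both functions are scaled to unit norm. In the equality case the normalized functions
  coincide, so one center and one scale serve both and only the factors differ.\<close>

lemma riesz_form_pair:
  fixes f g :: "real^'n \<Rightarrow> real"
  assumes [measurable]: "f \<in> borel_measurable borel" "g \<in> borel_measurable borel"
    and nn: "\<And>x. 0 \<le> f x" "\<And>x. 0 \<le> g x"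
    and P: "(\<integral>\<^sup>+x. ennreal (f x powr p) \<partial>lborel) = ennreal P" "0 < P"
    and Q: "(\<integral>\<^sup>+x. ennreal (g x powr p) \<partial>lborel) = ennreal Q" "0 < Q"
  shows "riesz_form l f g \<le> ennreal (HLS_const CARD('n) l * P powr (1 / p) * Q powr (1 / p))"
    and "riesz_form l f g = ennreal (HLS_const CARD('n) l * P powr (1 / p) * Q powr (1 / p)) \<Longrightarrow>
      \<exists>a b c c'. 0 < b \<and> 0 < c \<and> 0 < c' \<and> (AE x in lborel. f x = c * HLS_optimizer l a b x) \<and> (AE x in lborel. g x = c' * HLS_optimizer l a b x)"
proof -
  let ?H = "HLS_const CARD('n) l"
  have H: "0 < ?H" by (rule HLS_const_pos)
  define c d where "c = P powr (1 / p)" and "d = Q powr (1 / p)"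
  have cd: "0 < c" "0 < d" using P Q by (simp_all add: c_def d_def)
  let ?f = "\<lambda>x. inverse c * f x" and ?g = "\<lambda>x. inverse d * g x"
  have f1: "(\<integral>\<^sup>+x. ennreal (?f x powr p) \<partial>lborel) = 1" unfolding c_def by (rule nn_integral_normalized[OF assms(1) nn(1) P])
  have g1: "(\<integral>\<^sup>+x. ennreal (?g x powr p) \<partial>lborel) = 1" unfolding d_def by (rule nn_integral_normalized[OF assms(2) nn(2) Q])
  have nn': "0 \<le> ?f x" "0 \<le> ?g x" for x using nn cd by auto
  have sc: "riesz_form l f g = ennreal (c * d) * riesz_form l ?f ?g"
    using cd by (subst riesz_form_scale[symmetric]) (auto simp flip: mult.assoc)
  note unit = riesz_form_unit_pair[OF _ _ nn' f1 g1]
  have Hcd: "ennreal (c * d) * ennreal ?H = ennreal (?H * c * d)" using cd H by (simp add: mult_ac flip: ennreal_mult')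
  show "riesz_form l f g \<le> ennreal (?H * P powr (1 / p) * Q powr (1 / p))"
    unfolding sc c_def[symmetric] d_def[symmetric] Hcd[symmetric] by (intro mult_left_mono unit(1)) auto
  assume "riesz_form l f g = ennreal (?H * P powr (1 / p) * Q powr (1 / p))"
  then have "ennreal (c * d) * riesz_form l ?f ?g = ennreal (c * d) * ennreal ?H"
    unfolding Hcd sc c_def[symmetric] d_def[symmetric] .
  then have "riesz_form l ?f ?g = ennreal ?H"
    using mult_pos_pos[OF cd] by (subst (asm) ennreal_mult_cancel_left) (auto simp: ennreal_eq_0_iff)
  from unit(2)[OF _ _ this] have fg: "AE x in lborel. ?f x = ?g x" and ff: "riesz_form l ?f ?f = ennreal ?H" by auto
  have "\<exists>a b k. 0 < b \<and> 0 < k \<and> (AE x in lborel. ?f x = k * HLS_optimizer l a b x)"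
    by (rule riesz_form_eq_imp_optimizer[of ?f 1]) (use nn' f1 ff in auto)
  then obtain a b k where abk: "0 < b" "0 < k" "AE x in lborel. ?f x = k * HLS_optimizer l a b x" by blast
  have "AE x in lborel. f x = (c * k) * HLS_optimizer l a b x"
    using abk(3) by eventually_elim (use cd in \<open>simp add: field_simps\<close>)
  moreover have "AE x in lborel. g x = (d * k) * HLS_optimizer l a b x"
    using abk(3) fg by eventually_elim (use cd in \<open>simp add: field_simps\<close>)
  ultimately show "\<exists>a b c c'. 0 < b \<and> 0 < c \<and> 0 < c' \<and> (AE x in lborel. f x = c * HLS_optimizer l a b x) \<and> (AE x in lborel. g x = c' * HLS_optimizer l a b x)"
    using abk cd by (intro exI[of _ a] exI[of _ b] exI[of _ "c * k"] exI[of _ "d * k"]) auto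
qed

end

section \<open>Complex-valued functions\<close>

text \<open>After rotation of the integral to the nonnegative axis,
  \<open>norm (\<phi> z) - Re (cnj \<omega> * \<phi> z)\<close> is nonnegative with integral zero. A
  complex number whose real part equals its modulus is that modulus. For a vanishing integral the
  choice \<open>\<omega> = 1\<close> is harmless.\<close>

lemma norm_integral_eq_imp_constant_phase:
  fixes \<phi> :: "'a \<Rightarrow> complex"
  assumes int: "integrable M \<phi>" and eq: "norm (\<integral>z. \<phi> z \<partial>M) = (\<integral>z. norm (\<phi> z) \<partial>M)"
  shows "\<exists>\<omega>. norm \<omega> = 1 \<and> (AE z in M. \<phi> z = \<omega> * of_real (norm (\<phi> z)))"
proof -
  define Z where "Z = (\<integral>z. \<phi> z \<partial>M)"
  define \<omega> where "\<omega> = (if Z = 0 then 1 else sgn Z)"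
  have \<omega>: "norm \<omega> = 1" by (simp add: \<omega>_def norm_sgn)
  have \<omega>': "\<omega> * cnj \<omega> = 1" using complex_norm_square[of \<omega>] \<omega> by simp
  have Z: "Z = \<omega> * of_real (norm Z)" by (simp add: \<omega>_def sgn_eq)
  have "cnj \<omega> * Z = (\<omega> * cnj \<omega>) * of_real (norm Z)" by (subst Z) (simp only: mult_ac)
  then have "Re (cnj \<omega> * Z) = norm Z" using \<omega>' by simp
  moreover have "(\<integral>z. Re (cnj \<omega> * \<phi> z) \<partial>M) = Re (cnj \<omega> * Z)"
    using int by (simp add: Z_def flip: integral_Re)
  ultimately have "(\<integral>z. norm (\<phi> z) - Re (cnj \<omega> * \<phi> z) \<partial>M) = 0"
    using int eq by (simp add: Z_def Bochner_Integration.integral_diff integrable_Re)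
  moreover have "integrable M (\<lambda>z. norm (\<phi> z) - Re (cnj \<omega> * \<phi> z))" using int by (intro Bochner_Integration.integrable_diff integrable_Re integrable_mult_right integrable_norm)
  moreover have le: "Re (cnj \<omega> * \<phi> z) \<le> norm (\<phi> z)" for z
    using complex_Re_le_cmod[of "cnj \<omega> * \<phi> z"] \<omega> by (simp add: norm_mult)
  ultimately have "AE z in M. norm (\<phi> z) - Re (cnj \<omega> * \<phi> z) = 0"
    by (subst (asm) integral_nonneg_eq_0_iff_AE) auto
  then have "AE z in M. \<phi> z = \<omega> * of_real (norm (\<phi> z))"
  proof eventually_elim
    case (elim z)
    have "norm (cnj \<omega> * \<phi> z) = norm (\<phi> z)" using \<omega> by (simp add: norm_mult)
    with elim have "Re (cnj \<omega> * \<phi> z) = norm (cnj \<omega> * \<phi> z)" by simp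
    then have "cnj \<omega> * \<phi> z = of_real (norm (\<phi> z))"
      using elim cmod_power2[of "cnj \<omega> * \<phi> z"] by (intro complex_eqI) auto
    then have "\<omega> * cnj \<omega> * \<phi> z = \<omega> * of_real (norm (\<phi> z))" by (simp add: mult.assoc)
    then show ?case using \<omega>' by simp
  qed
  with \<omega> show ?thesis by blast
qed

text \<open>Iterated integrals over the product of two completed measures rest on this. A countable
  Borel cover by sets of finite measure remains one in the completion.\<close>

lemma sigma_finite_lebesgue: "sigma_finite_measure (lebesgue :: 'a::euclidean_space measure)"
proof
  obtain A :: "'a set set" where "countable A" "A \<subseteq> sets lborel" "\<Union>A = space lborel" "\<forall>a\<in>A. emeasure lborel a \<noteq> \<infinity>"
    using lborel.sigma_finite_countable by blast
  then show "\<exists>A. countable A \<and> A \<subseteq> sets (lebesgue :: 'a measure) \<and> \<Union>A = space lebesgue \<and> (\<forall>a\<in>A. emeasure lebesgue a \<noteq> \<infinity>)"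
    by (intro exI[of _ A]) (auto simp: emeasure_completion subset_iff)
qed

lemma HLS_integrand_measurable:
  fixes f g :: "'a::euclidean_space \<Rightarrow> complex"
  assumes "f \<in> borel_measurable lebesgue" "g \<in> borel_measurable lebesgue"
  shows "HLS_integrand l f g \<in> borel_measurable (lebesgue \<Otimes>\<^sub>M lebesgue)"
proof -
  let ?M = "lebesgue \<Otimes>\<^sub>M lebesgue :: ('a \<times> 'a) measure"
  have id: "(\<lambda>x. x) \<in> lebesgue \<rightarrow>\<^sub>M (borel :: 'a measure)" by (rule measurable_completion) simp
  have d: "(\<lambda>z. fst z - snd z) \<in> borel_measurable ?M"
    using measurable_compose[OF measurable_fst id] measurable_compose[OF measurable_snd id]
    by (rule borel_measurable_diff)
  have "(\<lambda>z. complex_of_real (norm (fst z - snd z) powr l)) \<in> borel_measurable ?M"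
    by (rule measurable_compose[OF d, of "\<lambda>v. complex_of_real (norm v powr l)"]) measurable
  moreover have "(\<lambda>z. cnj (f (fst z))) \<in> borel_measurable ?M"
    by (rule measurable_compose[OF measurable_compose[OF measurable_fst assms(1)], of cnj])
       (intro borel_measurable_continuous_onI continuous_intros)
  moreover have "(\<lambda>z. g (snd z)) \<in> borel_measurable ?M"
    by (rule measurable_compose[OF measurable_snd assms(2)])
  ultimately show ?thesis unfolding HLS_integrand_def split_beta'
    by (intro borel_measurable_divide borel_measurable_times)
qed

lemma norm_HLS_integrand: "norm (HLS_integrand l f g (x, y)) = norm (f x) * norm (g y) * norm (x - y) powr (- l)"
  by (simp add: HLS_integrand_def norm_mult norm_divide powr_minus_divide)

lemma nn_integral_norm_HLS_integrand:
  assumes meas: "f \<in> borel_measurable lebesgue" "g \<in> borel_measurable lebesgue"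
    and f0: "AE x in lborel. norm (f x) = f0 x" and g0: "AE x in lborel. norm (g x) = g0 x"
  shows "(\<integral>\<^sup>+z. ennreal (norm (HLS_integrand l f g z)) \<partial>(lebesgue \<Otimes>\<^sub>M lebesgue)) = riesz_form l f0 g0"
proof -
  interpret sigma_finite_measure "lebesgue :: 'a measure" by (rule sigma_finite_lebesgue)
  have "(\<integral>\<^sup>+z. ennreal (norm (HLS_integrand l f g z)) \<partial>(lebesgue \<Otimes>\<^sub>M lebesgue)) =
      (\<integral>\<^sup>+x. \<integral>\<^sup>+y. ennreal (norm (HLS_integrand l f g (x, y))) \<partial>lebesgue \<partial>lebesgue)"
    using HLS_integrand_measurable[OF meas] by (intro nn_integral_fst[symmetric]) measurable
  also have "\<dots> = riesz_form l (\<lambda>x. norm (f x)) (\<lambda>x. norm (g x))"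
    unfolding nn_integral_completion norm_HLS_integrand riesz_form_def ..
  also have "\<dots> = riesz_form l f0 g0" by (rule riesz_form_cong_AE[OF f0 g0])
  finally show ?thesis .
qed

text \<open>Elements of the space are Lebesgue measurable, while the estimates of the form are
  stated for Borel functions that are nonnegative everywhere. Completion supplies a Borel
  representative of the modulus, and its absolute value is nonnegative at every point.\<close>

lemma Lp_space_borel_modulus:
  fixes f :: "'a::euclidean_space \<Rightarrow> complex"
  assumes f: "f \<in> Lp_space p"
  obtains f0 where "f0 \<in> borel_measurable borel" "\<And>x. 0 \<le> f0 x" "AE x in lborel. norm (f x) = f0 x"
    "(\<integral>\<^sup>+x. ennreal (f0 x powr p) \<partial>lborel) = ennreal (\<integral>x. norm (f x) powr p \<partial>lebesgue)"
proof -
  have fm: "f \<in> borel_measurable lebesgue" and fi: "integrable lebesgue (\<lambda>x. norm (f x) powr p)"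
    using f by (auto simp: Lp_space_def)
  from fm have "(\<lambda>x. norm (f x)) \<in> borel_measurable (completion lborel)" by measurable
  then obtain g where g: "g \<in> borel_measurable lborel" "AE x in lborel. norm (f x) = g x"
    by (blast dest: completion_ex_borel_measurable_real)
  have ae: "AE x in lborel. norm (f x) = \<bar>g x\<bar>" using g(2) by eventually_elim (metis abs_norm_cancel)
  have "(\<integral>\<^sup>+x. ennreal (\<bar>g x\<bar> powr p) \<partial>lborel) = (\<integral>\<^sup>+x. ennreal (norm (f x) powr p) \<partial>lborel)"
    by (intro nn_integral_cong_AE eventually_mono[OF ae]) simp
  also have "\<dots> = (\<integral>\<^sup>+x. ennreal (norm (f x) powr p) \<partial>lebesgue)" by (simp add: nn_integral_completion)
  also have "\<dots> = ennreal (\<integral>x. norm (f x) powr p \<partial>lebesgue)" by (intro nn_integral_eq_integral fi) auto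
  finally show thesis using g(1) ae by (intro that[of "\<lambda>x. \<bar>g x\<bar>"]) auto
qed

text \<open>The integral of \<open>norm (HLS_integrand l f g z)\<close> is the form of the moduli,
  which reduces integrability and the bound to nonnegative functions. In the equality case two
  estimates are sharp: the one for the moduli determines \<open>norm (f x)\<close> and
  \<open>norm (g x)\<close> up to factors, and the triangle inequality for integrals gives the
  integrand a constant phase, from which the phases of \<open>f\<close> and \<open>g\<close> are
  read off.\<close>

theorem theorem2p1:
  fixes f g :: "real ^ 'n \<Rightarrow> complex" and l p :: real
  assumes "CARD('n) \<le> 2 \<Longrightarrow> 0 < l"
    and "CARD('n) \<ge> 3 \<Longrightarrow> real CARD('n) - 2 \<le> l"
    and "l < real CARD('n)"
    and "p = 2 * real CARD('n) / (2 * real CARD('n) - l)"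
    and "f \<in> Lp_space p" and "g \<in> Lp_space p"
  shows "integrable (lebesgue \<Otimes>\<^sub>M lebesgue) (HLS_integrand l f g)
    \<and> norm (\<integral>z. HLS_integrand l f g z \<partial>(lebesgue \<Otimes>\<^sub>M lebesgue))
        \<le> HLS_const CARD('n) l * Lp_norm p f * Lp_norm p g
    \<and> (norm (\<integral>z. HLS_integrand l f g z \<partial>(lebesgue \<Otimes>\<^sub>M lebesgue))
          = HLS_const CARD('n) l * Lp_norm p f * Lp_norm p g
        \<longleftrightarrow> (AE x in lebesgue. f x = 0) \<or> (AE x in lebesgue. g x = 0)
          \<or> (\<exists>(a :: real ^ 'n) (b :: real) (c :: complex) (c' :: complex). b > 0
               \<and> (AE x in lebesgue. f x = c * of_real (HLS_optimizer l a b x))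
               \<and> (AE x in lebesgue. g x = c' * of_real (HLS_optimizer l a b x))))"
proof -
  let ?H = "HLS_const CARD('n) l" and ?M = "lebesgue \<Otimes>\<^sub>M lebesgue :: ((real^'n) \<times> (real^'n)) measure"
  let ?\<Phi> = "HLS_integrand l f g"
  \<comment> \<open>In dimension at least 3 the lower bound \<open>N - 2\<close> is at least
    \<open>1\<close>, so \<open>l\<close> is positive in every case.\<close>
  have l: "0 < l" "l < real CARD('n)" using assms(1-3) by (cases "CARD('n) \<le> 2"; linarith)+
  have pq: "p * (2 * real CARD('n) - l) = 2 * real CARD('n)"
    using l unfolding assms(4) by (subst nonzero_divide_eq_eq[symmetric]) auto
  have p: "1 < p" by (rule p_gt_1[OF l pq])
  have H: "0 < ?H" by (rule HLS_const_pos[OF l pq])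
  interpret lebesgue: sigma_finite_measure "lebesgue :: (real^'n) measure" by (rule sigma_finite_lebesgue)
  interpret pair_sigma_finite "lebesgue :: (real^'n) measure" "lebesgue :: (real^'n) measure" ..
  have meas: "f \<in> borel_measurable lebesgue" "g \<in> borel_measurable lebesgue" using assms(5,6) by (auto simp: Lp_space_def)
  note \<Phi>_meas = HLS_integrand_measurable[OF meas, of l]
  define P Q where "P = (\<integral>x. norm (f x) powr p \<partial>lebesgue)" and "Q = (\<integral>x. norm (g x) powr p \<partial>lebesgue)"
  obtain f0 where f0: "f0 \<in> borel_measurable borel" "\<And>x. 0 \<le> f0 x" "AE x in lborel. norm (f x) = f0 x"
    "(\<integral>\<^sup>+x. ennreal (f0 x powr p) \<partial>lborel) = ennreal P"
    using Lp_space_borel_modulus[OF assms(5)] unfolding P_def by blast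
  obtain g0 where g0: "g0 \<in> borel_measurable borel" "\<And>x. 0 \<le> g0 x" "AE x in lborel. norm (g x) = g0 x"
    "(\<integral>\<^sup>+x. ennreal (g0 x powr p) \<partial>lborel) = ennreal Q"
    using Lp_space_borel_modulus[OF assms(6)] unfolding Q_def by blast
  have PQ: "0 \<le> P" "0 \<le> Q" by (simp_all add: P_def Q_def)
  have norms: "Lp_norm p f = P powr (1 / p)" "Lp_norm p g = Q powr (1 / p)" by (simp_all add: Lp_norm_def P_def Q_def)
  have nnI: "(\<integral>\<^sup>+z. ennreal (norm (?\<Phi> z)) \<partial>?M) = riesz_form l f0 g0"
    by (rule nn_integral_norm_HLS_integrand[OF meas f0(3) g0(3)])
  have fzero: "AE x in lebesgue. f x = 0" if "P = 0"
  proof -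
    have "AE x in lborel. f0 x = 0" by (rule AE_zero_if_norm_zero[OF f0(1,2)]) (use f0(4) that in simp)
    with f0(3) have "AE x in lborel. f x = 0" by eventually_elim simp
    then show ?thesis by (simp add: AE_completion_iff)
  qed
  have gzero: "AE x in lebesgue. g x = 0" if "Q = 0"
  proof -
    have "AE x in lborel. g0 x = 0" by (rule AE_zero_if_norm_zero[OF g0(1,2)]) (use g0(4) that in simp)
    with g0(3) have "AE x in lborel. g x = 0" by eventually_elim simp
    then show ?thesis by (simp add: AE_completion_iff)
  qed
  have le: "riesz_form l f0 g0 \<le> ennreal (?H * P powr (1 / p) * Q powr (1 / p))"
  proof (cases "0 < P \<and> 0 < Q")
    case True
    then show ?thesis using f0 g0 by (intro riesz_form_pair[OF l pq]) auto
  next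
    case False
    then have "(AE x in lborel. f0 x = 0) \<or> (AE x in lborel. g0 x = 0)"
      using AE_zero_if_norm_zero[OF f0(1,2), of p] AE_zero_if_norm_zero[OF g0(1,2), of p] f0(4) g0(4) PQ by auto
    then have "riesz_form l f0 g0 = 0"
    proof
      assume "AE x in lborel. f0 x = 0"
      from riesz_form_cong_AE[OF this AE_I2[OF refl], of l g0] show ?thesis by (simp add: riesz_form_def)
    next
      assume "AE x in lborel. g0 x = 0"
      from riesz_form_cong_AE[OF AE_I2[OF refl] this, of l f0] show ?thesis by (simp add: riesz_form_def)
    qed
    then show ?thesis by simp
  qed
  have int: "integrable ?M ?\<Phi>"
    by (rule integrableI_bounded[OF \<Phi>_meas]) (use le in \<open>simp add: nnI le_less_trans\<close>)
  define T where "T = (\<integral>z. norm (?\<Phi> z) \<partial>?M)"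
  have T: "riesz_form l f0 g0 = ennreal T" "0 \<le> T"
    unfolding nnI[symmetric] T_def using int by (auto intro!: nn_integral_eq_integral integral_nonneg_AE)
  have T_le: "T \<le> ?H * Lp_norm p f * Lp_norm p g"
    using le H unfolding T(1) norms by (subst (asm) ennreal_le_iff) auto
  have norm_le: "norm (\<integral>z. ?\<Phi> z \<partial>?M) \<le> T" unfolding T_def by (rule integral_norm_bound)
  have bound: "norm (\<integral>z. ?\<Phi> z \<partial>?M) \<le> ?H * Lp_norm p f * Lp_norm p g" using norm_le T_le by simp
  have eq_iff: "norm (\<integral>z. ?\<Phi> z \<partial>?M) = ?H * Lp_norm p f * Lp_norm p g
        \<longleftrightarrow> (AE x in lebesgue. f x = 0) \<or> (AE x in lebesgue. g x = 0)
          \<or> (\<exists>(a :: real ^ 'n) (b :: real) (c :: complex) (c' :: complex). b > 0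
               \<and> (AE x in lebesgue. f x = c * of_real (HLS_optimizer l a b x))
               \<and> (AE x in lebesgue. g x = c' * of_real (HLS_optimizer l a b x)))" (is "?L \<longleftrightarrow> ?R")
  proof
    assume eq: ?L
    show ?R
    proof (cases "0 < P \<and> 0 < Q")
      case False
      then show ?thesis using fzero gzero PQ by auto
    next
      case True
      have T_eq: "T = ?H * P powr (1 / p) * Q powr (1 / p)" using eq norm_le T_le unfolding norms by linarith
      obtain a b c c' where abc: "0 < b" "0 < c" "0 < c'"
        and fo: "AE x in lborel. f0 x = c * HLS_optimizer l a b x" and go: "AE x in lborel. g0 x = c' * HLS_optimizer l a b x"
        using riesz_form_pair(2)[OF l pq f0(1) g0(1) f0(2) g0(2) f0(4) _ g0(4)] True T(1) unfolding T_eq by blast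
      have hpos: "0 < HLS_optimizer l a b x" for x :: "real^'n" by (rule HLS_optimizer_pos[OF abc(1)])
      have fn: "AE x in lborel. norm (f x) = c * HLS_optimizer l a b x" using f0(3) fo by eventually_elim simp
      have gn: "AE x in lborel. norm (g x) = c' * HLS_optimizer l a b x" using g0(3) go by eventually_elim simp
      have "norm (\<integral>z. ?\<Phi> z \<partial>?M) = (\<integral>z. norm (?\<Phi> z) \<partial>?M)" using eq norm_le T_le unfolding T_def[symmetric] by linarith
      from norm_integral_eq_imp_constant_phase[OF int this] obtain \<omega> where \<omega>: "norm \<omega> = 1"
        and ph: "AE z in ?M. ?\<Phi> z = \<omega> * of_real (norm (?\<Phi> z))" by blast
      have phase: "AE x in lborel. AE y in lborel. cnj (f x) * g y = \<omega> * of_real (norm (f x) * norm (g y))"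
      proof -
        have "AE x in lborel. AE y in lborel. ?\<Phi> (x, y) = \<omega> * of_real (norm (?\<Phi> (x, y)))"
          using AE_pair[OF ph] by (simp add: AE_completion_iff)
        then show ?thesis
        proof eventually_elim
          case (elim x)
          from elim AE_lborel_singleton[of x] show ?case
          proof eventually_elim
            case (elim y)
            define k where "k = norm (x - y) powr l"
            have k: "0 < k" using elim by (simp add: k_def)
            have "cnj (f x) * g y / of_real k = \<omega> * of_real (norm (f x) * norm (g y) / k)"
              using elim(1) k by (simp add: HLS_integrand_def norm_divide norm_mult k_def)
            then show ?case using k by (simp add: field_simps)
          qed
        qed
      qed
      \<comment> \<open>Freezing one point with \<open>f x0 \<noteq> 0\<close> turns the joint phase
        relation into a constant phase \<open>\<kappa>\<close> for \<open>g\<close>.\<close>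
      have "\<exists>x0. f x0 \<noteq> 0 \<and> (AE y in lborel. cnj (f x0) * g y = \<omega> * of_real (norm (f x0) * norm (g y)))"
      proof (rule AE_lborel_ex)
        show "AE x in lborel. f x \<noteq> 0 \<and> (AE y in lborel. cnj (f x) * g y = \<omega> * of_real (norm (f x) * norm (g y)))"
          using fn phase
        proof eventually_elim
          case (elim x)
          have "0 < norm (f x)" unfolding elim(1) using abc hpos by simp
          then show ?case using elim(2) by simp
        qed
      qed
      then obtain x0 where x0: "f x0 \<noteq> 0" "AE y in lborel. cnj (f x0) * g y = \<omega> * of_real (norm (f x0) * norm (g y))" by blast
      define \<kappa> where "\<kappa> = \<omega> * of_real (norm (f x0)) / cnj (f x0)"
      have \<kappa>: "\<kappa> \<noteq> 0" using x0(1) \<omega> by (auto simp: \<kappa>_def)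
      have gk: "AE y in lborel. g y = \<kappa> * of_real (norm (g y))"
        using x0(2) by eventually_elim (use x0(1) in \<open>simp add: \<kappa>_def field_simps\<close>)
      \<comment> \<open>For almost every \<open>x\<close> one good \<open>y\<close> with
        \<open>g y \<noteq> 0\<close> suffices to solve the phase relation for the phase of
        \<open>f x\<close>.\<close>
      have fk: "AE x in lborel. f x = cnj (\<omega> / \<kappa>) * of_real (norm (f x))"
        using phase
      proof eventually_elim
        case (elim x)
        have "\<exists>y. cnj (f x) * g y = \<omega> * of_real (norm (f x) * norm (g y)) \<and> g y = \<kappa> * of_real (norm (g y)) \<and> norm (g y) = c' * HLS_optimizer l a b y"
          by (rule AE_lborel_ex) (use elim gk gn in \<open>auto elim: eventually_elim2\<close>)
        then obtain y where y: "cnj (f x) * g y = \<omega> * of_real (norm (f x) * norm (g y))" "g y = \<kappa> * of_real (norm (g y))"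
          "norm (g y) = c' * HLS_optimizer l a b y" by blast
        define m where "m = norm (g y)"
        have m: "0 < m" unfolding m_def y(3) using abc hpos by simp
        have "cnj (f x) * (\<kappa> * of_real m) = \<omega> * of_real (norm (f x) * m)" using y(1,2) unfolding m_def by metis
        then have "cnj (f x) = \<omega> / \<kappa> * of_real (norm (f x))" using m \<kappa> by (simp add: field_simps)
        then have "cnj (cnj (f x)) = cnj (\<omega> / \<kappa> * of_real (norm (f x)))" by simp
        then show ?case by (simp only: complex_cnj_cnj complex_cnj_mult complex_cnj_complex_of_real)
      qed
      have "AE x in lebesgue. f x = (cnj (\<omega> / \<kappa>) * of_real c) * of_real (HLS_optimizer l a b x)"
        unfolding AE_completion_iff using fk fn by eventually_elim (metis mult.assoc of_real_mult)
      moreover have "AE x in lebesgue. g x = (\<kappa> * of_real c') * of_real (HLS_optimizer l a b x)"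
        unfolding AE_completion_iff using gk gn by eventually_elim (metis mult.assoc of_real_mult)
      ultimately show ?thesis using abc(1) by blast
    qed
  next
    assume R: ?R
    show ?L
    proof (cases "P = 0 \<or> Q = 0")
      case True
      \<comment> \<open>With a vanishing norm the bound is zero, so the integral is zero as
        well.\<close>
      then have "?H * Lp_norm p f * Lp_norm p g = 0" using p by (auto simp: norms)
      then show ?thesis
        using bound norm_ge_zero[of "\<integral>z. ?\<Phi> z \<partial>?M"] by linarith
    next
      case False
      have "\<not> (AE x in lebesgue. f x = 0)"
      proof
        assume "AE x in lebesgue. f x = 0"
        then have "P = (\<integral>x. 0 \<partial>(lebesgue :: (real^'n) measure))"
          unfolding P_def using meas by (intro integral_cong_AE) (auto elim: eventually_mono)
        with False show False by simp
      qed
      moreover have "\<not> (AE x in lebesgue. g x = 0)"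
      proof
        assume "AE x in lebesgue. g x = 0"
        then have "Q = (\<integral>x. 0 \<partial>(lebesgue :: (real^'n) measure))"
          unfolding Q_def using meas by (intro integral_cong_AE) (auto elim: eventually_mono)
        with False show False by simp
      qed
      ultimately obtain a :: "real^'n" and b c c' where b: "0 < b"
        and fo: "AE x in lebesgue. f x = c * of_real (HLS_optimizer l a b x)"
        and go: "AE x in lebesgue. g x = c' * of_real (HLS_optimizer l a b x)" using R by blast
      let ?h = "HLS_optimizer l a b"
      have hpos: "0 < ?h x" for x :: "real^'n" by (rule HLS_optimizer_pos[OF b])
      have fn: "AE x in lborel. f0 x = norm c * ?h x"
        using fo[unfolded AE_completion_iff] f0(3) by eventually_elim (use hpos in \<open>simp add: norm_mult less_imp_le\<close>)
      have gn: "AE x in lborel. g0 x = norm c' * ?h x"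
        using go[unfolded AE_completion_iff] g0(3) by eventually_elim (use hpos in \<open>simp add: norm_mult less_imp_le\<close>)
      obtain W where W: "0 < W" "(\<integral>\<^sup>+x. ennreal (?h x powr p) \<partial>lborel) = ennreal W"
        "riesz_form l ?h ?h = ennreal (?H * W powr (2 / p))" using riesz_form_optimizer[OF b l pq] by blast
      have Lp: "R powr (1 / p) = k * W powr (1 / p)"
        if u: "AE x in lborel. u x = k * ?h x" and k: "0 \<le> k" and R: "(\<integral>\<^sup>+x. ennreal (u x powr p) \<partial>lborel) = ennreal R" "0 \<le> R"
        for u and k R :: real
      proof -
        have "ennreal R = (\<integral>\<^sup>+x. ennreal (k powr p) * ennreal (?h x powr p) \<partial>lborel)"
          unfolding R(1)[symmetric]
          by (intro nn_integral_cong_AE eventually_mono[OF u]) (use k hpos in \<open>simp add: powr_mult ennreal_mult' less_imp_le\<close>)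
        also have "\<dots> = ennreal (k powr p * W)" by (simp add: nn_integral_cmult W ennreal_mult')
        finally have "R = k powr p * W" using R W by simp
        then show ?thesis using k W p by (simp add: powr_mult powr_powr)
      qed
      have "ennreal T = ennreal (norm c * norm c') * riesz_form l ?h ?h"
        unfolding T(1)[symmetric] riesz_form_cong_AE[OF fn gn] by (rule riesz_form_scale) auto
      also have "\<dots> = ennreal (norm c * norm c' * (?H * W powr (2 / p)))" unfolding W(3) by (simp add: ennreal_mult')
      finally have "T = norm c * norm c' * (?H * W powr (2 / p))" using T(2) H by simp
      also have "W powr (2 / p) = W powr (1 / p) * W powr (1 / p)" by (simp flip: powr_add)
      finally have T_eq: "T = ?H * Lp_norm p f * Lp_norm p g"
        unfolding norms Lp[OF fn _ f0(4) PQ(1), simplified] Lp[OF gn _ g0(4) PQ(2), simplified] by simp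
      \<comment> \<open>The integrand is \<open>cnj c * c'\<close> times a nonnegative function, so
        its phase is constant and passing to the modulus under the integral loses nothing. The
        relation is kept free of division until the factor is known to be nonzero.\<close>
      have "AE z in ?M. ?\<Phi> z * of_real (norm (cnj c * c')) = (cnj c * c') * of_real (norm (?\<Phi> z))"
      proof (rule AE_pair_measure)
        show "{z \<in> space ?M. ?\<Phi> z * of_real (norm (cnj c * c')) = (cnj c * c') * of_real (norm (?\<Phi> z))} \<in> sets ?M"
          using \<Phi>_meas by measurable
        show "AE x in lebesgue. AE y in lebesgue. ?\<Phi> (x, y) * of_real (norm (cnj c * c')) = (cnj c * c') * of_real (norm (?\<Phi> (x, y)))"
          using fo
        proof eventually_elim
          case (elim x)
          from go show ?case
          proof eventually_elim
            case (elim y)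
            define k where "k = ?h x * ?h y / norm (x - y) powr l"
            have k: "0 \<le> k" using hpos[of x] hpos[of y] by (simp add: k_def)
            have "?\<Phi> (x, y) = cnj c * c' * of_real k"
              using elim \<open>f x = c * of_real (?h x)\<close> by (simp add: HLS_integrand_def k_def)
            then show ?case using k by (simp add: norm_mult)
          qed
        qed
      qed
      then have "(\<integral>z. ?\<Phi> z * of_real (norm (cnj c * c')) \<partial>?M) = (\<integral>z. (cnj c * c') * of_real (norm (?\<Phi> z)) \<partial>?M)"
        by (intro integral_cong_AE borel_measurable_integrable integrable_mult_left integrable_mult_right
            integrable_of_real integrable_norm int)
      then have "(\<integral>z. ?\<Phi> z \<partial>?M) * of_real (norm (cnj c * c')) = (cnj c * c') * of_real T"
        unfolding T_def using int by (simp add: integral_complex_of_real)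
      then have "norm ((\<integral>z. ?\<Phi> z \<partial>?M) * of_real (norm (cnj c * c'))) = norm ((cnj c * c') * of_real T)" by simp
      then have "norm (\<integral>z. ?\<Phi> z \<partial>?M) * norm (cnj c * c') = T * norm (cnj c * c')"
        using T(2) by (simp add: norm_mult)
      moreover have "norm (cnj c * c') \<noteq> 0"
        using fo go \<open>\<not> (AE x in lebesgue. f x = 0)\<close> \<open>\<not> (AE x in lebesgue. g x = 0)\<close> by auto
      ultimately show ?thesis unfolding T_eq[symmetric] by simp
    qed
  qed
  show ?thesis using int bound eq_iff by blast
qed

end
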